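(* If $G$ is a $4$-edge-connected graph and $A$ is a finite abelian group, then $G$ is $A$-flow-connected whenever $|A|\ge 62(56^2\cdot 27+27)+1=5{,}251{,}339$.
   Context: Graphs are finite; parallel edges are allowed. A cycle is a connected 2-regular graph (two parallel edges form a cycle of length 2). Fix an arbitrary orientation $D$ of $G$; for a vertex $v$ let $E_D^+(v)$ and $E_D^-(v)$ be the sets of edges directed out of and into $v$. An $A$-flow on $G$ (always nowhere-zero here) is a function $f:E(G)\to A\setminus\{0_A\}$ with $\sum_{e\in E_D^+(v)}f(e)-\sum_{e\in E_D^-(v)}f(e)=0_A$ for every vertex $v$. (Flows given with different orientations are identified by negating the value of every edge whose orientation is reversed, so the choice of $D$ does not matter.) Two $A$-flows $f',f''$ are adjacent if there is a cycle $C$ in $G$ such that $f'(e)=f''(e)$ for all $e\notin E(C)$, and equivalent if they are joined by a finite sequence of $A$-flows in which consecutive flows are adjacent. $G$ is $A$-flow-connected if all its $A$-flows are pairwise equivalent. *)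

theory Defs
  imports Main "HOL-Library.FuncSet" "HOL-Library.Cardinality" "Graph_Theory.Digraph"
begin

record ('v, 'e) multigraph =
  vertices :: "'v set"
  edges :: "'e set"
  ends :: "'e \<Rightarrow> 'v set"

text \<open>Finite graphs; parallel edges are allowed, loops are not: every edge has exactly two
  ends.\<close>

definition multigraph :: "('v, 'e) multigraph \<Rightarrow> bool" where
  "multigraph G \<longleftrightarrow> finite (vertices G) \<and> finite (edges G) \<and>
     (\<forall>e\<in>edges G. ends G e \<subseteq> vertices G \<and> card (ends G e) = 2)"

definition adj_rel :: "('v, 'e) multigraph \<Rightarrow> ('v \<times> 'v) set" where
  "adj_rel G = {(u, v). \<exists>e\<in>edges G. ends G e = {u, v}}"

definition connected_graph :: "('v, 'e) multigraph \<Rightarrow> bool" where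
  "connected_graph G \<longleftrightarrow> vertices G \<noteq> {} \<and>
     (\<forall>u\<in>vertices G. \<forall>v\<in>vertices G. (u, v) \<in> (adj_rel G)\<^sup>*)"

definition degree :: "('v, 'e) multigraph \<Rightarrow> 'v \<Rightarrow> nat" where
  "degree G v = card {e \<in> edges G. v \<in> ends G e}"

definition delete_edges :: "('v, 'e) multigraph \<Rightarrow> 'e set \<Rightarrow> ('v, 'e) multigraph" where
  "delete_edges G F = G\<lparr>edges := edges G - F\<rparr>"

text \<open>The one-vertex graph is k-edge-connected for every k under this convention.\<close>

definition edge_connected :: "nat \<Rightarrow> ('v, 'e) multigraph \<Rightarrow> bool" where
  "edge_connected k G \<longleftrightarrow> connected_graph G \<and>
     (\<forall>F \<subseteq> edges G. card F < k \<longrightarrow> connected_graph (delete_edges G F))"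

definition is_subgraph :: "('v, 'e) multigraph \<Rightarrow> ('v, 'e) multigraph \<Rightarrow> bool" where
  "is_subgraph H G \<longleftrightarrow> multigraph H \<and> vertices H \<subseteq> vertices G \<and> edges H \<subseteq> edges G \<and>
     (\<forall>e\<in>edges H. ends H e = ends G e)"

definition is_cycle :: "('v, 'e) multigraph \<Rightarrow> bool" where
  "is_cycle C \<longleftrightarrow> multigraph C \<and> connected_graph C \<and> (\<forall>v\<in>vertices C. degree C v = 2)"

definition orientation_of :: "('v, 'e) pre_digraph \<Rightarrow> ('v, 'e) multigraph \<Rightarrow> bool" where
  "orientation_of D G \<longleftrightarrow> verts D = vertices G \<and> arcs D = edges G \<and>
     (\<forall>e\<in>edges G. {tail D e, head D e} = ends G e)"

text \<open>Nowhere-zero flows with respect to an orientation \<open>D\<close>. The extensional function space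
  makes a flow a function on the edge set only.\<close>

definition flows :: "('v, 'e) pre_digraph \<Rightarrow> ('e \<Rightarrow> 'a::ab_group_add) set" where
  "flows D = {f \<in> arcs D \<rightarrow>\<^sub>E (UNIV - {0}).
     \<forall>v\<in>verts D. (\<Sum>e\<in>out_arcs D v. f e) - (\<Sum>e\<in>in_arcs D v. f e) = 0}"

definition adjacent_flows ::
  "('v, 'e) multigraph \<Rightarrow> ('v, 'e) pre_digraph \<Rightarrow>
     ('e \<Rightarrow> 'a::ab_group_add) \<Rightarrow> ('e \<Rightarrow> 'a) \<Rightarrow> bool" where
  "adjacent_flows G D f f' \<longleftrightarrow> f \<in> flows D \<and> f' \<in> flows D \<and>
     (\<exists>C. is_cycle C \<and> is_subgraph C G \<and> (\<forall>e\<in>edges G - edges C. f e = f' e))"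

definition equivalent_flows ::
  "('v, 'e) multigraph \<Rightarrow> ('v, 'e) pre_digraph \<Rightarrow>
     ('e \<Rightarrow> 'a::ab_group_add) \<Rightarrow> ('e \<Rightarrow> 'a) \<Rightarrow> bool" where
  "equivalent_flows G D = (adjacent_flows G D)\<^sup>*\<^sup>*"

text \<open>Reversing an edge and negating its value preserves flows and adjacency, so it is
  immaterial which orientation is used; the definition asks for all of them. The group is
  passed as a type.\<close>

definition flow_connected ::
  "'a::ab_group_add itself \<Rightarrow> ('v, 'e) multigraph \<Rightarrow> bool" where
  "flow_connected A G \<longleftrightarrow> (\<forall>D. orientation_of D G \<longrightarrow>
     (\<forall>f\<in>flows D. \<forall>f'\<in>flows D. equivalent_flows G D f (f' :: 'e \<Rightarrow> 'a)))"

end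

theory Submission
  imports Defs
begin

text \<open>
  Adding \<open>b\<close> times a circulation with values in \<open>{-1, 0, 1}\<close> to a flow can be done one directed cycle
  at a time, and then every edge changes at most once. So such a shift is a legal sequence of steps as
  soon as the flows before and after it are nowhere zero, and it suffices to join any two flows by shifts.
  This is proved for all loopless graphs in which every cut has at least four edges, by induction on the
  number of vertices (\<open>any_two_flows_joined\<close>). There are two reductions.

  Contraction (\<open>reach_of_contraction\<close>). Let \<open>U\<close> be a vertex set spanned by two edge-disjoint connected
  subgraphs with union \<open>H\<close>, and suppose that on \<open>H\<close> both flows avoid the sums \<open>i b1 + j b2\<close> with
  \<open>|i|, |j| \<le> 1\<close>. A sequence of flows of the graph with \<open>U\<close> contracted lifts to circulations that may
  vanish on \<open>H\<close>. What is really moved is such a circulation plus two adjustments inside \<open>H\<close>, one built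
  from \<open>b1, b2\<close> and one from independent elements \<open>c1, c2\<close>. An adjustment is safe if no choice of the
  other one produces a zero. Closing edges of one connected subgraph through the other prescribes the
  parity of a circulation on the first, so safe adjustments always exist (\<open>safe_exists\<close>), and while one
  adjustment is safe the other can be replaced at will. Making them safe in turn, before each cycle for the
  circulation that comes next, carries the flow along the whole lifted sequence.

  Splitting (\<open>sparse_step\<close>). Suppose that at a vertex of degree four the flow passes straight from \<open>e1\<close> to \<open>e2\<close>
  and from \<open>e3\<close> to \<open>e4\<close>. Then it is a flow of the smaller graph in which each of the two pairs has become
  one edge. A given flow is made straight by shifting two edge-disjoint cycles, leaving the vertex through
  \<open>e1\<close> and \<open>e2\<close>, by two amounts whose sum is the negative of the outflow on these edges. If \<open>X + Y\<close> is the whole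
  group, the amounts can be taken from \<open>X + s\<close> and \<open>Y - s\<close>, and for some \<open>s\<close> only few edges carry values that
  block these shifts.

  One of the reductions always applies. Two parallel edges can be contracted. If \<open>4 |E| \<ge> 9 |V|\<close>, then after
  deleting the few edges with unsuitable values there are still at least \<open>2 |V| - 2\<close> edges, and a minimal vertex set
  that induces this many is spanned by two disjoint connected subgraphs (\<open>dense_doubly_connected\<close>). Otherwise more
  than half of the vertices have degree four. Deleting a set \<open>W\<close> of edges creates at most \<open>|W|\<close> bridges
  (\<open>card_bridges_le\<close>), so some vertex of degree four meets no deleted edge and no bridge. At most one of
  its three pairings creates a cut with fewer than four edges and at most one admits no two disjoint cycles,
  which leaves a good pairing (\<open>good_pairing\<close>).
\<close>

section \<open>Integer multiples in an abelian group\<close>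

primrec nmul :: "nat \<Rightarrow> 'a::ab_group_add \<Rightarrow> 'a" where
  "nmul 0 a = 0"
| "nmul (Suc n) a = a + nmul n a"

definition zmul :: "int \<Rightarrow> 'a::ab_group_add \<Rightarrow> 'a" where
  "zmul k a = nmul (nat k) a - nmul (nat (- k)) a"

lemma zmul_simps [simp]: "zmul 0 a = 0" "zmul 1 a = a" "zmul (-1) a = - a"
  by (simp_all add: zmul_def)

lemma zmul_plus_one: "zmul (k + 1) a = zmul k a + a"
proof (cases "k \<ge> 0")
  case True
  then have "nat (k + 1) = Suc (nat k)" "nat (- (k + 1)) = 0" "nat (- k) = 0" by auto
  then show ?thesis by (simp add: zmul_def)
next
  case False
  then have "nat (- k) = Suc (nat (- (k + 1)))" "nat (k + 1) = 0" "nat k = 0" by auto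
  then show ?thesis by (simp add: zmul_def)
qed

lemma zmul_add: "zmul (k + l) a = zmul k a + zmul l a"
proof (induction l rule: int_induct[where k = 0])
  case base
  then show ?case by simp
next
  case (step1 i)
  then show ?case using zmul_plus_one[of "k + i" a] zmul_plus_one[of i a] by (simp add: add.assoc)
next
  case (step2 i)
  then show ?case using zmul_plus_one[of "k + (i - 1)" a] zmul_plus_one[of "i - 1" a]
    by (simp add: algebra_simps)
qed

lemma zmul_minus: "zmul (- k) a = - zmul k a"
  by (simp add: zmul_def)

lemma zmul_diff: "zmul (k - l) a = zmul k a - zmul l a"
  using zmul_add[of k "- l" a] by (simp add: zmul_minus)

lemma zmul_sum: "zmul (sum f S) a = (\<Sum>x\<in>S. zmul (f x) a)"
  by (induction S rule: infinite_finite_induct) (auto simp: zmul_add)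

lemma zmul_2: "zmul 2 a = a + a" "zmul (-2) a = - (a + a)"
proof -
  show *: "zmul 2 a = a + a" using zmul_add[of 1 1 a] by simp
  show "zmul (-2) a = - (a + a)" using zmul_minus[of 2 a] * by simp
qed

section \<open>Net outflow, circulations and reachability\<close>

text \<open>A graph is given by its vertices, its edges and the two end maps of an orientation, so that
  contracting and splitting only change the maps and every edge keeps its name.\<close>

definition loopfree :: "'v set \<Rightarrow> 'e set \<Rightarrow> ('e \<Rightarrow> 'v) \<Rightarrow> ('e \<Rightarrow> 'v) \<Rightarrow> bool" where
  "loopfree V E t h \<longleftrightarrow> finite V \<and> finite E \<and> (\<forall>e\<in>E. t e \<in> V \<and> h e \<in> V \<and> t e \<noteq> h e)"

definition net :: "'e set \<Rightarrow> ('e \<Rightarrow> 'v) \<Rightarrow> ('e \<Rightarrow> 'v) \<Rightarrow> ('e \<Rightarrow> 'a::ab_group_add) \<Rightarrow> 'v \<Rightarrow> 'a" where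
  "net E t h f v = (\<Sum>e\<in>E. (if t e = v then f e else 0) - (if h e = v then f e else 0))"

definition circ :: "'e set \<Rightarrow> ('e \<Rightarrow> 'v) \<Rightarrow> ('e \<Rightarrow> 'v) \<Rightarrow> ('e \<Rightarrow> 'a::ab_group_add) \<Rightarrow> bool" where
  "circ E t h f \<longleftrightarrow> (\<forall>v. net E t h f v = 0)"

definition nzflow :: "'e set \<Rightarrow> ('e \<Rightarrow> 'v) \<Rightarrow> ('e \<Rightarrow> 'v) \<Rightarrow> ('e \<Rightarrow> 'a::ab_group_add) \<Rightarrow> bool" where
  "nzflow E t h f \<longleftrightarrow> circ E t h f \<and> (\<forall>e\<in>E. f e \<noteq> 0)"

definition cut :: "'e set \<Rightarrow> ('e \<Rightarrow> 'v) \<Rightarrow> ('e \<Rightarrow> 'v) \<Rightarrow> 'v set \<Rightarrow> 'e set" where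
  "cut E t h S = {e\<in>E. (t e \<in> S) \<noteq> (h e \<in> S)}"

text \<open>A shift by a multiple of a unit circulation. It need not be a single cycle: composite shifts are
  what lifts well from contracted and split graphs, and they decompose into cycles in the end.\<close>

definition ustep :: "'e set \<Rightarrow> ('e \<Rightarrow> 'v) \<Rightarrow> ('e \<Rightarrow> 'v) \<Rightarrow> ('e \<Rightarrow> 'a::ab_group_add) \<Rightarrow> ('e \<Rightarrow> 'a) \<Rightarrow> bool" where
  "ustep E t h f g \<longleftrightarrow> nzflow E t h f \<and> nzflow E t h g \<and>
     (\<exists>b z. circ E t h z \<and> (\<forall>e\<in>E. \<bar>z e\<bar> \<le> (1::int)) \<and> (\<forall>e\<in>E. g e = f e + zmul (z e) b))"

abbreviation reach where "reach E t h \<equiv> (ustep E t h)\<^sup>*\<^sup>*"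

lemma net_add: "net E t h (\<lambda>e. f e + g e) v = net E t h f v + net E t h g v"
proof -
  have "net E t h (\<lambda>e. f e + g e) v = (\<Sum>e\<in>E. ((if t e = v then f e else 0) - (if h e = v then f e else 0))
     + ((if t e = v then g e else 0) - (if h e = v then g e else 0)))"
    unfolding net_def by (rule sum.cong) auto
  then show ?thesis by (simp add: net_def sum.distrib)
qed

lemma net_uminus: "net E t h (\<lambda>e. - f e) v = - net E t h f v"
  unfolding net_def sum_negf[symmetric] by (rule sum.cong) auto

lemma net_diff: "net E t h (\<lambda>e. f e - g e) v = net E t h f v - net E t h g v"
  using net_add[of E t h f "\<lambda>e. - g e" v] by (simp add: net_uminus)

lemma net_scale: "net E t h (\<lambda>e. k * f e) v = (k::int) * net E t h f v"
  unfolding net_def sum_distrib_left by (rule sum.cong) (auto simp: algebra_simps)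

lemma net_zmul: "net E t h (\<lambda>e. zmul (z e) b) v = zmul (net E t h z v) b"
  unfolding net_def zmul_sum by (rule sum.cong) (auto simp: zmul_minus)

lemma net_cong: "(\<And>e. e \<in> E \<Longrightarrow> f e = g e) \<Longrightarrow> net E t h f v = net E t h g v"
  unfolding net_def by (rule sum.cong) auto

lemma net_zero [simp]: "net E t h (\<lambda>e. 0) v = 0"
  unfolding net_def by (rule sum.neutral) auto

lemma net_sum: "net E t h (\<lambda>e. \<Sum>i\<in>I. f i e) v = (\<Sum>i\<in>I. net E t h (f i) v)"
  by (induction I rule: infinite_finite_induct) (auto simp: net_add)

lemma net_mono_support:
  assumes "finite E" "F \<subseteq> E" "\<And>e. e \<in> E - F \<Longrightarrow> f e = 0"
  shows "net E t h f v = net F t h f v"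
  unfolding net_def by (rule sum.mono_neutral_right) (use assms in auto)

lemma sum_net:
  assumes "finite S"
  shows "(\<Sum>v\<in>S. net E t h f v) = (\<Sum>e\<in>E. (if t e \<in> S then f e else 0) - (if h e \<in> S then f e else 0))"
proof -
  have "(\<Sum>v\<in>S. net E t h f v) = (\<Sum>e\<in>E. \<Sum>v\<in>S. (if t e = v then f e else 0) - (if h e = v then f e else 0))"
    unfolding net_def by (rule sum.swap)
  also have "\<dots> = (\<Sum>e\<in>E. (if t e \<in> S then f e else 0) - (if h e \<in> S then f e else 0))"
    using assms by (intro sum.cong) (auto simp: sum_subtractf)
  finally show ?thesis .
qed

lemma net_single:
  assumes "finite E" "a \<in> E"
  shows "net E t h (\<lambda>e. of_bool (e = a)) v = (of_bool (v = t a) - of_bool (v = h a) :: int)"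
proof -
  have "net E t h (\<lambda>e. of_bool (e = a)) v = (\<Sum>e\<in>E. if e = a then of_bool (v = t a) - of_bool (v = h a) else 0 :: int)"
    unfolding net_def by (rule sum.cong) auto
  then show ?thesis using assms by simp
qed

lemma net_outside: "loopfree V E t h \<Longrightarrow> v \<notin> V \<Longrightarrow> net E t h f v = 0"
  unfolding net_def loopfree_def by (rule sum.neutral) auto

lemma circ_add: "circ E t h f \<Longrightarrow> circ E t h g \<Longrightarrow> circ E t h (\<lambda>e. f e + g e)"
  by (simp add: circ_def net_add)

lemma circ_diff: "circ E t h f \<Longrightarrow> circ E t h g \<Longrightarrow> circ E t h (\<lambda>e. f e - g e)"
  by (simp add: circ_def net_diff)

lemma circ_uminus: "circ E t h f \<Longrightarrow> circ E t h (\<lambda>e. - f e)"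
  by (simp add: circ_def net_uminus)

lemma circ_scale: "circ E t h f \<Longrightarrow> circ E t h (\<lambda>e. (k::int) * f e)"
  by (simp add: circ_def net_scale)

lemma circ_zmul: "circ E t h z \<Longrightarrow> circ E t h (\<lambda>e. zmul (z e) b)"
  by (simp add: circ_def net_zmul)

lemma circ_cong: "(\<And>e. e \<in> E \<Longrightarrow> f e = g e) \<Longrightarrow> circ E t h f \<longleftrightarrow> circ E t h g"
  unfolding circ_def using net_cong[of E f g t h] by auto

lemma circ_zero [simp]: "circ E t h (\<lambda>e. 0)"
  by (simp add: circ_def)

lemma nzflow_cong: "(\<And>e. e \<in> E \<Longrightarrow> f e = g e) \<Longrightarrow> nzflow E t h f \<longleftrightarrow> nzflow E t h g"
  unfolding nzflow_def using circ_cong[of E f g t h] by auto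

lemma ustep_sym: "ustep E t h f g \<Longrightarrow> ustep E t h g f"
proof -
  assume "ustep E t h f g"
  then obtain b z where *: "nzflow E t h f" "nzflow E t h g" "circ E t h z"
    "\<forall>e\<in>E. \<bar>z e\<bar> \<le> (1::int)" "\<forall>e\<in>E. g e = f e + zmul (z e) b"
    by (auto simp: ustep_def)
  have "circ E t h (\<lambda>e. - z e)" "\<forall>e\<in>E. \<bar>- z e\<bar> \<le> (1::int)" "\<forall>e\<in>E. f e = g e + zmul (- z e) b"
    using * circ_uminus[of E t h z] by (auto simp: zmul_minus)
  then show ?thesis using * unfolding ustep_def by blast
qed

lemma reach_sym: "reach E t h f g \<Longrightarrow> reach E t h g f"
  by (induction rule: rtranclp_induct) (auto intro: ustep_sym converse_rtranclp_into_rtranclp)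

lemma ustep_agree: "nzflow E t h f \<Longrightarrow> (\<And>e. e \<in> E \<Longrightarrow> g e = f e) \<Longrightarrow> ustep E t h f g"
  unfolding ustep_def using nzflow_cong[of E f g t h]
  by (auto intro!: exI[of _ 0] exI[of _ "\<lambda>_. 0"])

lemma ustep_shift:
  assumes "nzflow E t h f" "circ E t h z" "\<And>e. e \<in> E \<Longrightarrow> \<bar>z e\<bar> \<le> (1::int)"
    "\<And>e. e \<in> E \<Longrightarrow> g e = f e + zmul (z e) b" "\<And>e. e \<in> E \<Longrightarrow> g e \<noteq> 0"
  shows "ustep E t h f g"
proof -
  have "circ E t h (\<lambda>e. f e + zmul (z e) b)"
    using assms by (intro circ_add circ_zmul) (auto simp: nzflow_def)
  then have "circ E t h g" using assms(4) circ_cong by (metis (no_types, lifting))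
  then show ?thesis using assms unfolding ustep_def nzflow_def by blast
qed

section \<open>Cuts\<close>

lemma finite_cut [simp]: "finite E \<Longrightarrow> finite (cut E t h S)"
  by (simp add: cut_def)

lemma card_cut: "finite E \<Longrightarrow> int (card (cut E t h S)) = (\<Sum>e\<in>E. of_bool ((t e \<in> S) \<noteq> (h e \<in> S)))"
  unfolding cut_def by (simp add: Int_def)

lemma cut_compl: "(\<And>e. e \<in> E \<Longrightarrow> t e \<in> V \<and> h e \<in> V) \<Longrightarrow> cut E t h (V - S) = cut E t h S"
  unfolding cut_def by blast

text \<open>Group-valued circulations balance over every cut, so the support of one is bridgeless.\<close>

lemma circ_cut_ne_single:
  assumes "finite E" "finite S" "circ E t h f" "e \<in> E" "f e \<noteq> 0" "(t e \<in> S) \<noteq> (h e \<in> S)"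
  obtains e' where "e' \<in> E" "e' \<noteq> e" "f e' \<noteq> 0" "(t e' \<in> S) \<noteq> (h e' \<in> S)"
proof (rule ccontr)
  assume "\<not> thesis"
  then have *: "\<And>e'. e' \<in> E \<Longrightarrow> e' \<noteq> e \<Longrightarrow> (if t e' \<in> S then f e' else 0) - (if h e' \<in> S then f e' else 0) = 0"
    using that by fastforce
  have "0 = (\<Sum>v\<in>S. net E t h f v)" using assms by (simp add: circ_def)
  also have "\<dots> = (\<Sum>e\<in>E. (if t e \<in> S then f e else 0) - (if h e \<in> S then f e else 0))"
    using assms by (intro sum_net)
  also have "\<dots> = (if t e \<in> S then f e else 0) - (if h e \<in> S then f e else 0)"
    using assms * by (subst sum.remove[of _ e]) auto
  also have "\<dots> \<noteq> 0" using assms by auto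
  finally show False by simp
qed

text \<open>An edge joining the intersection to the outside of both sets crosses both of them and neither
  difference; this gain of two is what the induction for unit flows needs.\<close>

lemma card_cut_posimodular:
  assumes "finite E" "e \<in> E" "t e \<in> S" "t e \<in> S'" "h e \<notin> S" "h e \<notin> S'"
  shows "card (cut E t h (S - S')) + card (cut E t h (S' - S)) + 2 \<le> card (cut E t h S) + card (cut E t h S')"
proof -
  let ?i = "\<lambda>S e. of_bool ((t e \<in> S) \<noteq> (h e \<in> S)) :: int"
  let ?d = "\<lambda>e. ?i S e + ?i S' e - ?i (S - S') e - ?i (S' - S) e"
  have "2 = ?d e" using assms by auto
  also have "\<dots> \<le> (\<Sum>e\<in>E. ?d e)"
    by (rule member_le_sum) (use assms in auto)
  also have "\<dots> = int (card (cut E t h S)) + card (cut E t h S') - card (cut E t h (S - S')) - card (cut E t h (S' - S))"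
    using assms by (simp add: card_cut sum.distrib sum_subtractf del: sum_of_bool_eq)
  finally show ?thesis by linarith
qed

section \<open>Unit flows with prescribed demand\<close>

lemma sum_delta_int: "finite S \<Longrightarrow> (\<Sum>v\<in>S. of_bool (v = x)) = (of_bool (x \<in> S) :: int)"
  by (simp add: of_bool_def)

lemma sum_demand:
  "finite S \<Longrightarrow> (\<Sum>v\<in>S. of_bool (v = x) - of_bool (v = y)) = (of_bool (x \<in> S) - of_bool (y \<in> S) :: int)"
  by (simp add: sum_subtractf sum_delta_int del: sum_of_bool_eq)

text \<open>The integral supply-demand theorem for unit capacities, by induction on the edges: an edge may be given
  the value \<open>c\<close> if \<open>c\<close> lies in an interval for every cut that it crosses. By posimodularity these intervals
  meet pairwise, and they all meet \<open>{-1..1}\<close>.\<close>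

lemma unit_flow_exists:
  fixes d :: "'v \<Rightarrow> int"
  assumes "finite F" "finite V" "\<And>e. e \<in> F \<Longrightarrow> t e \<in> V \<and> h e \<in> V \<and> t e \<noteq> h e"
    "sum d V = 0" "\<And>S. S \<subseteq> V \<Longrightarrow> \<bar>sum d S\<bar> \<le> card (cut F t h S)"
  shows "\<exists>x::'e \<Rightarrow> int. (\<forall>e. \<bar>x e\<bar> \<le> 1) \<and> (\<forall>e. e \<notin> F \<longrightarrow> x e = 0) \<and> (\<forall>v\<in>V. net F t h x v = d v)"
  using assms
proof (induction F arbitrary: d rule: finite_induct)
  case empty
  have "d v = 0" if "v \<in> V" for v
    using empty.prems(4)[of "{v}"] that by (simp add: cut_def)
  then show ?case by (intro exI[of _ "\<lambda>_. 0"]) auto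
next
  case (insert e F)
  let ?x = "t e" and ?y = "h e"
  have xy: "?x \<in> V" "?y \<in> V" "?x \<noteq> ?y" using insert.prems(2)[of e] by auto
  let ?E = "insert e F"
  have finE: "finite ?E" using insert by auto
  define M where "M = {S. S \<subseteq> V \<and> ?x \<in> S \<and> ?y \<notin> S}"
  have finM: "finite M" using insert.prems(1) by (simp add: M_def)
  have M_ne: "M \<noteq> {}" unfolding M_def using xy by auto
  have bound: "\<bar>sum d S\<bar> \<le> card (cut ?E t h S)" if "S \<subseteq> V" for S
    using insert.prems(4) that by blast
  define lo where "lo S = sum d S - card (cut ?E t h S) + 1" for S
  \<comment> \<open>the least admissible value: above every lower bound, and at least -1\<close>
  define c where "c = max (-1) (Max (lo ` M))"
  have lo_le: "lo S \<le> c" if "S \<in> M" for S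
    unfolding c_def using that finM by (auto intro: max.coboundedI2)
  have c_le1: "c \<le> 1"
    unfolding c_def using finM M_ne bound by (auto simp: lo_def M_def abs_le_iff)
  have c_le: "c \<le> sum d S' + card (cut ?E t h S') - 1" if S': "S' \<in> M" for S'
  proof -
    have "lo S \<le> sum d S' + card (cut ?E t h S') - 1" if S: "S \<in> M" for S
    proof -
      have fin: "finite S" "finite S'" using S S' insert.prems(1) by (auto simp: M_def intro: finite_subset)
      have "sum d S - sum d S' = sum d (S - S') - sum d (S' - S)"
        using fin sum.Int_Diff[of S d S'] sum.Int_Diff[of S' d S] by (simp add: Int_commute)
      also have "\<dots> \<le> card (cut ?E t h (S - S')) + card (cut ?E t h (S' - S))"
        using bound[of "S - S'"] bound[of "S' - S"] S S' by (fastforce simp: M_def abs_le_iff)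
      also have "\<dots> + 2 \<le> card (cut ?E t h S) + card (cut ?E t h S')"
        using card_cut_posimodular[of ?E e t S S' h] finE S S' by (simp add: M_def)
      finally show ?thesis by (simp add: lo_def)
    qed
    moreover have "-1 \<le> sum d S' + card (cut ?E t h S') - 1"
      using bound[of S'] S' by (auto simp: M_def)
    ultimately show ?thesis unfolding c_def using finM M_ne by auto
  qed
  define d' where "d' v = d v - c * of_bool (v = ?x) + c * of_bool (v = ?y)" for v
  have sum_d': "sum d' S = sum d S - c * of_bool (?x \<in> S) + c * of_bool (?y \<in> S)" if "S \<subseteq> V" for S
  proof -
    have "finite S" using that insert.prems(1) finite_subset by blast
    then show ?thesis
      by (simp add: d'_def sum.distrib sum_subtractf sum_distrib_left[symmetric] sum_delta_int del: sum_of_bool_eq sum_mult_of_bool_eq)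
  qed
  have cutE: "card (cut ?E t h S) = card (cut F t h S) + of_bool ((?x \<in> S) \<noteq> (?y \<in> S))" for S
  proof -
    have "cut ?E t h S = (if (?x \<in> S) \<noteq> (?y \<in> S) then insert e (cut F t h S) else cut F t h S)"
      unfolding cut_def by auto
    moreover have "e \<notin> cut F t h S" using insert.hyps by (auto simp: cut_def)
    ultimately show ?thesis using insert.hyps by auto
  qed
  have key: "\<bar>sum d S - c\<bar> \<le> card (cut F t h S)" if S: "S \<in> M" for S
    using lo_le[OF S] c_le[OF S] cutE[of S] S by (auto simp: lo_def M_def)
  have "\<bar>sum d' S\<bar> \<le> card (cut F t h S)" if S: "S \<subseteq> V" for S
  proof -
    consider "S \<in> M" | "V - S \<in> M" | "(?x \<in> S) = (?y \<in> S)" using S xy by (auto simp: M_def)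
    then show ?thesis
    proof cases
      case 1
      then show ?thesis using key[OF 1] sum_d'[OF S] by (auto simp: M_def)
    next
      case 2
      have "cut F t h (V - S) = cut F t h S" using insert.prems(2) by (intro cut_compl) auto
      moreover have "sum d (V - S) = - sum d S"
        using sum_diff[of V S d] insert.prems(1,3) S by simp
      ultimately have "\<bar>- sum d S - c\<bar> \<le> card (cut F t h S)" using key[OF 2] by simp
      then show ?thesis using 2 sum_d'[OF S] xy by (auto simp: M_def)
    next
      case 3
      then show ?thesis using bound[OF S] cutE[of S] sum_d'[OF S] by auto
    qed
  qed
  moreover have "sum d' V = 0" using sum_d'[of V] insert.prems(3) xy by simp
  ultimately obtain x' where x': "\<forall>e. \<bar>x' e\<bar> \<le> 1" "\<forall>e. e \<notin> F \<longrightarrow> x' e = 0" "\<forall>v\<in>V. net F t h x' v = d' v"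
    using insert.IH[of d'] insert.prems by blast
  define x where "x = x'(e := c)"
  have "net ?E t h x v = d v" if v: "v \<in> V" for v
  proof -
    have "net ?E t h x v = (if ?x = v then c else 0) - (if ?y = v then c else 0) + net F t h x v"
      using insert.hyps by (simp add: net_def x_def)
    also have "net F t h x v = net F t h x' v" using insert.hyps by (intro net_cong) (auto simp: x_def)
    also have "\<dots> = d' v" using x' v by blast
    finally show ?thesis by (auto simp: d'_def)
  qed
  moreover have "\<bar>x e'\<bar> \<le> 1" for e' using c_le1 x' by (auto simp: c_def x_def)
  moreover have "x e' = 0" if "e' \<notin> ?E" for e' using that x' by (auto simp: x_def)
  ultimately show ?case by blast
qed

section \<open>Extracting a directed cycle from an integer circulation\<close>

definition src :: "('e \<Rightarrow> 'v) \<Rightarrow> ('e \<Rightarrow> 'v) \<Rightarrow> ('e \<Rightarrow> int) \<Rightarrow> 'e \<Rightarrow> 'v" where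
  "src t h z e = (if z e > 0 then t e else h e)"

definition dst :: "('e \<Rightarrow> 'v) \<Rightarrow> ('e \<Rightarrow> 'v) \<Rightarrow> ('e \<Rightarrow> int) \<Rightarrow> 'e \<Rightarrow> 'v" where
  "dst t h z e = (if z e > 0 then h e else t e)"

lemma net_src_dst:
  "net E t h z v = (\<Sum>e\<in>E. (if src t h z e = v then \<bar>z e\<bar> else 0) - (if dst t h z e = v then \<bar>z e\<bar> else 0))"
  unfolding net_def src_def dst_def by (rule sum.cong) auto

definition conforms :: "'e set \<Rightarrow> ('e \<Rightarrow> int) \<Rightarrow> ('e \<Rightarrow> int) \<Rightarrow> bool" where
  "conforms E c z \<longleftrightarrow> (\<forall>e. c e = 0 \<or> e \<in> E \<and> c e = sgn (z e))"

text \<open>A directed cycle is stored as its vertex set \<open>N\<close> with the choice \<open>out\<close> of the arc leaving each vertex.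
  That no proper nonempty subset is closed under successors makes it a single cycle.\<close>

definition dicycle :: "'e set \<Rightarrow> ('e \<Rightarrow> 'v) \<Rightarrow> ('e \<Rightarrow> 'v) \<Rightarrow> ('e \<Rightarrow> int) \<Rightarrow> 'v set \<Rightarrow> ('v \<Rightarrow> 'e) \<Rightarrow> bool" where
  "dicycle E t h z N out \<longleftrightarrow> N \<noteq> {} \<and> finite N \<and>
     (\<forall>v\<in>N. out v \<in> E \<and> z (out v) \<noteq> 0 \<and> src t h z (out v) = v) \<and>
     bij_betw (\<lambda>v. dst t h z (out v)) N N \<and>
     (\<forall>X. X \<noteq> {} \<longrightarrow> X \<subseteq> N \<longrightarrow> (\<lambda>v. dst t h z (out v)) ` X \<subseteq> X \<longrightarrow> X = N)"

definition arcs_flow :: "'v set \<Rightarrow> ('v \<Rightarrow> 'e) \<Rightarrow> ('e \<Rightarrow> int) \<Rightarrow> 'e \<Rightarrow> int" where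
  "arcs_flow N out z e = (if e \<in> out ` N then sgn (z e) else 0)"

text \<open>Every arc that carries flow ends at a vertex from which another one leaves. Following chosen arcs gives
  a successor map, and a smallest nonempty set closed under it is a cycle.\<close>

lemma dicycle_exists:
  assumes "finite E" "circ E t h z" "e \<in> E" "z e \<noteq> 0"
  obtains N out where "dicycle E t h z N out"
proof -
  let ?s = "src t h z" and ?d = "dst t h z"
  define P where "P = {e\<in>E. z e \<noteq> 0}"
  have out_exists: "\<exists>e'\<in>P. ?s e' = ?d e" if e: "e \<in> P" for e
  proof (rule ccontr)
    assume no: "\<not> (\<exists>e'\<in>P. ?s e' = ?d e)"
    let ?g = "\<lambda>e'. (if ?s e' = ?d e then \<bar>z e'\<bar> else 0) - (if ?d e' = ?d e then \<bar>z e'\<bar> else 0)"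
    have le: "?g e' \<le> 0" if "e' \<in> E" for e' using no that by (auto simp: P_def)
    have "net E t h z (?d e) = (\<Sum>e'\<in>E. ?g e')" by (rule net_src_dst)
    also have "\<dots> = ?g e + (\<Sum>e'\<in>E - {e}. ?g e')" using e assms by (intro sum.remove) (auto simp: P_def)
    also have "(\<Sum>e'\<in>E - {e}. ?g e') \<le> 0" by (rule sum_nonpos) (use le in auto)
    also have "?g e < 0" using no e by (auto simp: P_def)
    finally show False using assms(2) by (simp add: circ_def)
  qed
  define out where "out v = (SOME e'. e' \<in> P \<and> ?s e' = v)" for v
  have out: "out v \<in> P \<and> ?s (out v) = v" if "v \<in> ?s ` P" for v
    unfolding out_def by (rule someI_ex) (use that in auto)
  define nx where "nx v = ?d (out v)" for v
  have nx: "nx v \<in> ?s ` P" if "v \<in> ?s ` P" for v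
    unfolding nx_def using out_exists[of "out v"] out[OF that] by force
  have fin: "finite (?s ` P)" using assms by (simp add: P_def)
  let ?Q = "\<lambda>X. X \<noteq> {} \<and> X \<subseteq> ?s ` P \<and> nx ` X \<subseteq> X"
  have "?Q (?s ` P)" using assms nx by (auto simp: P_def)
  then obtain N where N: "?Q N" and min: "\<And>X. ?Q X \<Longrightarrow> card N \<le> card X"
    using ex_has_least_nat[of ?Q _ card] by meson
  have finO: "finite N" using N fin finite_subset by blast
  have minN: "X = N" if "X \<noteq> {}" "X \<subseteq> N" "nx ` X \<subseteq> X" for X
    using card_seteq[OF finO that(2)] min[of X] that N by blast
  have "nx ` N = N" by (rule minN) (use N in auto)
  then have "bij_betw nx N N" using finO by (simp add: bij_betw_def eq_card_imp_inj_on)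
  moreover have "\<forall>v\<in>N. out v \<in> E \<and> z (out v) \<noteq> 0 \<and> ?s (out v) = v"
    using out N by (auto simp: P_def)
  ultimately have "dicycle E t h z N out"
    unfolding dicycle_def using N finO minN by (auto simp: nx_def[abs_def])
  then show thesis by (rule that)
qed

lemma arcs_flow_nonzero: "dicycle E t h z N out \<Longrightarrow> arcs_flow N out z e \<noteq> 0 \<longleftrightarrow> e \<in> out ` N"
  unfolding dicycle_def arcs_flow_def by (metis imageE sgn_eq_0_iff)

lemma conforms_arcs_flow: "dicycle E t h z N out \<Longrightarrow> conforms E (arcs_flow N out z) z"
  by (auto simp: arcs_flow_def dicycle_def conforms_def)

lemma circ_arcs_flow:
  assumes "finite E" "dicycle E t h z N out"
  shows "circ E t h (arcs_flow N out z)"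
  unfolding circ_def
proof
  fix v
  let ?c = "arcs_flow N out z" and ?s = "src t h z" and ?d = "dst t h z"
  have D: "finite N" "\<And>v. v \<in> N \<Longrightarrow> out v \<in> E \<and> z (out v) \<noteq> 0 \<and> ?s (out v) = v"
    "bij_betw (\<lambda>v. ?d (out v)) N N" using assms(2) by (auto simp: dicycle_def)
  have inj: "inj_on out N" using D(2) by (metis inj_onI)
  have "net E t h ?c v = (\<Sum>e\<in>out ` N. (if ?s e = v then 1 else 0) - (if ?d e = v then 1 else 0))"
    unfolding net_def using assms(1) D(2)
    by (intro sum.mono_neutral_cong_right) (auto simp: arcs_flow_def src_def dst_def sgn_if)
  also have "\<dots> = (\<Sum>w\<in>N. (if w = v then 1 else 0) - (if ?d (out w) = v then 1 else 0))"
    using inj D(2) by (subst sum.reindex) (auto intro!: sum.cong)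
  also have "\<dots> = (\<Sum>w\<in>N. if w = v then 1 else 0) - (\<Sum>w\<in>N. if ?d (out w) = v then 1 else 0)"
    by (rule sum_subtractf)
  also have "(\<Sum>w\<in>N. if ?d (out w) = v then 1 else 0) = (\<Sum>w\<in>N. if w = v then 1 else (0::int))"
    by (rule sum.reindex_bij_betw[OF D(3), of "\<lambda>w. if w = v then 1 else (0::int)"])
  finally show "net E t h ?c v = 0" by simp
qed

text \<open>A directed cycle leaves each vertex only once; at a vertex of degree four this keeps two cycles apart.\<close>

lemma arcs_flow_out_unique:
  assumes "dicycle E t h z N out" "arcs_flow N out z e \<noteq> 0" "arcs_flow N out z e' \<noteq> 0"
    "src t h z e = src t h z e'"
  shows "e = e'"
  using assms(2-4) unfolding arcs_flow_nonzero[OF assms(1)]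
  using assms(1) by (auto simp: dicycle_def)

lemma sgn_diff_sgn: "sgn (z - sgn z) = 0 \<or> sgn (z - sgn z) = sgn (z::int)"
  by (cases z "0::int" rule: linorder_cases) (auto simp: sgn_if)

lemma abs_diff_sgn:
  fixes z :: int
  shows "\<bar>z - sgn z\<bar> \<le> \<bar>z\<bar>" "z \<noteq> 0 \<Longrightarrow> \<bar>z - sgn z\<bar> < \<bar>z\<bar>"
    "\<bar>z - 2 * sgn z\<bar> \<le> \<bar>z\<bar>" "\<bar>z\<bar> > 1 \<Longrightarrow> \<bar>z - 2 * sgn z\<bar> < \<bar>z\<bar>"
  by (cases z "0::int" rule: linorder_cases; auto)+

lemma conforms_cases: "conforms E c z \<Longrightarrow> c e = 0 \<or> e \<in> E \<and> c e = sgn (z e)"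
  unfolding conforms_def by blast

lemma conforms_trans_diff:
  assumes "conforms E c z" "conforms E c' (\<lambda>e. z e - c e)"
  shows "conforms E c' z"
  unfolding conforms_def
proof
  fix e
  have c': "c' e = 0 \<or> e \<in> E \<and> c' e = sgn (z e - c e)" by (rule conforms_cases[OF assms(2)])
  consider "c e = 0" | "c e = sgn (z e)" using conforms_cases[OF assms(1), of e] by blast
  then show "c' e = 0 \<or> e \<in> E \<and> c' e = sgn (z e)"
  proof cases
    case 1
    then show ?thesis using c' by simp
  next
    case 2
    then show ?thesis using c' sgn_diff_sgn[of "z e"] by metis
  qed
qed

lemma conforms_abs_diff:
  assumes "finite E" "conforms E c z" "c e \<noteq> 0"
  shows "(\<Sum>e\<in>E. nat \<bar>z e - c e\<bar>) < (\<Sum>e\<in>E. nat \<bar>z e\<bar>)"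
proof (rule sum_strict_mono_ex1)
  show "\<forall>e\<in>E. nat \<bar>z e - c e\<bar> \<le> nat \<bar>z e\<bar>"
  proof
    fix e
    have "\<bar>z e - c e\<bar> \<le> \<bar>z e\<bar>"
      using conforms_cases[OF assms(2), of e] abs_diff_sgn(1)[of "z e"] by (metis diff_zero order_refl)
    then show "nat \<bar>z e - c e\<bar> \<le> nat \<bar>z e\<bar>" by linarith
  qed
  have e: "e \<in> E" "c e = sgn (z e)" using conforms_cases[OF assms(2), of e] assms(3) by auto
  then have "z e \<noteq> 0" using assms(3) by auto
  then have "\<bar>z e - c e\<bar> < \<bar>z e\<bar>" using e abs_diff_sgn(2) by simp
  then have "nat \<bar>z e - c e\<bar> < nat \<bar>z e\<bar>" by linarith
  then show "\<exists>e\<in>E. nat \<bar>z e - c e\<bar> < nat \<bar>z e\<bar>" using e by blast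
qed (use assms in auto)

text \<open>A directed cycle through a prescribed edge: peel off cycles until one contains the edge.\<close>

lemma dicycle_through:
  assumes "finite E" "circ E t h z" "e \<in> E" "z e \<noteq> 0"
  shows "\<exists>c. circ E t h c \<and> conforms E c z \<and> c e \<noteq> 0 \<and>
     (\<forall>a b. c a \<noteq> 0 \<longrightarrow> c b \<noteq> 0 \<longrightarrow> src t h z a = src t h z b \<longrightarrow> a = b)"
  using assms(2,4)
proof (induction "\<Sum>e\<in>E. nat \<bar>z e\<bar>" arbitrary: z rule: less_induct)
  case less
  obtain N out where D: "dicycle E t h z N out"
    using dicycle_exists[OF assms(1) less.prems(1) assms(3) less.prems(2)] by blast
  define c where "c = arcs_flow N out z"
  have c: "circ E t h c" "conforms E c z"
    using circ_arcs_flow[OF assms(1) D] conforms_arcs_flow[OF D] by (auto simp: c_def)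
  show ?case
  proof (cases "c e = 0")
    case False
    then show ?thesis using c arcs_flow_out_unique[OF D] by (auto simp: c_def)
  next
    case True
    obtain v where "v \<in> N" using D by (auto simp: dicycle_def)
    then have "c (out v) \<noteq> 0" unfolding c_def using arcs_flow_nonzero[OF D] by blast
    then have "(\<Sum>e\<in>E. nat \<bar>z e - c e\<bar>) < (\<Sum>e\<in>E. nat \<bar>z e\<bar>)"
      using conforms_abs_diff[OF assms(1) c(2)] by blast
    moreover have "circ E t h (\<lambda>e. z e - c e)" by (intro circ_diff less.prems c)
    moreover have "z e - c e \<noteq> 0" using True less.prems by simp
    ultimately obtain c' where c': "circ E t h c'" "conforms E c' (\<lambda>e. z e - c e)" "c' e \<noteq> 0"
      and un: "\<And>a b. c' a \<noteq> 0 \<Longrightarrow> c' b \<noteq> 0 \<Longrightarrow> src t h (\<lambda>e. z e - c e) a = src t h (\<lambda>e. z e - c e) b \<Longrightarrow> a = b"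
      using less.hyps[of "\<lambda>e. z e - c e"] by blast
    have "src t h (\<lambda>e. z e - c e) a = src t h z a" if "c' a \<noteq> 0" for a
    proof -
      have "c' a = sgn (z a - c a)" "c' a = sgn (z a)"
        using conforms_cases[OF c'(2), of a] conforms_cases[OF conforms_trans_diff[OF c(2) c'(2)], of a] that by auto
      then have "z a - c a > 0 \<longleftrightarrow> z a > 0" by (metis sgn_1_pos sgn_greater)
      then show ?thesis by (simp add: src_def)
    qed
    then show ?thesis using c' un conforms_trans_diff[OF c(2) c'(2)] by metis
  qed
qed

lemma conforms_unit: "conforms E c z \<Longrightarrow> \<bar>c e\<bar> \<le> 1"
  using conforms_cases[of E c z e] abs_sgn_eq[of "z e"] by auto

text \<open>Every integer circulation is congruent modulo 2 to a unit circulation: wherever the value is at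
  least 2 in absolute value, subtract twice a cycle.\<close>

lemma unit_circ_mod2:
  assumes "finite E" "circ E t h z"
  shows "\<exists>u. circ E t h u \<and> (\<forall>e\<in>E. \<bar>u e\<bar> \<le> 1) \<and> (\<forall>e. even (u e - z e)) \<and> (\<forall>e. z e = 0 \<longrightarrow> u e = (0::int))"
  using assms(2)
proof (induction "\<Sum>e\<in>E. nat \<bar>z e\<bar>" arbitrary: z rule: less_induct)
  case less
  show ?case
  proof (cases "\<forall>e\<in>E. \<bar>z e\<bar> \<le> 1")
    case True
    then show ?thesis using less.prems by (intro exI[of _ z]) auto
  next
    case False
    then obtain e where e: "e \<in> E" "\<bar>z e\<bar> > 1" by auto
    then obtain c where c: "circ E t h c" "conforms E c z" "c e \<noteq> 0"
      using dicycle_through[OF assms(1) less.prems, of e] by fastforce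
    let ?z = "\<lambda>e. z e - 2 * c e"
    have c': "c a = 0 \<or> c a = sgn (z a)" for a using c by (auto simp: conforms_def)
    have "(\<Sum>e\<in>E. nat \<bar>?z e\<bar>) < (\<Sum>e\<in>E. nat \<bar>z e\<bar>)"
    proof (rule sum_strict_mono_ex1)
      show "\<forall>e\<in>E. nat \<bar>?z e\<bar> \<le> nat \<bar>z e\<bar>"
      proof
        fix e
        have "\<bar>?z e\<bar> \<le> \<bar>z e\<bar>" using c'[of e] abs_diff_sgn(3)[of "z e"] by (metis diff_zero mult_zero_right order_refl)
        then show "nat \<bar>?z e\<bar> \<le> nat \<bar>z e\<bar>" by linarith
      qed
      have "\<bar>?z e\<bar> < \<bar>z e\<bar>" using c'[of e] c(3) abs_diff_sgn(4)[of "z e"] e by simp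
      then have "nat \<bar>?z e\<bar> < nat \<bar>z e\<bar>" by linarith
      then show "\<exists>e\<in>E. nat \<bar>?z e\<bar> < nat \<bar>z e\<bar>" using e by blast
    qed (use assms in auto)
    moreover have "circ E t h ?z" by (intro circ_diff circ_scale less.prems c)
    ultimately obtain u where u: "circ E t h u" "\<forall>e\<in>E. \<bar>u e\<bar> \<le> 1" "\<forall>e. even (u e - ?z e)" "\<forall>e. ?z e = 0 \<longrightarrow> u e = 0"
      using less.hyps[of ?z] by blast
    have "even (u e - z e)" for e using u(3)[rule_format, of e] by presburger
    moreover have "u e = 0" if "z e = 0" for e using u(4) c'[of e] that by auto
    ultimately show ?thesis using u by blast
  qed
qed

section \<open>Unit shifts decompose into cycle changes\<close>

lemma dicycle_is_cycle:
  assumes G: "multigraph G" and D: "orientation_of D G"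
    and C: "dicycle (edges G) (tail D) (head D) z N out"
  shows "is_cycle \<lparr>vertices = N, edges = out ` N, ends = ends G\<rparr>" (is "is_cycle ?C")
    and "is_subgraph \<lparr>vertices = N, edges = out ` N, ends = ends G\<rparr> G"
proof -
  let ?s = "src (tail D) (head D) z" and ?d = "dst (tail D) (head D) z"
  let ?n = "\<lambda>v. ?d (out v)"
  have N: "N \<noteq> {}" "finite N" "\<And>v. v \<in> N \<Longrightarrow> out v \<in> edges G \<and> z (out v) \<noteq> 0 \<and> ?s (out v) = v"
    and bij: "bij_betw ?n N N"
    and min: "\<And>X. X \<noteq> {} \<Longrightarrow> X \<subseteq> N \<Longrightarrow> ?n ` X \<subseteq> X \<Longrightarrow> X = N"
    using C by (auto simp: dicycle_def)
  have ends: "ends G (out v) = {v, ?n v}" if "v \<in> N" for v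
  proof -
    have "ends G (out v) = {tail D (out v), head D (out v)}"
      using D N(3)[OF that] by (auto simp: orientation_of_def)
    also have "\<dots> = {?s (out v), ?d (out v)}" by (auto simp: src_def dst_def)
    finally have "ends G (out v) = {?s (out v), ?d (out v)}" .
    then show ?thesis using N(3)[OF that] by auto
  qed
  have card2: "card (ends G (out v)) = 2" "ends G (out v) \<subseteq> vertices G" if "v \<in> N" for v
    using G N(3)[OF that] by (auto simp: multigraph_def)
  have ne: "?n v \<noteq> v" if "v \<in> N" for v using card2[OF that] ends[OF that] by auto
  have nO: "?n v \<in> N" if "v \<in> N" for v using bij that by (auto simp: bij_betw_def)
  have inj: "inj_on out N" using N(3) by (metis inj_onI)
  have mg: "multigraph ?C"
    using N card2 ends nO by (auto simp: multigraph_def)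
  have conn: "(u, w) \<in> (adj_rel ?C)\<^sup>*" if u: "u \<in> N" and w: "w \<in> N" for u w
  proof -
    have "{w \<in> N. (u, w) \<in> (adj_rel ?C)\<^sup>*} = N"
    proof (rule min)
      show "?n ` {w \<in> N. (u, w) \<in> (adj_rel ?C)\<^sup>*} \<subseteq> {w \<in> N. (u, w) \<in> (adj_rel ?C)\<^sup>*}"
      proof clarsimp
        fix w assume w: "w \<in> N" "(u, w) \<in> (adj_rel ?C)\<^sup>*"
        have "(w, ?n w) \<in> adj_rel ?C" using ends[OF w(1)] w by (auto simp: adj_rel_def)
        then show "?n w \<in> N \<and> (u, ?n w) \<in> (adj_rel ?C)\<^sup>*" using nO w by (simp add: rtrancl.rtrancl_into_rtrancl)
      qed
    qed (use u in auto)
    then show ?thesis using w by auto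
  qed
  have deg: "degree ?C v = 2" if v: "v \<in> N" for v
  proof -
    have "?n ` N = N" using bij by (rule bij_betw_imp_surj_on)
    then have "v \<in> ?n ` N" using v by (simp only:)
    then obtain p where p: "v = ?n p" "p \<in> N" by (rule imageE)
    have uniq: "w = p" if "w \<in> N" "?n w = v" for w
      using inj_onD[OF bij_betw_imp_inj_on[OF bij], of w p] p(2) that p(1)[symmetric] by (simp only:)
    have "v \<in> ends G (out w) \<longleftrightarrow> w = v \<or> w = p" if w: "w \<in> N" for w
    proof -
      have "v \<in> ends G (out w) \<longleftrightarrow> w = v \<or> ?n w = v" unfolding ends[OF w] by blast
      then show ?thesis using uniq[OF w] p(1)[symmetric] by blast
    qed
    then have "{e \<in> out ` N. v \<in> ends G e} = {out v, out p}"
      using v p(2) by blast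
    then have "{e \<in> edges ?C. v \<in> ends ?C e} = {out v, out p}" by simp
    moreover have "out v \<noteq> out p"
    proof
      assume "out v = out p"
      then have "v = p" using inj_onD[OF inj] v p(2) by blast
      then show False using ne[OF p(2)] p(1) by metis
    qed
    ultimately show ?thesis by (simp add: degree_def)
  qed
  show "is_cycle ?C"
    using mg conn deg N(1) by (auto simp: is_cycle_def connected_graph_def)
  show "is_subgraph ?C G"
    unfolding is_subgraph_def using mg N(3) card2(2) ends by (simp, blast)
qed

lemma flows_iff:
  assumes G: "multigraph G" and D: "orientation_of D G"
  shows "f \<in> flows D \<longleftrightarrow> f \<in> extensional (edges G) \<and> nzflow (edges G) (tail D) (head D) f"
proof -
  have fin: "finite (edges G)" using G by (simp add: multigraph_def)
  have va: "verts D = vertices G" "arcs D = edges G" using D by (auto simp: orientation_of_def)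
  have ends: "tail D e \<in> vertices G \<and> head D e \<in> vertices G" if "e \<in> edges G" for e
    using G D that unfolding multigraph_def orientation_of_def by blast
  have eq: "(\<Sum>e\<in>out_arcs D v. f e) - (\<Sum>e\<in>in_arcs D v. f e) = net (edges G) (tail D) (head D) f v" for v
    using fin by (simp add: net_def sum_subtractf out_arcs_def in_arcs_def va sum.inter_filter)
  have out: "net (edges G) (tail D) (head D) f v = 0" if "v \<notin> vertices G" for v
    unfolding net_def by (rule sum.neutral) (use ends that in auto)
  have "f \<in> flows D \<longleftrightarrow> f \<in> edges G \<rightarrow>\<^sub>E (UNIV - {0}) \<and> (\<forall>v\<in>vertices G. net (edges G) (tail D) (head D) f v = 0)"
    unfolding flows_def va mem_Collect_eq eq by (rule refl)
  also have "\<dots> \<longleftrightarrow> f \<in> edges G \<rightarrow>\<^sub>E (UNIV - {0}) \<and> circ (edges G) (tail D) (head D) f"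
    unfolding circ_def using out by blast
  also have "f \<in> edges G \<rightarrow>\<^sub>E (UNIV - {0}) \<longleftrightarrow> f \<in> extensional (edges G) \<and> (\<forall>e\<in>edges G. f e \<noteq> 0)"
    by (auto simp: PiE_def Pi_def)
  finally show ?thesis unfolding nzflow_def by blast
qed

text \<open>Subtracting one directed cycle after another from the circulation changes each edge at most once, so
  every flow in between has on each edge its initial or its final value and is nowhere zero.\<close>

lemma ustep_equivalent:
  fixes f g :: "'e \<Rightarrow> 'a::ab_group_add"
  assumes G: "multigraph G" and D: "orientation_of D G"
    and us: "ustep (edges G) (tail D) (head D) f g"
  shows "equivalent_flows G D (restrict f (edges G)) (restrict g (edges G))"
proof -
  let ?E = "edges G" and ?t = "tail D" and ?h = "head D"
  have fin: "finite ?E" using G by (simp add: multigraph_def)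
  obtain b z where z: "nzflow ?E ?t ?h f" "nzflow ?E ?t ?h g" "circ ?E ?t ?h z"
    "\<forall>e\<in>?E. \<bar>z e\<bar> \<le> (1::int)" "\<forall>e\<in>?E. g e = f e + zmul (z e) b"
    using us by (auto simp: ustep_def)
  show ?thesis using z
  proof (induction "\<Sum>e\<in>?E. nat \<bar>z e\<bar>" arbitrary: z f rule: less_induct)
    case less
    show ?case
    proof (cases "\<forall>e\<in>?E. z e = 0")
      case True
      then have "restrict f ?E = restrict g ?E" using less.prems by auto
      then show ?thesis by (simp add: equivalent_flows_def)
    next
      case False
      then obtain e where "e \<in> ?E" "z e \<noteq> 0" by auto
      then obtain N out where C: "dicycle ?E ?t ?h z N out"
        using dicycle_exists[OF fin less.prems(3)] by blast
      define c where "c = arcs_flow N out z"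
      have c: "circ ?E ?t ?h c" "conforms ?E c z"
        using circ_arcs_flow[OF fin C] conforms_arcs_flow[OF C] by (auto simp: c_def)
      define f1 where "f1 e = f e + zmul (c e) b" for e
      have c_cases: "c e = 0 \<or> c e = z e" if "e \<in> ?E" for e
      proof -
        have "\<bar>z e\<bar> \<le> 1" using less.prems(4) that by blast
        then have "z e = sgn (z e)" by (auto simp: sgn_if)
        then show ?thesis using c(2) by (auto simp: conforms_def)
      qed
      have f1nz: "f1 e \<noteq> 0" if "e \<in> ?E" for e
        using c_cases[OF that] less.prems that by (auto simp: f1_def nzflow_def)
      have f1: "nzflow ?E ?t ?h f1"
        using less.prems(1) c f1nz unfolding nzflow_def f1_def[abs_def] by (auto intro!: circ_add circ_zmul)
      obtain v where "v \<in> N" using C by (auto simp: dicycle_def)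
      then have "c (out v) \<noteq> 0" unfolding c_def using arcs_flow_nonzero[OF C] by blast
      then have less': "(\<Sum>e\<in>?E. nat \<bar>z e - c e\<bar>) < (\<Sum>e\<in>?E. nat \<bar>z e\<bar>)"
        using conforms_abs_diff[OF fin c(2)] by blast
      have "equivalent_flows G D (restrict f1 ?E) (restrict g ?E)"
      proof (rule less.hyps[OF less' f1 less.prems(2)])
        show "circ ?E ?t ?h (\<lambda>e. z e - c e)" by (intro circ_diff less.prems c)
        show "\<forall>e\<in>?E. \<bar>z e - c e\<bar> \<le> 1" using c_cases less.prems(4) by fastforce
        show "\<forall>e\<in>?E. g e = f1 e + zmul (z e - c e) b"
          using less.prems(5) by (auto simp: f1_def zmul_diff)
      qed
      moreover have "adjacent_flows G D (restrict f ?E) (restrict f1 ?E)"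
      proof -
        have "restrict f ?E \<in> flows D" "restrict f1 ?E \<in> flows D"
          using less.prems(1) f1 nzflow_cong[of ?E "restrict f ?E" f] nzflow_cong[of ?E "restrict f1 ?E" f1]
          by (auto simp: flows_iff[OF G D])
        moreover have "restrict f ?E e = restrict f1 ?E e" if "e \<in> ?E - out ` N" for e
          using that by (auto simp: f1_def c_def arcs_flow_def)
        ultimately show ?thesis
          unfolding adjacent_flows_def using dicycle_is_cycle[OF G D C]
          by (intro conjI exI[of _ "\<lparr>vertices = N, edges = out ` N, ends = ends G\<rparr>"]) auto
      qed
      ultimately show ?thesis
        by (simp add: equivalent_flows_def)
    qed
  qed
qed

lemma reach_equivalent:
  assumes G: "multigraph G" and D: "orientation_of D G"
    and r: "reach (edges G) (tail D) (head D) f g"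
  shows "equivalent_flows G D (restrict f (edges G)) (restrict g (edges G))"
  using r
proof (induction rule: rtranclp_induct)
  case base
  then show ?case by (simp add: equivalent_flows_def)
next
  case (step y w)
  then show ?case using ustep_equivalent[OF G D step(2)]
    unfolding equivalent_flows_def by (meson rtranclp_trans)
qed

lemma edge_connected_cut:
  assumes G: "multigraph G" and D: "orientation_of D G" and k: "edge_connected k G"
    and S: "S \<subseteq> vertices G" "S \<noteq> {}" "S \<noteq> vertices G"
  shows "k \<le> card (cut (edges G) (tail D) (head D) S)"
proof (rule ccontr)
  let ?F = "cut (edges G) (tail D) (head D) S"
  assume "\<not> ?thesis"
  then have conn: "connected_graph (delete_edges G ?F)"
    using k by (auto simp: edge_connected_def cut_def)
  obtain u w where u: "u \<in> S" and w: "w \<in> vertices G" "w \<notin> S" using S by auto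
  have "(u, w) \<in> (adj_rel (delete_edges G ?F))\<^sup>*"
    using conn u w S by (auto simp: connected_graph_def delete_edges_def)
  then have "w \<in> S"
  proof (induction rule: rtrancl_induct)
    case base
    then show ?case by (rule u)
  next
    case (step y x)
    then obtain e where e: "e \<in> edges G" "e \<notin> ?F" "ends G e = {y, x}"
      by (auto simp: adj_rel_def delete_edges_def)
    have "{tail D e, head D e} = {y, x}" using D e by (auto simp: orientation_of_def)
    then show ?case using e step by (auto simp: cut_def doubleton_eq_iff)
  qed
  then show False using w by simp
qed

section \<open>Contracting a doubly connected set of vertices\<close>

text \<open>Connectedness of the edges \<open>T\<close> on the vertex set \<open>U\<close>, in terms of cuts.\<close>

definition connects :: "'e set \<Rightarrow> ('e \<Rightarrow> 'v) \<Rightarrow> ('e \<Rightarrow> 'v) \<Rightarrow> 'v set \<Rightarrow> bool" where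
  "connects T t h U \<longleftrightarrow> (\<forall>S\<subseteq>U. S \<noteq> {} \<longrightarrow> S \<noteq> U \<longrightarrow> cut T t h S \<noteq> {})"

definition span2 :: "'a::ab_group_add \<Rightarrow> 'a \<Rightarrow> 'a set" where
  "span2 b1 b2 = {zmul i b1 + zmul j b2 | i j. \<bar>i\<bar> \<le> 1 \<and> \<bar>j\<bar> \<le> 1}"

text \<open>The coefficients are differences of numbers in \<open>{-1, 0, 1}\<close>, and an odd coefficient means that one of the
  two is zero and the other is not. So sums with different sets of nonzero coefficients are
  distinguished, whatever the signs; elements of order two are allowed.\<close>

definition dissoc4 :: "'a::ab_group_add \<Rightarrow> 'a \<Rightarrow> 'a \<Rightarrow> 'a \<Rightarrow> bool" where
  "dissoc4 b1 b2 c1 c2 \<longleftrightarrow> (\<forall>i j k l. \<bar>i\<bar> \<le> 2 \<longrightarrow> \<bar>j\<bar> \<le> 2 \<longrightarrow> \<bar>k\<bar> \<le> 2 \<longrightarrow> \<bar>l\<bar> \<le> 2 \<longrightarrow>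
     odd i \<or> odd j \<or> odd k \<or> odd l \<longrightarrow> zmul i b1 + zmul j b2 + zmul k c1 + zmul l c2 \<noteq> 0)"

lemma dissoc4_swap: "dissoc4 b1 b2 c1 c2 \<Longrightarrow> dissoc4 c1 c2 b1 b2"
  unfolding dissoc4_def
proof (intro allI impI)
  fix i j k l :: int
  assume *: "\<forall>i j k l. \<bar>i\<bar> \<le> 2 \<longrightarrow> \<bar>j\<bar> \<le> 2 \<longrightarrow> \<bar>k\<bar> \<le> 2 \<longrightarrow> \<bar>l\<bar> \<le> 2 \<longrightarrow>
      odd i \<or> odd j \<or> odd k \<or> odd l \<longrightarrow> zmul i b1 + zmul j b2 + zmul k c1 + zmul l c2 \<noteq> 0"
    and b: "\<bar>i\<bar> \<le> 2" "\<bar>j\<bar> \<le> 2" "\<bar>k\<bar> \<le> 2" "\<bar>l\<bar> \<le> 2" "odd i \<or> odd j \<or> odd k \<or> odd l"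
  have "zmul k b1 + zmul l b2 + zmul i c1 + zmul j c2 \<noteq> 0"
    using *[rule_format, of k l i j] b by blast
  then show "zmul i c1 + zmul j c2 + zmul k b1 + zmul l b2 \<noteq> 0" by (simp add: ac_simps)
qed

lemma span2I: "\<bar>i\<bar> \<le> 1 \<Longrightarrow> \<bar>j\<bar> \<le> 1 \<Longrightarrow> zmul i b1 + zmul j b2 \<in> span2 b1 b2"
  by (auto simp: span2_def)

lemma span2_uminus: "x \<in> span2 b1 b2 \<Longrightarrow> - x \<in> span2 b1 b2"
proof -
  assume "x \<in> span2 b1 b2"
  then obtain i j where "x = zmul i b1 + zmul j b2" "\<bar>i\<bar> \<le> 1" "\<bar>j\<bar> \<le> 1" by (auto simp: span2_def)
  then have "- x = zmul (- i) b1 + zmul (- j) b2" "\<bar>- i\<bar> \<le> 1" "\<bar>- j\<bar> \<le> 1" by (auto simp: zmul_minus)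
  then show ?thesis using span2I by metis
qed

lemma connects_path:
  fixes t h :: "'e \<Rightarrow> 'v"
  assumes "loopfree V E t h" "U \<subseteq> V" "T \<subseteq> E" "\<And>e. e \<in> T \<Longrightarrow> t e \<in> U \<and> h e \<in> U"
    "connects T t h U" "x \<in> U" "y \<in> U"
  shows "\<exists>p::'e \<Rightarrow> int. (\<forall>e. e \<notin> T \<longrightarrow> p e = 0) \<and> (\<forall>v. net E t h p v = of_bool (v = x) - of_bool (v = y))"
proof -
  have fin: "finite T" "finite U" "finite E" using assms finite_subset by (auto simp: loopfree_def)
  let ?d = "\<lambda>v. of_bool (v = x) - of_bool (v = y) :: int"
  have sd: "sum ?d S = of_bool (x \<in> S) - of_bool (y \<in> S)" if "S \<subseteq> U" for S
    by (rule sum_demand[OF finite_subset[OF that fin(2)]])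
  have "\<bar>sum ?d S\<bar> \<le> card (cut T t h S)" if S: "S \<subseteq> U" for S
  proof (cases "S = {} \<or> S = U")
    case True
    then show ?thesis using sd[OF S] assms by auto
  next
    case False
    then have "cut T t h S \<noteq> {}" using assms S by (auto simp: connects_def)
    then have "card (cut T t h S) \<ge> 1" using fin by (simp add: Suc_le_eq card_gt_0_iff)
    then show ?thesis using sd[OF S] by auto
  qed
  moreover have "sum ?d U = 0" using sd[of U] assms by simp
  moreover have "t e \<in> U \<and> h e \<in> U \<and> t e \<noteq> h e" if "e \<in> T" for e
    using assms that by (auto simp: loopfree_def)
  ultimately obtain p where p: "\<forall>e. e \<notin> T \<longrightarrow> p e = 0" "\<forall>v\<in>U. net T t h p v = ?d v"
    using unit_flow_exists[of T U t h ?d] fin by blast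
  have "net E t h p v = ?d v" for v
  proof -
    have "net E t h p v = net T t h p v"
      using fin assms p by (intro net_mono_support) auto
    also have "\<dots> = ?d v"
    proof (cases "v \<in> U")
      case True
      then show ?thesis using p by blast
    next
      case False
      have "net T t h p v = 0" unfolding net_def by (rule sum.neutral) (use assms(4) False in auto)
      then show ?thesis using False assms by auto
    qed
    finally show ?thesis .
  qed
  then show ?thesis using p by blast
qed

lemma connects_demand:
  fixes t h :: "'e \<Rightarrow> 'v"
  assumes G: "loopfree V E t h" "U \<subseteq> V" "T \<subseteq> E" "\<And>e. e \<in> T \<Longrightarrow> t e \<in> U \<and> h e \<in> U"
    "connects T t h U" and "sum d U = 0" "u0 \<in> U"
  shows "\<exists>p::'e \<Rightarrow> int. (\<forall>e. e \<notin> T \<longrightarrow> p e = 0) \<and> (\<forall>v. net E t h p v = (if v \<in> U then d v else 0))"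
proof -
  have fin: "finite U" using assms finite_subset by (auto simp: loopfree_def)
  have "\<forall>u\<in>U. \<exists>p::'e \<Rightarrow> int. (\<forall>e. e \<notin> T \<longrightarrow> p e = 0) \<and> (\<forall>v. net E t h p v = of_bool (v = u) - of_bool (v = u0))"
    using connects_path[OF G] assms(7) by blast
  from bchoice[OF this] obtain P :: "'v \<Rightarrow> 'e \<Rightarrow> int" where P: "\<And>u e. u \<in> U \<Longrightarrow> e \<notin> T \<Longrightarrow> P u e = 0"
    "\<And>u v. u \<in> U \<Longrightarrow> net E t h (P u) v = of_bool (v = u) - of_bool (v = u0)"
    by blast
  let ?p = "\<lambda>e. \<Sum>u\<in>U. d u * P u e"
  have "net E t h ?p v = (if v \<in> U then d v else 0)" for v
  proof -
    have "net E t h ?p v = (\<Sum>u\<in>U. d u * (of_bool (v = u) - of_bool (v = u0)))"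
      unfolding net_sum net_scale by (rule sum.cong) (use P in auto)
    also have "\<dots> = (\<Sum>u\<in>U. if v = u then d u else 0) - sum d U * of_bool (v = u0)"
      unfolding sum_distrib_right sum_subtractf[symmetric] by (rule sum.cong) (auto simp: algebra_simps)
    finally show ?thesis using assms fin by simp
  qed
  then show ?thesis using P by (intro exI[of _ ?p]) auto
qed

text \<open>Each edge of \<open>T'\<close> with \<open>J\<close> is closed to a cycle through \<open>T\<close>, and the sum of these cycles is reduced
  modulo 2. Only the signs of the result are out of control.\<close>

lemma connects_parity:
  fixes t h :: "'e \<Rightarrow> 'v"
  assumes G: "loopfree V E t h" "U \<subseteq> V" "T \<subseteq> E" "\<And>e. e \<in> T \<Longrightarrow> t e \<in> U \<and> h e \<in> U"
    "connects T t h U"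
    and T': "T' \<subseteq> E" "\<And>e. e \<in> T' \<Longrightarrow> t e \<in> U \<and> h e \<in> U" "T \<inter> T' = {}"
  shows "\<exists>u. circ E t h u \<and> (\<forall>e. \<bar>u e\<bar> \<le> (1::int)) \<and> (\<forall>e. e \<notin> T \<union> T' \<longrightarrow> u e = 0) \<and>
    (\<forall>e\<in>T'. u e \<noteq> 0 \<longleftrightarrow> J e)"
proof -
  have finE: "finite E" using G by (auto simp: loopfree_def)
  define J' where "J' = {e\<in>T'. J e}"
  have J': "J' \<subseteq> E" "J' \<subseteq> T'" "finite J'" using T' finE finite_subset[OF _ finE] by (auto simp: J'_def)
  have "\<forall>a\<in>J'. \<exists>p::'e \<Rightarrow> int. (\<forall>e. e \<notin> T \<longrightarrow> p e = 0) \<and> (\<forall>v. net E t h p v = of_bool (v = h a) - of_bool (v = t a))"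
    using connects_path[OF G] T'(2) J' by blast
  from bchoice[OF this] obtain P :: "'e \<Rightarrow> 'e \<Rightarrow> int" where P: "\<And>a e. a \<in> J' \<Longrightarrow> e \<notin> T \<Longrightarrow> P a e = 0"
    "\<And>a v. a \<in> J' \<Longrightarrow> net E t h (P a) v = of_bool (v = h a) - of_bool (v = t a)"
    by blast
  define z :: "'e \<Rightarrow> int" where "z e = (\<Sum>a\<in>J'. of_bool (e = a) + P a e)" for e
  have net1: "net E t h (\<lambda>e. of_bool (e = a)) v = (of_bool (v = t a) - of_bool (v = h a) :: int)" if "a \<in> E" for a v
    by (rule net_single[OF finE that])
  have "circ E t h z"
    unfolding circ_def z_def[abs_def] net_sum net_add
    using P net1 J' by (auto intro!: sum.neutral)
  then obtain u where u: "circ E t h u" "\<forall>e\<in>E. \<bar>u e\<bar> \<le> (1::int)" "\<forall>e. even (u e - z e)" "\<forall>e. z e = 0 \<longrightarrow> u e = 0"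
    using unit_circ_mod2[OF finE] by blast
  have z0: "z e = 0" if "e \<notin> T \<union> T'" for e
    unfolding z_def by (rule sum.neutral) (use that P J' in auto)
  have zJ: "z e = of_bool (J e)" if "e \<in> T'" for e
  proof -
    have "e \<notin> T" using that T'(3) by blast
    have "z e = (\<Sum>a\<in>J'. of_bool (e = a))"
      unfolding z_def by (rule sum.cong) (use \<open>e \<notin> T\<close> P in auto)
    then show ?thesis using J'(3) that by (simp add: J'_def of_bool_def)
  qed
  have "u e \<noteq> 0 \<longleftrightarrow> J e" if e: "e \<in> T'" for e
  proof -
    have "\<bar>u e\<bar> \<le> 1" "even (u e - z e)" using u e T' by auto
    then show ?thesis using zJ[OF e] by (cases "J e") (auto; presburger)+
  qed
  moreover have "\<bar>u e\<bar> \<le> 1" for e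
  proof (cases "e \<in> E")
    case False
    then have "u e = 0" using z0[of e] u(4) G(3) T'(1) by blast
    then show ?thesis by simp
  qed (use u in auto)
  moreover have "u e = 0" if "e \<notin> T \<union> T'" for e using z0[OF that] u(4) by blast
  ultimately show ?thesis using u(1) by blast
qed

locale doubly_connected =
  fixes V :: "'v set" and E :: "'e set" and t h :: "'e \<Rightarrow> 'v" and U :: "'v set" and T1 T2 :: "'e set"
  assumes G: "loopfree V E t h" and UV: "U \<subseteq> V"
    and T1E: "T1 \<subseteq> E" and T2E: "T2 \<subseteq> E" and disj: "T1 \<inter> T2 = {}"
    and T1U: "\<And>e. e \<in> T1 \<Longrightarrow> t e \<in> U \<and> h e \<in> U" and T2U: "\<And>e. e \<in> T2 \<Longrightarrow> t e \<in> U \<and> h e \<in> U"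
    and conn1: "connects T1 t h U" and conn2: "connects T2 t h U"
begin

abbreviation "H \<equiv> T1 \<union> T2"

lemma finE: "finite E" using G by (simp add: loopfree_def)

definition hcirc :: "('e \<Rightarrow> int) \<Rightarrow> bool" where
  "hcirc p \<longleftrightarrow> circ E t h p \<and> (\<forall>e. \<bar>p e\<bar> \<le> 1) \<and> (\<forall>e. e \<notin> H \<longrightarrow> p e = 0)"

text \<open>The adjustments of a circulation inside \<open>H\<close> by the elements \<open>b1\<close> and \<open>b2\<close>.\<close>

definition adjust :: "'a::ab_group_add \<Rightarrow> 'a \<Rightarrow> ('e \<Rightarrow> 'a) \<Rightarrow> bool" where
  "adjust b1 b2 s \<longleftrightarrow> (\<exists>p q. hcirc p \<and> hcirc q \<and> s = (\<lambda>e. zmul (p e) b1 + zmul (q e) b2))"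

text \<open>Adding to \<open>g\<close> the adjustment \<open>s\<close> and any adjustment by \<open>b1\<close> and \<open>b2\<close> never gives zero on \<open>H\<close>; the set
  \<open>span2 b1 b2\<close> is closed under negation.\<close>

definition safe :: "('e \<Rightarrow> 'a::ab_group_add) \<Rightarrow> ('e \<Rightarrow> 'a) \<Rightarrow> 'a \<Rightarrow> 'a \<Rightarrow> bool" where
  "safe g s b1 b2 \<longleftrightarrow> (\<forall>e\<in>H. g e + s e \<notin> span2 b1 b2)"

definition nzoff :: "('e \<Rightarrow> 'a::ab_group_add) \<Rightarrow> bool" where
  "nzoff g \<longleftrightarrow> circ E t h g \<and> (\<forall>e\<in>E - H. g e \<noteq> 0)"

lemma hcirc_zero [simp]: "hcirc (\<lambda>e. 0)" by (simp add: hcirc_def)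

lemma adjust_zero: "adjust b1 b2 (\<lambda>e. 0)"
  unfolding adjust_def by (intro exI[of _ "\<lambda>e. 0"]) simp

lemma adjust_off: "adjust b1 b2 s \<Longrightarrow> e \<notin> H \<Longrightarrow> s e = 0"
  by (auto simp: adjust_def hcirc_def)

lemma adjust_circ: "adjust b1 b2 s \<Longrightarrow> circ E t h s"
  by (auto simp: adjust_def hcirc_def intro!: circ_add circ_zmul)

lemma adjust_span: "adjust b1 b2 s \<Longrightarrow> s e \<in> span2 b1 b2"
  by (auto simp: adjust_def hcirc_def intro!: span2I)

text \<open>On each edge at most one pattern of zero and nonzero coefficients of \<open>c1, c2\<close> can be unsafe. The
  coefficient of \<open>c1\<close> is chosen against it on \<open>T2\<close> and the coefficient of \<open>c2\<close> on \<open>T1\<close>.\<close>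

lemma safe_exists:
  assumes dis: "dissoc4 b1 b2 c1 c2"
  shows "\<exists>s. adjust c1 c2 s \<and> safe g s b1 b2"
proof -
  define bad where "bad e r1 r2 \<longleftrightarrow> (\<exists>i j. \<bar>i\<bar> \<le> 1 \<and> \<bar>j\<bar> \<le> 1 \<and> (i \<noteq> 0) = r1 \<and> (j \<noteq> 0) = r2 \<and>
      g e + (zmul i c1 + zmul j c2) \<in> span2 b1 b2)" for e r1 r2
  have uniq: "r1 = q1 \<and> r2 = q2" if bad: "bad e r1 r2" "bad e q1 q2" for e r1 r2 q1 q2
  proof -
    obtain i j where ij: "\<bar>i\<bar> \<le> 1" "\<bar>j\<bar> \<le> 1" "(i \<noteq> 0) = r1" "(j \<noteq> 0) = r2" "g e + (zmul i c1 + zmul j c2) \<in> span2 b1 b2"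
      using bad(1) unfolding bad_def by blast
    obtain k l where kl: "\<bar>k\<bar> \<le> 1" "\<bar>l\<bar> \<le> 1" "(k \<noteq> 0) = q1" "(l \<noteq> 0) = q2" "g e + (zmul k c1 + zmul l c2) \<in> span2 b1 b2"
      using bad(2) unfolding bad_def by blast
    obtain m n where mn: "\<bar>m\<bar> \<le> 1" "\<bar>n\<bar> \<le> 1" "g e + (zmul i c1 + zmul j c2) = zmul m b1 + zmul n b2"
      using ij(5) by (auto simp: span2_def)
    obtain m' n' where mn': "\<bar>m'\<bar> \<le> 1" "\<bar>n'\<bar> \<le> 1" "g e + (zmul k c1 + zmul l c2) = zmul m' b1 + zmul n' b2"
      using kl(5) by (auto simp: span2_def)
    have "zmul (m' - m) b1 + zmul (n' - n) b2 + zmul (i - k) c1 + zmul (j - l) c2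
      = (zmul m' b1 + zmul n' b2) - (zmul m b1 + zmul n b2) + (g e + (zmul i c1 + zmul j c2)) - (g e + (zmul k c1 + zmul l c2))"
      by (simp add: zmul_diff algebra_simps)
    also have "\<dots> = 0" unfolding mn(3) mn'(3) by (simp add: algebra_simps)
    finally have z: "zmul (m' - m) b1 + zmul (n' - n) b2 + zmul (i - k) c1 + zmul (j - l) c2 = 0" .
    have diff2: "\<bar>x - y\<bar> \<le> 2" if "\<bar>x\<bar> \<le> 1" "\<bar>y\<bar> \<le> 1" for x y :: int using that by linarith
    have "\<bar>m' - m\<bar> \<le> 2" "\<bar>n' - n\<bar> \<le> 2" "\<bar>i - k\<bar> \<le> 2" "\<bar>j - l\<bar> \<le> 2"
      by (intro diff2 ij(1,2) kl(1,2) mn(1,2) mn'(1,2))+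
    note ne = dis[unfolded dissoc4_def, rule_format, OF this]
    have "\<not> (odd (m' - m) \<or> odd (n' - n) \<or> odd (i - k) \<or> odd (j - l))"
    proof
      assume "odd (m' - m) \<or> odd (n' - n) \<or> odd (i - k) \<or> odd (j - l)"
      from ne[OF this] z show False by (rule notE)
    qed
    then have "even (i - k)" "even (j - l)" by simp_all
    then have "(i \<noteq> 0) = (k \<noteq> 0)" "(j \<noteq> 0) = (l \<noteq> 0)" using ij(1,2) kl(1,2) by presburger+
    then show ?thesis using ij kl by blast
  qed
  have "\<exists>x1 x2. \<forall>r1 r2. bad e r1 r2 \<longrightarrow> r1 = x1 \<and> r2 = x2" for e
    using uniq by metis
  then obtain x1 x2 where x: "\<And>e r1 r2. bad e r1 r2 \<Longrightarrow> r1 = x1 e \<and> r2 = x2 e"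
    by metis
  obtain p where p: "hcirc p" "\<forall>e\<in>T2. p e \<noteq> 0 \<longleftrightarrow> \<not> x1 e"
    using connects_parity[OF G UV T1E T1U conn1 T2E T2U disj, of "\<lambda>e. \<not> x1 e"] unfolding hcirc_def by blast
  have disj': "T2 \<inter> T1 = {}" using disj by blast
  obtain q where q: "hcirc q" "\<forall>e\<in>T1. q e \<noteq> 0 \<longleftrightarrow> \<not> x2 e"
    using connects_parity[OF G UV T2E T2U conn2 T1E T1U disj', of "\<lambda>e. \<not> x2 e"] unfolding hcirc_def Un_commute[of T2] by blast
  let ?s = "\<lambda>e. zmul (p e) c1 + zmul (q e) c2"
  have "safe g ?s b1 b2"
    unfolding safe_def
  proof (intro ballI notI)
    fix e assume e: "e \<in> H" and sp: "g e + ?s e \<in> span2 b1 b2"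
    have "bad e (p e \<noteq> 0) (q e \<noteq> 0)"
      unfolding bad_def using p(1) q(1) sp
      by (intro exI[of _ "p e"] exI[of _ "q e"]) (auto simp: hcirc_def)
    then have "(p e \<noteq> 0) = x1 e" "(q e \<noteq> 0) = x2 e" using x by blast+
    then show False using e p(2) q(2) by blast
  qed
  moreover have "adjust c1 c2 ?s" unfolding adjust_def using p q by blast
  ultimately show ?thesis by blast
qed

lemma safe_nonzero:
  assumes "nzoff g" "adjust b1 b2 s" "adjust c1 c2 s'" "safe g s c1 c2"
  shows "nzflow E t h (\<lambda>e. g e + s e + s' e)"
proof -
  have "g e + s e + s' e \<noteq> 0" if e: "e \<in> E" for e
  proof (cases "e \<in> H")
    case True
    show ?thesis
    proof
      assume "g e + s e + s' e = 0"
      then have "g e + s e = - s' e" by (simp add: eq_neg_iff_add_eq_0)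
      then show False using assms(4) True span2_uminus[OF adjust_span[OF assms(3), of e]]
        unfolding safe_def by metis
    qed
  next
    case False
    then have "s e = 0" "s' e = 0" "g e \<noteq> 0"
      using adjust_off[OF assms(2)] adjust_off[OF assms(3)] assms(1) e by (auto simp: nzoff_def)
    then show ?thesis by simp
  qed
  moreover have "circ E t h (\<lambda>e. g e + s e + s' e)"
    using assms(1) by (intro circ_add adjust_circ[OF assms(2)] adjust_circ[OF assms(3)]) (auto simp: nzoff_def)
  ultimately show ?thesis by (simp add: nzflow_def)
qed

lemma nzflow_commute: "nzflow E t h (\<lambda>e. g e + s e + s' e) \<Longrightarrow> nzflow E t h (\<lambda>e. g e + s' e + s e)"
  by (simp add: ac_simps)

text \<open>The two coefficients are first brought to zero and then to their new values, one at a time; all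
  values in between are adjustments too, so safety keeps them away from zero.\<close>

lemma adjust_freely:
  assumes g: "nzoff g" and s: "adjust b1 b2 s" "safe g s c1 c2" and s': "adjust c1 c2 s'" "adjust c1 c2 s''"
  shows "reach E t h (\<lambda>e. g e + s e + s' e) (\<lambda>e. g e + s e + s'' e)"
proof -
  have *: "reach E t h (\<lambda>e. g e + s e + r e) (\<lambda>e. g e + s e + 0)" if r: "adjust c1 c2 r" for r
  proof -
    obtain p q where pq: "hcirc p" "hcirc q" "r = (\<lambda>e. zmul (p e) c1 + zmul (q e) c2)"
      using r by (auto simp: adjust_def)
    have ad: "adjust c1 c2 (\<lambda>e. zmul 0 c1 + zmul (q e) c2)"
      unfolding adjust_def using pq by (intro exI[of _ "\<lambda>e. 0"] exI[of _ q]) simp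
    have n: "nzflow E t h (\<lambda>e. g e + s e + r e)" "nzflow E t h (\<lambda>e. g e + s e + (zmul 0 c1 + zmul (q e) c2))"
      "nzflow E t h (\<lambda>e. g e + s e + 0)"
      using safe_nonzero[OF g s(1) _ s(2)] r ad adjust_zero by blast+
    have "ustep E t h (\<lambda>e. g e + s e + r e) (\<lambda>e. g e + s e + (zmul 0 c1 + zmul (q e) c2))"
      unfolding ustep_def using n pq circ_uminus[of E t h p]
      by (intro conjI exI[of _ c1] exI[of _ "\<lambda>e. - p e"]) (auto simp: hcirc_def zmul_minus)
    moreover have "ustep E t h (\<lambda>e. g e + s e + (zmul 0 c1 + zmul (q e) c2)) (\<lambda>e. g e + s e + 0)"
      unfolding ustep_def using n pq circ_uminus[of E t h q]
      by (intro conjI exI[of _ c2] exI[of _ "\<lambda>e. - q e"]) (auto simp: hcirc_def zmul_minus)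
    ultimately show ?thesis by (meson converse_rtranclp_into_rtranclp rtranclp.rtrancl_refl)
  qed
  show ?thesis using *[OF s'(1)] reach_sym[OF *[OF s'(2)]] by (rule rtranclp_trans)
qed

text \<open>The circulation \<open>g\<close> may vanish on \<open>H\<close>; it stands for the flows obtained from it by adjustments.\<close>

definition reached where
  "reached f b1 b2 c1 c2 g \<longleftrightarrow> (\<exists>s s'. adjust b1 b2 s \<and> adjust c1 c2 s' \<and>
     reach E t h f (\<lambda>e. g e + s e + s' e) \<and> (safe g s c1 c2 \<or> safe g s' b1 b2))"

lemma reachedE:
  assumes "reached f b1 b2 c1 c2 g"
  obtains s s' where "adjust b1 b2 s" "adjust c1 c2 s'" "reach E t h f (\<lambda>e. g e + s e + s' e)"
    "safe g s c1 c2 \<or> safe g s' b1 b2"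
  using assms unfolding reached_def by blast

lemma reached_swap: "reached f b1 b2 c1 c2 g \<Longrightarrow> reached f c1 c2 b1 b2 g"
proof -
  assume "reached f b1 b2 c1 c2 g"
  then obtain s s' where s: "adjust b1 b2 s" "adjust c1 c2 s'" "reach E t h f (\<lambda>e. g e + s e + s' e)"
    "safe g s c1 c2 \<or> safe g s' b1 b2" by (rule reachedE)
  have "(\<lambda>e. g e + s e + s' e) = (\<lambda>e. g e + s' e + s e)" by (simp add: ac_simps)
  then show ?thesis using s unfolding reached_def 
    by - (rule exI[of _ s'], rule exI[of _ s], simp, blast)
qed

text \<open>If \<open>s\<close> is safe for \<open>g\<close>, replace the other adjustment by one that is safe for the shifted circulation. Then
  both the flow before and the flow after the shift are nowhere zero, and the roles are exchanged.\<close>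

lemma reached_step:
  assumes dis: "dissoc4 b1 b2 c1 c2" and g: "nzoff g" "nzoff (\<lambda>e. g e + zmul (z e) b)"
    and z: "circ E t h z" "\<And>e. \<bar>z e\<bar> \<le> (1::int)" and r: "reached f b1 b2 c1 c2 g"
  shows "reached f b1 b2 c1 c2 (\<lambda>e. g e + zmul (z e) b)"
proof -
  let ?g = "\<lambda>e. g e + zmul (z e) b"
  have *: "reached f b1 b2 c1 c2 ?g"
    if dis: "dissoc4 b1 b2 c1 c2" and s: "adjust b1 b2 s" and s': "adjust c1 c2 s'"
      and r: "reach E t h f (\<lambda>e. g e + s e + s' e)" and sf: "safe g s c1 c2" for b1 b2 c1 c2 s s'
  proof -
    obtain r where r': "adjust c1 c2 r" "safe ?g r b1 b2" using safe_exists[OF dis] by blast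
    have n: "nzflow E t h (\<lambda>e. g e + s e + r e)" "nzflow E t h (\<lambda>e. ?g e + s e + r e)"
      using safe_nonzero[OF g(1) s r'(1) sf] nzflow_commute[OF safe_nonzero[OF g(2) r'(1) s r'(2)]] .
    have r1: "reach E t h f (\<lambda>e. g e + s e + r e)"
      using r adjust_freely[OF g(1) s sf s' r'(1)] by (rule rtranclp_trans)
    have "ustep E t h (\<lambda>e. g e + s e + r e) (\<lambda>e. ?g e + s e + r e)"
      unfolding ustep_def using n z by (intro conjI exI[of _ b] exI[of _ z]) (auto simp: ac_simps)
    then have "reach E t h f (\<lambda>e. ?g e + s e + r e)" using rtranclp.rtrancl_into_rtrancl[OF r1, of "\<lambda>e. ?g e + s e + r e"] by blast
    then show ?thesis unfolding reached_def using s r' by blast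
  qed
  obtain s s' where s: "adjust b1 b2 s" "adjust c1 c2 s'" "reach E t h f (\<lambda>e. g e + s e + s' e)"
    "safe g s c1 c2 \<or> safe g s' b1 b2" using r by (rule reachedE)
  from s(4) show ?thesis
  proof
    assume "safe g s c1 c2"
    then show ?thesis using * dis s by blast
  next
    assume sf: "safe g s' b1 b2"
    have "reach E t h f (\<lambda>e. g e + s' e + s e)" using s(3) by (simp add: ac_simps)
    then show ?thesis using *[OF dissoc4_swap[OF dis] s(2,1) _ sf] reached_swap by blast
  qed
qed

lemma reached_agree:
  assumes "nzoff g" "\<And>e. e \<in> E \<Longrightarrow> g' e = g e" "reached f b1 b2 c1 c2 g"
  shows "reached f b1 b2 c1 c2 g'"
proof -
  obtain s s' where s: "adjust b1 b2 s" "adjust c1 c2 s'" "reach E t h f (\<lambda>e. g e + s e + s' e)"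
    "safe g s c1 c2 \<or> safe g s' b1 b2" using assms(3) by (rule reachedE)
  have "nzflow E t h (\<lambda>e. g e + s e + s' e)"
    using s(4) safe_nonzero[OF assms(1) s(1,2)] nzflow_commute[OF safe_nonzero[OF assms(1) s(2,1)]] by blast
  then have "ustep E t h (\<lambda>e. g e + s e + s' e) (\<lambda>e. g' e + s e + s' e)"
    using assms(2) by (intro ustep_agree) auto
  then have "reach E t h f (\<lambda>e. g' e + s e + s' e)" using s(3) by (rule rtranclp.rtrancl_into_rtrancl[rotated])
  moreover have "safe g' s c1 c2 \<or> safe g' s' b1 b2"
    using s(4) assms(2) T1E T2E by (auto simp: safe_def)
  ultimately show ?thesis unfolding reached_def using s by blast
qed

text \<open>Lifted circulations may be large on \<open>H\<close>, so they are applied one directed cycle at a time.\<close>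

lemma reached_shift:
  assumes dis: "dissoc4 b1 b2 c1 c2" and g: "nzoff g" "nzoff (\<lambda>e. g e + zmul (z e) b)"
    and z: "circ E t h z" "\<And>e. e \<in> E - H \<Longrightarrow> \<bar>z e\<bar> \<le> (1::int)" and r: "reached f b1 b2 c1 c2 g"
  shows "reached f b1 b2 c1 c2 (\<lambda>e. g e + zmul (z e) b)"
  using g z r
proof (induction "\<Sum>e\<in>E. nat \<bar>z e\<bar>" arbitrary: z g rule: less_induct)
  case less
  show ?case
  proof (cases "\<forall>e\<in>E. z e = 0")
    case True
    then show ?thesis by (intro reached_agree[OF less.prems(1) _ less.prems(5)]) simp
  next
    case False
    then obtain e where e: "e \<in> E" "z e \<noteq> 0" by auto
    obtain c where c: "circ E t h c" "conforms E c z" "c e \<noteq> 0"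
      using dicycle_through[OF finE less.prems(3) e] by blast
    let ?g = "\<lambda>e. g e + zmul (c e) b"
    have off: "c e = 0 \<or> c e = z e" if "e \<in> E - H" for e
    proof -
      have "\<bar>z e\<bar> \<le> 1" using less.prems(4) that by blast
      then have "z e = sgn (z e)" by (auto simp: sgn_if)
      then show ?thesis using conforms_cases[OF c(2), of e] by presburger
    qed
    have g': "nzoff ?g"
      unfolding nzoff_def
    proof
      show "circ E t h ?g" using less.prems(1) c(1) by (intro circ_add circ_zmul) (auto simp: nzoff_def)
      show "\<forall>e\<in>E - H. ?g e \<noteq> 0"
        using off less.prems(1,2) unfolding nzoff_def by (metis add.right_neutral zmul_simps(1))
    qed
    have r1: "reached f b1 b2 c1 c2 ?g"
      by (rule reached_step[OF dis less.prems(1) g' c(1) conforms_unit[OF c(2)] less.prems(5)])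
    have eq: "(\<lambda>e. ?g e + zmul (z e - c e) b) = (\<lambda>e. g e + zmul (z e) b)"
      by (simp add: zmul_diff)
    have "reached f b1 b2 c1 c2 (\<lambda>e. ?g e + zmul (z e - c e) b)"
    proof (rule less.hyps[OF conforms_abs_diff[OF finE c(2,3)] g' _ _ _ r1])
      show "nzoff (\<lambda>e. ?g e + zmul (z e - c e) b)" using less.prems(2) unfolding eq .
      show "circ E t h (\<lambda>e. z e - c e)" by (intro circ_diff less.prems c)
      show "\<bar>z e - c e\<bar> \<le> 1" if "e \<in> E - H" for e
        using off[OF that] less.prems(4)[OF that] by auto
    qed
    then show ?thesis unfolding eq .
  qed
qed

lemma reached_start:
  assumes "nzflow E t h f" "\<And>e. e \<in> H \<Longrightarrow> f e \<notin> span2 b1 b2"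
  shows "reached f b1 b2 c1 c2 f"
  unfolding reached_def
  by (intro exI[of _ "\<lambda>e. 0"]) (use assms adjust_zero in \<open>auto simp: safe_def\<close>)

lemma reached_end:
  assumes dis: "dissoc4 b1 b2 c1 c2" and f': "nzflow E t h f'" "\<And>e. e \<in> H \<Longrightarrow> f' e \<notin> span2 b1 b2"
    and r: "reached f b1 b2 c1 c2 f'"
  shows "reach E t h f f'"
proof -
  have nz: "nzoff f'" using f' by (auto simp: nzoff_def nzflow_def)
  obtain s s' where s: "adjust b1 b2 s" "adjust c1 c2 s'" "reach E t h f (\<lambda>e. f' e + s e + s' e)"
    "safe f' s c1 c2 \<or> safe f' s' b1 b2" using r by (rule reachedE)
  obtain q where q: "adjust b1 b2 q" "safe f' q c1 c2"
    "reach E t h f (\<lambda>e. f' e + q e + s' e)"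
  proof (cases "safe f' s c1 c2")
    case True
    then show ?thesis using that s by blast
  next
    case False
    then have sf: "safe f' s' b1 b2" using s by blast
    obtain q where q: "adjust b1 b2 q" "safe f' q c1 c2" using safe_exists[OF dissoc4_swap[OF dis]] by blast
    have "reach E t h (\<lambda>e. f' e + s e + s' e) (\<lambda>e. f' e + q e + s' e)"
      using adjust_freely[OF nz s(2) sf s(1) q(1)] by (simp add: ac_simps)
    then show ?thesis using that q rtranclp_trans[OF s(3)] by blast
  qed
  have "reach E t h (\<lambda>e. f' e + q e + s' e) (\<lambda>e. f' e + q e + 0)"
    by (rule adjust_freely[OF nz q(1,2) s(2) adjust_zero])
  then have r1: "reach E t h f (\<lambda>e. f' e + q e)" using q(3) by simp
  have "safe f' (\<lambda>e. 0) b1 b2" using f' by (auto simp: safe_def)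
  then have "reach E t h (\<lambda>e. f' e + 0 + q e) (\<lambda>e. f' e + 0 + 0)"
    by (intro adjust_freely[OF nz adjust_zero[of c1 c2] _ q(1) adjust_zero])
  then show ?thesis using r1 by simp
qed


section \<open>Lifting from the contracted graph\<close>

definition quot :: "'v \<Rightarrow> 'v \<Rightarrow> 'v" where "quot u0 v = (if v \<in> U then u0 else v)"

definition outer :: "'e set" where "outer = {e\<in>E. \<not> (t e \<in> U \<and> h e \<in> U)}"

lemma outer_E: "outer \<subseteq> E" "finite outer" "outer \<inter> H = {}"
  using finE T1U T2U by (auto simp: outer_def)

context
  fixes u0 assumes u0: "u0 \<in> U"
begin

abbreviation "tq \<equiv> quot u0 \<circ> t"
abbreviation "hq \<equiv> quot u0 \<circ> h"

lemma quot_eq: "v \<noteq> u0 \<Longrightarrow> quot u0 x = v \<longleftrightarrow> x = v \<and> v \<notin> U" "quot u0 x = u0 \<longleftrightarrow> x \<in> U"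
  using u0 by (auto simp: quot_def)

text \<open>The contracted vertex \<open>u0\<close> collects the net outflow of all of \<open>U\<close>.\<close>

lemma net_outer:
  "v \<notin> U \<Longrightarrow> net outer tq hq z v = net E t h z v"
  "net outer tq hq z u0 = (\<Sum>u\<in>U. net E t h z u)"
  "v \<in> U \<Longrightarrow> v \<noteq> u0 \<Longrightarrow> net outer tq hq z v = 0"
proof -
  show "net outer tq hq z v = net E t h z v" if "v \<notin> U"
  proof -
    have "v \<noteq> u0" using that u0 by auto
    then have "net outer tq hq z v = (\<Sum>e\<in>outer. (if t e = v then z e else 0) - (if h e = v then z e else 0))"
      unfolding net_def using that by (intro sum.cong) (auto simp: quot_eq)
    also have "\<dots> = net E t h z v"
      unfolding net_def by (rule sum.mono_neutral_left) (use finE that in \<open>auto simp: outer_def\<close>)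
    finally show ?thesis .
  qed
  have "finite U" using UV G finite_subset by (auto simp: loopfree_def)
  then have "(\<Sum>u\<in>U. net E t h z u) = (\<Sum>e\<in>E. (if t e \<in> U then z e else 0) - (if h e \<in> U then z e else 0))"
    by (rule sum_net)
  also have "\<dots> = (\<Sum>e\<in>outer. (if t e \<in> U then z e else 0) - (if h e \<in> U then z e else 0))"
    using finE by (intro sum.mono_neutral_right) (auto simp: outer_def)
  finally show "net outer tq hq z u0 = (\<Sum>u\<in>U. net E t h z u)" unfolding net_def by (simp add: quot_eq)
  show "net outer tq hq z v = 0" if "v \<in> U" "v \<noteq> u0"
    unfolding net_def using that by (intro sum.neutral) (auto simp: quot_eq)
qed

lemma circ_outer: "circ E t h g \<Longrightarrow> circ outer tq hq g"
  unfolding circ_def using net_outer by (metis sum.neutral)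

lemma lift_circ:
  assumes "circ outer tq hq (z :: 'e \<Rightarrow> int)"
  shows "\<exists>z'. circ E t h z' \<and> (\<forall>e\<in>outer. z' e = z e) \<and> (\<forall>e. e \<notin> outer \<longrightarrow> e \<notin> T1 \<longrightarrow> z' e = 0)"
proof -
  define z0 where "z0 e = (if e \<in> outer then z e else 0)" for e
  have c0: "circ outer tq hq z0" using assms circ_cong[of outer z0 z] by (auto simp: z0_def)
  have n0: "net E t h z0 v = 0" if "v \<notin> U" for v
    using net_outer(1)[OF that, of z0] c0 by (simp add: circ_def)
  have "(\<Sum>u\<in>U. net E t h z0 u) = 0"
    using net_outer(2)[of z0] c0 by (simp add: circ_def)
  then have "(\<Sum>u\<in>U. - net E t h z0 u) = 0" by (simp add: sum_negf)
  then obtain p where p: "\<forall>e. e \<notin> T1 \<longrightarrow> p e = 0"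
    "\<forall>v. net E t h p v = (if v \<in> U then - net E t h z0 v else 0)"
    using connects_demand[OF G UV T1E T1U conn1 _ u0, of "\<lambda>u. - net E t h z0 u"] by blast
  have "circ E t h (\<lambda>e. z0 e + p e)"
    unfolding circ_def net_add using p(2) n0 by auto
  moreover have "p e = 0" if "e \<in> outer" for e using p(1) that outer_E by blast
  ultimately show ?thesis using p(1) by (intro exI[of _ "\<lambda>e. z0 e + p e"]) (auto simp: z0_def)
qed

lemma lift_inner:
  assumes "a \<in> E - outer - H"
  shows "\<exists>z'. circ E t h z' \<and> z' a = (1::int) \<and> (\<forall>e. e \<noteq> a \<longrightarrow> e \<notin> T1 \<longrightarrow> z' e = 0)"
proof -
  have a: "t a \<in> U" "h a \<in> U" "a \<in> E" using assms by (auto simp: outer_def)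
  obtain p :: "'e \<Rightarrow> int" where p: "\<forall>e. e \<notin> T1 \<longrightarrow> p e = 0" "\<forall>v. net E t h p v = of_bool (v = h a) - of_bool (v = t a)"
    using connects_path[OF G UV T1E T1U conn1 a(2,1)] by blast
  have "circ E t h (\<lambda>e. of_bool (e = a) + p e)"
    unfolding circ_def net_add using p(2) net_single[OF finE a(3), of t h] by simp
  moreover have "p a = 0" using p(1) assms by auto
  ultimately show ?thesis using p(1) by (intro exI[of _ "\<lambda>e. of_bool (e = a) + p e"]) auto
qed

text \<open>The support of a group-valued circulation is bridgeless, so the cut condition for returning one unit
  along the other edges of the support holds.\<close>

lemma unit_circ_in_support:
  assumes "circ E t h (g :: 'e \<Rightarrow> 'a::ab_group_add)" "a \<in> E" "g a \<noteq> 0"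
  shows "\<exists>z. circ E t h z \<and> z a = (1::int) \<and> (\<forall>e. \<bar>z e\<bar> \<le> 1) \<and> (\<forall>e. e \<notin> E \<or> g e = 0 \<longrightarrow> z e = 0)"
proof -
  have finV: "finite V" and ends: "\<And>e. e \<in> E \<Longrightarrow> t e \<in> V \<and> h e \<in> V \<and> t e \<noteq> h e"
    using G by (auto simp: loopfree_def)
  define F where "F = {e\<in>E. g e \<noteq> 0} - {a}"
  have F: "finite F" "F \<subseteq> E" "a \<notin> F" using finE by (auto simp: F_def)
  let ?d = "\<lambda>v. of_bool (v = h a) - of_bool (v = t a) :: int"
  have sd: "sum ?d S = of_bool (h a \<in> S) - of_bool (t a \<in> S)" if "S \<subseteq> V" for S
    by (rule sum_demand[OF finite_subset[OF that finV]])
  have "\<bar>sum ?d S\<bar> \<le> card (cut F t h S)" if S: "S \<subseteq> V" for S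
  proof (cases "(t a \<in> S) = (h a \<in> S)")
    case True
    then show ?thesis using sd[OF S] by simp
  next
    case False
    have "finite S" using S finV finite_subset by blast
    then obtain e' where "e' \<in> E" "e' \<noteq> a" "g e' \<noteq> 0" "(t e' \<in> S) \<noteq> (h e' \<in> S)"
      using circ_cut_ne_single[OF finE _ assms(1,2,3) False] by blast
    then have "e' \<in> cut F t h S" by (auto simp: cut_def F_def)
    then have "card (cut F t h S) \<ge> 1" using F(1) finite_cut card_gt_0_iff by (metis Suc_leI One_nat_def empty_iff)
    then show ?thesis using sd[OF S] by auto
  qed
  moreover have "sum ?d V = 0" using sd[of V] ends[OF assms(2)] by simp
  moreover have "t e \<in> V \<and> h e \<in> V \<and> t e \<noteq> h e" if "e \<in> F" for e using ends that F by blast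
  ultimately obtain x where x: "\<forall>e. \<bar>x e\<bar> \<le> 1" "\<forall>e. e \<notin> F \<longrightarrow> x e = 0" "\<forall>v\<in>V. net F t h x v = ?d v"
    using unit_flow_exists[of F V t h ?d] F(1) finV by blast
  have nx: "net E t h x v = net F t h x v" for v using finE F x by (intro net_mono_support) auto
  have "net E t h (\<lambda>e. of_bool (e = a) + x e) v = 0" for v
  proof (cases "v \<in> V")
    case True
    then show ?thesis using x(3) unfolding net_add nx net_single[OF finE assms(2)] by simp
  next
    case False
    then show ?thesis using net_outside[OF G] by blast
  qed
  then have "circ E t h (\<lambda>e. of_bool (e = a) + x e)" by (simp add: circ_def)
  moreover have "x a = 0" using x F by blast
  moreover have "x e = 0" if "e \<notin> E \<or> g e = 0" for e using x(2) that by (auto simp: F_def)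
  ultimately show ?thesis using x(1) assms
    by (intro exI[of _ "\<lambda>e. of_bool (e = a) + x e"]) auto
qed

context
  fixes f f' :: "'e \<Rightarrow> 'a::ab_group_add" and b1 b2 c1 c2 :: 'a
  assumes dis: "dissoc4 b1 b2 c1 c2"
    and f: "nzflow E t h f" "\<And>e. e \<in> H \<Longrightarrow> f e \<notin> span2 b1 b2"
    and f': "nzflow E t h f'" "\<And>e. e \<in> H \<Longrightarrow> f' e \<notin> span2 b1 b2"
begin

abbreviation "got \<equiv> reached f b1 b2 c1 c2"

text \<open>The three lemmas that follow bring the circulation to \<open>f'\<close> first on the edges that survive the
  contraction, then on the remaining edges inside \<open>U\<close>, and finally on \<open>H\<close>.\<close>

lemma got_outer:
  assumes "reach outer tq hq f y"
  shows "\<exists>g. nzoff g \<and> got g \<and> (\<forall>e\<in>outer. g e = y e)"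
  using assms
proof (induction rule: rtranclp_induct)
  case base
  have "nzoff f" using f by (auto simp: nzoff_def nzflow_def)
  then show ?case using reached_start[OF f] by blast
next
  case (step y y')
  then obtain g where g: "nzoff g" "got g" "\<forall>e\<in>outer. g e = y e" by blast
  obtain b z where z: "nzflow outer tq hq y'" "circ outer tq hq z" "\<forall>e\<in>outer. \<bar>z e\<bar> \<le> (1::int)"
    "\<forall>e\<in>outer. y' e = y e + zmul (z e) b"
    using step.hyps(2) by (auto simp: ustep_def)
  obtain z' where z': "circ E t h z'" "\<forall>e\<in>outer. z' e = z e" "\<forall>e. e \<notin> outer \<longrightarrow> e \<notin> T1 \<longrightarrow> z' e = 0"
    using lift_circ[OF z(2)] by blast
  let ?g = "\<lambda>e. g e + zmul (z' e) b"
  have eq: "\<forall>e\<in>outer. ?g e = y' e" using g(3) z(4) z'(2) by simp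
  have "circ E t h ?g" using g(1) z'(1) by (intro circ_add circ_zmul) (auto simp: nzoff_def)
  moreover have "?g e \<noteq> 0" if e: "e \<in> E - H" for e
  proof (cases "e \<in> outer")
    case True
    then show ?thesis using eq z(1) by (auto simp: nzflow_def)
  next
    case False
    then have "z' e = 0" using z'(3) e by blast
    then show ?thesis using g(1) e by (auto simp: nzoff_def)
  qed
  ultimately have nz: "nzoff ?g" by (auto simp: nzoff_def)
  have "\<bar>z' e\<bar> \<le> 1" if e: "e \<in> E - H" for e
  proof (cases "e \<in> outer")
    case True
    then show ?thesis using z'(2) z(3) by auto
  next
    case False
    then have "z' e = 0" using z'(3) e by blast
    then show ?thesis by simp
  qed
  then have "got ?g" by (intro reached_shift[OF dis g(1) nz z'(1) _ g(2)])
  then show ?case using nz eq by blast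
qed

lemma got_inner:
  assumes "reach outer tq hq f f'" "finite L" "L \<subseteq> E - outer - H"
  shows "\<exists>g. nzoff g \<and> got g \<and> (\<forall>e\<in>outer \<union> L. g e = f' e)"
  using assms(2,3)
proof (induction rule: finite_induct)
  case empty
  then show ?case using got_outer[OF assms(1)] by simp
next
  case (insert a L)
  then obtain g where g: "nzoff g" "got g" "\<forall>e\<in>outer \<union> L. g e = f' e" by blast
  have a: "a \<in> E - outer - H" using insert.prems by blast
  obtain z where z: "circ E t h z" "z a = (1::int)" "\<forall>e. e \<noteq> a \<longrightarrow> e \<notin> T1 \<longrightarrow> z e = 0"
    using lift_inner[OF a] by blast
  let ?b = "f' a - g a"
  let ?g = "\<lambda>e. g e + zmul (z e) ?b"
  have ga: "?g a = f' a" using z(2) by simp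
  have ge: "?g e = g e" if "e \<noteq> a" "e \<notin> T1" for e using z(3) that by simp
  have nz: "nzoff ?g"
    unfolding nzoff_def
  proof
    show "circ E t h ?g" using g(1) z(1) by (intro circ_add circ_zmul) (auto simp: nzoff_def)
    show "\<forall>e\<in>E - H. ?g e \<noteq> 0"
    proof
      fix e assume e: "e \<in> E - H"
      show "?g e \<noteq> 0"
      proof (cases "e = a")
        case True
        then show ?thesis using ga f'(1) a by (auto simp: nzflow_def)
      next
        case False
        then show ?thesis using ge[OF False] e g(1) by (auto simp: nzoff_def)
      qed
    qed
  qed
  have "\<bar>z e\<bar> \<le> 1" if e: "e \<in> E - H" for e
  proof (cases "e = a")
    case True
    then show ?thesis using z(2) by simp
  next
    case False
    then have "z e = 0" using z(3) e by blast
    then show ?thesis by simp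
  qed
  then have "got ?g" by (intro reached_shift[OF dis g(1) nz z(1) _ g(2)])
  moreover have "?g e = f' e" if e: "e \<in> outer \<union> insert a L" for e
  proof (cases "e = a")
    case True
    then show ?thesis using ga by simp
  next
    case False
    then have "e \<in> outer \<union> L" "e \<notin> T1" using e outer_E(3) insert.prems by blast+
    then show ?thesis using ge[OF False] g(3) by simp
  qed
  ultimately show ?case using nz by blast
qed

lemma got_core:
  assumes "nzoff g" "got g" "\<forall>e\<in>E - H. g e = f' e"
  shows "got f'"
  using assms
proof (induction "card {e\<in>E. g e \<noteq> f' e}" arbitrary: g rule: less_induct)
  case less
  have nzf': "nzoff f'" using f' by (auto simp: nzoff_def nzflow_def)
  show ?case
  proof (cases "\<forall>e\<in>E. g e = f' e")
    case True
    then show ?thesis by (intro reached_agree[OF less.prems(1) _ less.prems(2)]) simp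
  next
    case False
    then obtain a where a: "a \<in> E" "f' a - g a \<noteq> 0" by auto
    have cd: "circ E t h (\<lambda>e. f' e - g e)"
      using less.prems(1) nzf' by (intro circ_diff) (auto simp: nzoff_def)
    obtain z where z: "circ E t h z" "z a = (1::int)" "\<forall>e. \<bar>z e\<bar> \<le> 1" "\<forall>e. e \<notin> E \<or> f' e - g e = 0 \<longrightarrow> z e = 0"
      using unit_circ_in_support[OF cd a] by blast
    let ?g = "\<lambda>e. g e + zmul (z e) (f' a - g a)"
    have ga: "?g a = f' a" using z(2) by simp
    have same: "?g e = g e" if "e \<in> E" "g e = f' e" for e using z(4) that by simp
    have off: "\<forall>e\<in>E - H. ?g e = f' e" using same less.prems(3) by simp
    have nz: "nzoff ?g"
      unfolding nzoff_def
    proof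
      show "circ E t h ?g" using less.prems(1) z(1) by (intro circ_add circ_zmul) (auto simp: nzoff_def)
      show "\<forall>e\<in>E - H. ?g e \<noteq> 0" using off f'(1) by (auto simp: nzflow_def)
    qed
    have g': "got ?g" using z(3) by (intro reached_step[OF dis less.prems(1) nz z(1) _ less.prems(2)]) blast
    have "{e\<in>E. ?g e \<noteq> f' e} \<subset> {e\<in>E. g e \<noteq> f' e}"
    proof
      show "{e\<in>E. ?g e \<noteq> f' e} \<subseteq> {e\<in>E. g e \<noteq> f' e}" using same by fastforce
      have "a \<in> {e\<in>E. g e \<noteq> f' e}" "a \<notin> {e\<in>E. ?g e \<noteq> f' e}" using a ga by auto
      then show "{e\<in>E. ?g e \<noteq> f' e} \<noteq> {e\<in>E. g e \<noteq> f' e}" by metis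
    qed
    then have "card {e\<in>E. ?g e \<noteq> f' e} < card {e\<in>E. g e \<noteq> f' e}" using finE by (intro psubset_card_mono) auto
    then show ?thesis by (rule less.hyps[OF _ nz g' off])
  qed
qed

theorem reach_of_contraction:
  assumes "reach outer tq hq f f'"
  shows "reach E t h f f'"
proof -
  have "finite (E - outer - H)" using finE by simp
  then obtain g where g: "nzoff g" "got g" "\<forall>e\<in>outer \<union> (E - outer - H). g e = f' e"
    using got_inner[OF assms _ subset_refl] by blast
  have "\<forall>e\<in>E - H. g e = f' e" using g(3) by blast
  then have "got f'" using got_core g by blast
  then show ?thesis using reached_end[OF dis f'(1)] f'(2) by blast
qed

end
end
end

section \<open>Two disjoint connected subgraphs in a dense graph\<close>

definition inside :: "'e set \<Rightarrow> ('e \<Rightarrow> 'v) \<Rightarrow> ('e \<Rightarrow> 'v) \<Rightarrow> 'v set \<Rightarrow> 'e set" where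
  "inside E t h S = {e\<in>E. t e \<in> S \<and> h e \<in> S}"

lemma inside_supermodular:
  assumes "finite E"
  shows "card (inside E t h A) + card (inside E t h B) \<le> card (inside E t h (A \<union> B)) + card (inside E t h (A \<inter> B))"
proof -
  let ?A = "inside E t h A" and ?B = "inside E t h B"
  have fin: "finite ?A" "finite ?B" "finite (inside E t h (A \<union> B))" using assms by (auto simp: inside_def)
  have "card ?A + card ?B = card (?A \<union> ?B) + card (?A \<inter> ?B)" using fin by (intro card_Un_Int)
  also have "?A \<inter> ?B = inside E t h (A \<inter> B)" by (auto simp: inside_def)
  also have "card (?A \<union> ?B) \<le> card (inside E t h (A \<union> B))"
    using fin by (intro card_mono) (auto simp: inside_def)
  finally show ?thesis by simp
qed

text \<open>The count that characterises unions of two edge-disjoint spanning trees.\<close>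

definition tight_sparse :: "'v set \<Rightarrow> 'e set \<Rightarrow> ('e \<Rightarrow> 'v) \<Rightarrow> ('e \<Rightarrow> 'v) \<Rightarrow> bool" where
  "tight_sparse U E t h \<longleftrightarrow> finite U \<and> finite E \<and> U \<noteq> {} \<and> (\<forall>e\<in>E. t e \<in> U \<and> h e \<in> U \<and> t e \<noteq> h e) \<and>
     card E + 2 = 2 * card U \<and> (\<forall>S\<subseteq>U. S \<noteq> {} \<longrightarrow> card (inside E t h S) + 2 \<le> 2 * card S)"

definition incident :: "'e set \<Rightarrow> ('e \<Rightarrow> 'v) \<Rightarrow> ('e \<Rightarrow> 'v) \<Rightarrow> 'v \<Rightarrow> 'e set" where
  "incident E t h v = {e\<in>E. t e = v \<or> h e = v}"

definition other :: "('e \<Rightarrow> 'v) \<Rightarrow> ('e \<Rightarrow> 'v) \<Rightarrow> 'v \<Rightarrow> 'e \<Rightarrow> 'v" where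
  "other t h v e = (if t e = v then h e else t e)"

lemma sum_degree:
  assumes "finite U" "finite E" "\<And>e. e \<in> E \<Longrightarrow> t e \<in> U \<and> h e \<in> U \<and> t e \<noteq> h e"
  shows "(\<Sum>v\<in>U. card (incident E t h v)) = 2 * card E"
proof -
  have "(\<Sum>v\<in>U. card (incident E t h v)) = (\<Sum>v\<in>U. \<Sum>e\<in>E. if t e = v \<or> h e = v then 1 else 0)"
    using assms by (intro sum.cong) (auto simp: incident_def sum.inter_filter[symmetric])
  also have "\<dots> = (\<Sum>e\<in>E. \<Sum>v\<in>U. if t e = v \<or> h e = v then 1 else 0)" by (rule sum.swap)
  also have "\<dots> = (\<Sum>e\<in>E. 2)"
  proof (rule sum.cong)
    fix e assume e: "e \<in> E"
    have "(\<Sum>v\<in>U. if t e = v \<or> h e = v then 1 else 0) = card {v\<in>U. t e = v \<or> h e = v}"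
      using assms(1) by (simp add: sum.inter_filter[symmetric])
    also have "{v\<in>U. t e = v \<or> h e = v} = {t e, h e}" using assms(3)[OF e] by auto
    finally show "(\<Sum>v\<in>U. if t e = v \<or> h e = v then 1 else 0) = (2::nat)" using assms(3)[OF e] by simp
  qed simp
  finally show ?thesis by simp
qed

lemma connectsD: "connects T t h U \<Longrightarrow> S \<subseteq> U \<Longrightarrow> S \<noteq> {} \<Longrightarrow> S \<noteq> U \<Longrightarrow> cut T t h S \<noteq> {}"
  by (simp add: connects_def)

lemma connects_cong:
  assumes "\<And>e. e \<in> T \<Longrightarrow> t e = t' e \<and> h e = h' e"
  shows "connects T t h U \<longleftrightarrow> connects T t' h' U"
proof -
  have "cut T t h S = cut T t' h' S" for S using assms by (auto simp: cut_def)
  then show ?thesis by (simp add: connects_def)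
qed

lemma separates_of_trivial_rest:
  assumes "S - {v} = {} \<or> S - {v} = U - {v}" "S \<subseteq> U" "S \<noteq> {}" "S \<noteq> U" "v \<in> U" "w \<in> U" "w \<noteq> v"
  shows "(v \<in> S) \<noteq> (w \<in> S)"
  using assms(1)
proof
  assume "S - {v} = {}"
  then have "S = {v}" using assms(3) by auto
  then show ?thesis using assms(7) by simp
next
  assume eq: "S - {v} = U - {v}"
  then have "w \<in> S" using assms(6,7) by blast
  moreover have "v \<notin> S"
  proof
    assume "v \<in> S"
    then have "insert v (S - {v}) = S" by blast
    moreover have "insert v (U - {v}) = U" using assms(5) by blast
    ultimately show False using eq assms(4) by simp
  qed
  ultimately show ?thesis by simp
qed

text \<open>Used for a new vertex \<open>v\<close> hanging on the single edge \<open>e\<close>.\<close>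

lemma connects_leaf:
  assumes T: "connects T t h (U - {v})" "\<And>e. e \<in> T \<Longrightarrow> t e \<noteq> v \<and> h e \<noteq> v"
    and e: "v \<in> U" "{t e, h e} = {v, w}" "w \<in> U" "w \<noteq> v"
  shows "connects (insert e T) t h U"
  unfolding connects_def
proof (intro allI impI)
  fix S assume S: "S \<subseteq> U" "S \<noteq> {}" "S \<noteq> U"
  show "cut (insert e T) t h S \<noteq> {}"
  proof (cases "S - {v} = {} \<or> S - {v} = U - {v}")
    case True
    then have "(v \<in> S) \<noteq> (w \<in> S)" using S e(1) e(3) e(4) by (rule separates_of_trivial_rest)
    then have "e \<in> cut (insert e T) t h S" using e(2) by (auto simp: cut_def doubleton_eq_iff)
    then show ?thesis by blast
  next
    case False
    then have "cut T t h (S - {v}) \<noteq> {}" using S by (intro connectsD[OF T(1)]) auto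
    moreover have "cut T t h (S - {v}) \<subseteq> cut (insert e T) t h S" using T(2) by (auto simp: cut_def)
    ultimately show ?thesis by blast
  qed
qed

text \<open>The edge \<open>p\<close> from \<open>a\<close> to \<open>b\<close> is subdivided by \<open>v\<close> into \<open>p\<close> and \<open>q\<close>.\<close>

lemma connects_subdivide:
  assumes T: "connects T t' h' (U - {v})" "\<And>e. e \<in> T - {p} \<Longrightarrow> t e = t' e \<and> h e = h' e \<and> t e \<noteq> v \<and> h e \<noteq> v"
    and p: "p \<in> T" "t' p = a" "h' p = b" "{t p, h p} = {v, a}" "a \<in> U" "a \<noteq> v"
    and q: "{t q, h q} = {v, b}" "b \<in> U" "b \<noteq> v" and v: "v \<in> U"
  shows "connects (insert q T) t h U"
  unfolding connects_def
proof (intro allI impI)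
  fix S assume S: "S \<subseteq> U" "S \<noteq> {}" "S \<noteq> U"
  have pc: "p \<in> cut (insert q T) t h S" if "(v \<in> S) \<noteq> (a \<in> S)"
    using that p by (auto simp: cut_def doubleton_eq_iff)
  have qc: "q \<in> cut (insert q T) t h S" if "(v \<in> S) \<noteq> (b \<in> S)"
    using that q by (auto simp: cut_def doubleton_eq_iff)
  show "cut (insert q T) t h S \<noteq> {}"
  proof (cases "S - {v} = {} \<or> S - {v} = U - {v}")
    case True
    then have "(v \<in> S) \<noteq> (a \<in> S)" using S v p(5) p(6) by (rule separates_of_trivial_rest)
    then show ?thesis using pc by blast
  next
    case False
    then have "cut T t' h' (S - {v}) \<noteq> {}" using S by (intro connectsD[OF T(1)]) auto
    then obtain e where e: "e \<in> T" "(t' e \<in> S - {v}) \<noteq> (h' e \<in> S - {v})" by (auto simp: cut_def)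
    show ?thesis
    proof (cases "e = p")
      case True
      then have "(a \<in> S) \<noteq> (b \<in> S)" using e p q by auto
      then show ?thesis using pc qc by blast
    next
      case F: False
      then have "e \<in> cut (insert q T) t h S" using e T(2)[of e] by (auto simp: cut_def)
      then show ?thesis by blast
    qed
  qed
qed

text \<open>The decomposition goes by induction on a vertex of degree 2 or 3. A vertex of degree 3 is replaced
  by an edge between two of its neighbours; sparsity forbids this for at most one of two overlapping
  pairs of neighbours, because two tight sets that meet have a tight union.\<close>

lemma tight_sparse_decomposition:
  assumes "tight_sparse U E t h"
  shows "\<exists>T1 T2. T1 \<subseteq> E \<and> T2 \<subseteq> E \<and> T1 \<inter> T2 = {} \<and> connects T1 t h U \<and> connects T2 t h U"
  using assms
proof (induction "card U" arbitrary: U E t h rule: less_induct)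
  case less
  note ts = less.prems[unfolded tight_sparse_def]
  have fin: "finite U" "finite E" "U \<noteq> {}" using ts by auto
  have ends: "\<And>e. e \<in> E \<Longrightarrow> t e \<in> U \<and> h e \<in> U \<and> t e \<noteq> h e" using ts by blast
  have cE: "card E + 2 = 2 * card U" using ts by blast
  have sparse: "\<And>S. S \<subseteq> U \<Longrightarrow> S \<noteq> {} \<Longrightarrow> card (inside E t h S) + 2 \<le> 2 * card S" using ts by blast
  show ?case
  proof (cases "card U \<le> 1")
    case True
    then have "S = {} \<or> S = U" if "S \<subseteq> U" for S
      using that fin by (metis card_le_Suc0_iff_eq One_nat_def subset_antisym subsetD subsetI all_not_in_conv)
    then have "connects {} t h U" by (auto simp: connects_def)
    then show ?thesis by (intro exI[of _ "{}"]) simp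
  next
    case big: False
    have "\<exists>v\<in>U. card (incident E t h v) \<le> 3"
    proof (rule ccontr)
      assume "\<not> ?thesis"
      then have "(\<Sum>v\<in>U. 4) \<le> (\<Sum>v\<in>U. card (incident E t h v))" by (intro sum_mono) auto
      then show False using sum_degree[OF fin(1,2) ends] cE by simp
    qed
    then obtain v where v: "v \<in> U" "card (incident E t h v) \<le> 3" by blast
    let ?I = "incident E t h v"
    have finI: "finite ?I" "?I \<subseteq> E" using fin by (auto simp: incident_def)
    define o' where "o' = other t h v"
    have o': "{t e, h e} = {v, o' e}" "o' e \<in> U" "o' e \<noteq> v" if "e \<in> ?I" for e
      using that ends[of e] by (auto simp: o'_def other_def incident_def)
    let ?U = "U - {v}"
    have cU: "card ?U = card U - 1" "card ?U < card U"
      using v(1) fin(1) card_Diff1_less[OF fin(1) v(1)] by simp_all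
    have neU: "?U \<noteq> {}"
    proof
      assume "?U = {}"
      then have "card ?U = 0" by (simp only: card.empty)
      then show False using big cU(1) by linarith
    qed
    have I2: "card ?I \<ge> 2"
    proof -
      have "inside E t h ?U = E - ?I" using ends by (auto simp: inside_def incident_def)
      then have "card E - card ?I + 2 \<le> 2 * (card U - 1)"
        using sparse[of ?U] neU cU finI by (auto simp: card_Diff_subset)
      moreover have "card ?I \<le> card E" using finI fin card_mono by blast
      ultimately show ?thesis using cE by linarith
    qed
    have notv: "t e \<noteq> v \<and> h e \<noteq> v" if "e \<in> E - ?I" for e using that by (auto simp: incident_def)
    have leaf0: "connects (insert a T) t h U" if T: "T \<subseteq> E - ?I" "connects T t h ?U" and a: "a \<in> ?I" for a T
    proof (rule connects_leaf[where v = v and w = "o' a", OF T(2) _ v(1) o'[OF a]])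
      show "t e \<noteq> v \<and> h e \<noteq> v" if "e \<in> T" for e using notv T that by blast
    qed
    show ?thesis
    proof (cases "card ?I = 2")
      case True
      then obtain e1 e2 where e12: "?I = {e1, e2}" "e1 \<noteq> e2" by (meson card_2_iff)
      have "tight_sparse ?U (E - ?I) t h"
        unfolding tight_sparse_def
      proof (intro conjI ballI allI impI)
        show "card (E - ?I) + 2 = 2 * card ?U"
          using True finI cE cU big by (simp add: card_Diff_subset)
        fix S assume S: "S \<subseteq> ?U" "S \<noteq> {}"
        have "card (inside (E - ?I) t h S) \<le> card (inside E t h S)"
          using fin by (intro card_mono) (auto simp: inside_def)
        then show "card (inside (E - ?I) t h S) + 2 \<le> 2 * card S" using sparse[of S] S by force
      qed (use fin neU ends notv in auto)
      from less.hyps[OF cU(2) this] obtain T1 T2 where T: "T1 \<subseteq> E - ?I" "T2 \<subseteq> E - ?I" "T1 \<inter> T2 = {}" "connects T1 t h ?U" "connects T2 t h ?U"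
        by (elim exE conjE) (rule that)
      have "connects (insert e1 T1) t h U" "connects (insert e2 T2) t h U"
        using leaf0[OF T(1,4)] leaf0[OF T(2,5)] e12(1) by simp_all
      moreover have "e1 \<in> E" "e2 \<in> E" "e1 \<notin> T2" "e2 \<notin> T1" using e12(1) finI T(1,2) by auto
      ultimately show ?thesis
        using T(1-3) e12(2) by (intro exI[of _ "insert e1 T1"] exI[of _ "insert e2 T2"]) auto
    next
      case False
      then have c3: "card ?I = 3" using I2 v by simp
      then obtain x1 x2 x3 where x: "?I = {x1, x2, x3}" "x1 \<noteq> x2" "x1 \<noteq> x3" "x2 \<noteq> x3"
        using card_3_iff[of ?I] by metis
      have "\<not> (o' x1 = o' x2 \<and> o' x2 = o' x3)"
      proof
        assume eq: "o' x1 = o' x2 \<and> o' x2 = o' x3"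
        have "?I \<subseteq> inside E t h {v, o' x1}"
        proof
          fix e assume e: "e \<in> ?I"
          then have "o' e = o' x1" using eq x by auto
          then show "e \<in> inside E t h {v, o' x1}" using o'(1)[OF e] finI e by (auto simp: inside_def)
        qed
        moreover have "finite (inside E t h {v, o' x1})" using fin by (simp add: inside_def)
        ultimately have "3 \<le> card (inside E t h {v, o' x1})" using c3 card_mono by metis
        moreover have "card (inside E t h {v, o' x1}) + 2 \<le> 2 * card {v, o' x1}"
          using sparse[of "{v, o' x1}"] v o'[of x1] x by auto
        moreover have "card {v, o' x1} \<le> 2" by (simp add: card_insert_if)
        ultimately show False by linarith
      qed
      then obtain e1 e2 e3 where e: "?I = {e1, e2, e3}" "e1 \<noteq> e2" "e1 \<noteq> e3" "e2 \<noteq> e3" "o' e2 \<noteq> o' e1" "o' e2 \<noteq> o' e3"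
      proof (cases "o' x1 = o' x2")
        case True
        then have "o' x3 \<noteq> o' x1" "o' x3 \<noteq> o' x2" using \<open>\<not> (o' x1 = o' x2 \<and> o' x2 = o' x3)\<close> by auto
        then show ?thesis using that[of x1 x3 x2] x by auto
      next
        case n12: False
        show ?thesis
        proof (cases "o' x1 = o' x3")
          case True
          then show ?thesis using that[of x1 x2 x3] x n12 by auto
        next
          case False
          then show ?thesis using that[of x2 x1 x3] x n12 by auto
        qed
      qed
      \<comment> \<open>tight sets away from the vertex are the obstacles to adding an edge\<close>
      define tgt where "tgt S \<longleftrightarrow> S \<subseteq> ?U \<and> card (inside E t h S) + 2 = 2 * card S" for S
      have nall: False if S: "tgt S" "o' e1 \<in> S" "o' e2 \<in> S" "o' e3 \<in> S" for S
      proof -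
        have fS: "finite S" "v \<notin> S" using S fin finite_subset by (auto simp: tgt_def)
        have "inside E t h S \<union> ?I \<subseteq> inside E t h (insert v S)"
        proof
          fix a assume "a \<in> inside E t h S \<union> ?I"
          then show "a \<in> inside E t h (insert v S)"
          proof
            assume a: "a \<in> ?I"
            then have "o' a \<in> S" using e S by auto
            then show ?thesis using o'(1)[OF a] finI a by (auto simp: inside_def doubleton_eq_iff)
          qed (auto simp: inside_def)
        qed
        then have "card (inside E t h S \<union> ?I) \<le> card (inside E t h (insert v S))"
          using fin by (intro card_mono) (auto simp: inside_def)
        moreover have "inside E t h S \<inter> ?I = {}" using fS by (auto simp: inside_def incident_def)
        ultimately have "card (inside E t h S) + 3 \<le> card (inside E t h (insert v S))"
          using c3 finI fin by (simp add: card_Un_disjoint inside_def)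
        moreover have "card (inside E t h (insert v S)) + 2 \<le> 2 * card (insert v S)"
          using sparse[of "insert v S"] S v by (auto simp: tgt_def)
        ultimately show False using S fS by (simp add: tgt_def)
      qed
      have un: "tgt (A \<union> B)" if A: "tgt A" and B: "tgt B" and m: "A \<inter> B \<noteq> {}" for A B
      proof -
        have fAB: "finite A" "finite B" using A B fin finite_subset by (auto simp: tgt_def)
        have "card (inside E t h (A \<inter> B)) + 2 \<le> 2 * card (A \<inter> B)" using sparse[of "A \<inter> B"] m A by (auto simp: tgt_def)
        moreover have "card (inside E t h (A \<union> B)) + 2 \<le> 2 * card (A \<union> B)" using sparse[of "A \<union> B"] m A B by (auto simp: tgt_def)
        moreover have "card A + card B = card (A \<union> B) + card (A \<inter> B)" using fAB by (rule card_Un_Int)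
        ultimately have "card (inside E t h (A \<union> B)) + 2 = 2 * card (A \<union> B)"
          using inside_supermodular[OF fin(2), of t h A B] A B unfolding tgt_def by linarith
        then show ?thesis using A B by (auto simp: tgt_def)
      qed
      obtain p q r where pqr: "?I = {p, q, r}" "p \<noteq> q" "p \<noteq> r" "q \<noteq> r" "o' p \<noteq> o' q"
        and nt: "\<And>S. tgt S \<Longrightarrow> o' p \<in> S \<Longrightarrow> o' q \<in> S \<Longrightarrow> False"
      proof (cases "\<exists>S. tgt S \<and> o' e1 \<in> S \<and> o' e2 \<in> S")
        case False
        then show ?thesis using that[of e1 e2 e3] e by metis
      next
        case True
        then obtain A where A: "tgt A" "o' e1 \<in> A" "o' e2 \<in> A" by blast
        have "False" if "tgt B" "o' e2 \<in> B" "o' e3 \<in> B" for B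
          using nall[OF un[OF A(1) that(1)]] A that by blast
        then show ?thesis using that[of e2 e3 e1] e by auto
      qed
      have pI: "p \<in> ?I" "q \<in> ?I" "r \<in> ?I" using pqr by auto
      define t' h' where "t' = t(p := o' p)" and "h' = h(p := o' q)"
      let ?E = "E - {q, r}"
      have same: "t' e = t e" "h' e = h e" if "e \<noteq> p" for e using that by (auto simp: t'_def h'_def)
      have ins: "inside ?E t' h' S = (if o' p \<in> S \<and> o' q \<in> S then insert p (inside E t h S) else inside E t h S)"
        "p \<notin> inside E t h S" if S: "S \<subseteq> ?U" for S
      proof -
        have v': "v \<notin> S" using S by blast
        have nI: "e \<notin> ?I" if "e \<in> inside E t h S" for e using that v' by (auto simp: inside_def incident_def)
        then show pn: "p \<notin> inside E t h S" using pI by blast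
        have other_e: "e \<in> inside ?E t' h' S \<longleftrightarrow> e \<in> inside E t h S" if "e \<noteq> p" for e
        proof -
          have "e \<in> inside E t h S \<Longrightarrow> e \<notin> {q, r}" using nI[of e] pI(2,3) by blast
          then show ?thesis using same[OF that] by (auto simp: inside_def)
        qed
        have this_e: "p \<in> inside ?E t' h' S \<longleftrightarrow> o' p \<in> S \<and> o' q \<in> S"
          using pI(1) finI pqr(2,3) by (auto simp: inside_def t'_def h'_def)
        show "inside ?E t' h' S = (if o' p \<in> S \<and> o' q \<in> S then insert p (inside E t h S) else inside E t h S)"
        proof (rule set_eqI)
          fix e
          show "e \<in> inside ?E t' h' S \<longleftrightarrow> e \<in> (if o' p \<in> S \<and> o' q \<in> S then insert p (inside E t h S) else inside E t h S)"
            using other_e[of e] this_e pn by (cases "e = p") simp_all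
        qed
      qed
      have "tight_sparse ?U ?E t' h'"
        unfolding tight_sparse_def
      proof (intro conjI ballI allI impI)
        have "card ?E = card E - 2" using pqr pI finI fin by (simp add: card_Diff_subset subset_iff)
        moreover have "card E \<ge> 3" using c3 finI fin card_mono by metis
        ultimately show "card ?E + 2 = 2 * card ?U" using cE cU big by linarith
        fix S assume S: "S \<subseteq> ?U" "S \<noteq> {}"
        have "card (inside E t h S) + 2 \<le> 2 * card S" using sparse S by blast
        moreover have "card (inside E t h S) + 2 \<noteq> 2 * card S" if "o' p \<in> S \<and> o' q \<in> S"
          using nt[of S] that S by (auto simp: tgt_def)
        moreover have "finite (inside E t h S)" using fin by (simp add: inside_def)
        ultimately show "card (inside ?E t' h' S) + 2 \<le> 2 * card S"
          using ins[OF S(1)] by (auto simp: card_insert_if)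
      next
        fix e assume e: "e \<in> ?E"
        have "t' e \<in> ?U \<and> h' e \<in> ?U \<and> t' e \<noteq> h' e"
        proof (cases "e = p")
          case True
          then show ?thesis using o'(2,3)[OF pI(1)] o'(2,3)[OF pI(2)] pqr(5) by (simp add: t'_def h'_def)
        next
          case False
          then have "e \<in> E - ?I" using e pqr(1) by blast
          then show ?thesis using notv[of e] ends[of e] same[OF False] by simp
        qed
        then show "t' e \<in> ?U" "h' e \<in> ?U" "t' e \<noteq> h' e" by blast+
      qed (use fin neU in auto)
      from less.hyps[OF cU(2) this] obtain T1 T2 where T: "T1 \<subseteq> ?E" "T2 \<subseteq> ?E" "T1 \<inter> T2 = {}" "connects T1 t' h' ?U" "connects T2 t' h' ?U"
        by (elim exE conjE) (rule that)
      have nv: "t e = t' e \<and> h e = h' e \<and> t e \<noteq> v \<and> h e \<noteq> v" if "e \<in> ?E - {p}" for e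
        using that same[of e] notv[of e] pqr(1) by auto
      have leaf: "connects (insert a T) t h U" if T: "T \<subseteq> ?E - {p}" "connects T t' h' ?U" and a: "a \<in> ?I" for a T
      proof (rule leaf0[OF _ _ a])
        show "T \<subseteq> E - ?I" using T(1) pqr(1) by blast
        show "connects T t h ?U" using T connects_cong[of T t t' h h' ?U] nv by blast
      qed
      have sub: "connects (insert q T) t h U" if Tp: "T \<subseteq> ?E" "p \<in> T" "connects T t' h' ?U" for T
      proof (rule connects_subdivide[where p = p and a = "o' p" and b = "o' q", OF Tp(3) _ Tp(2) _ _ o'[OF pI(1)] o'[OF pI(2)] v(1)])
        show "t e = t' e \<and> h e = h' e \<and> t e \<noteq> v \<and> h e \<noteq> v" if "e \<in> T - {p}" for e using nv Tp(1) that by blast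
      qed (simp_all add: t'_def h'_def)
      have pqE: "p \<in> E" "q \<in> E" "r \<in> E" using pI finI by blast+
      consider "p \<in> T1" "p \<notin> T2" | "p \<in> T2" "p \<notin> T1" | "p \<notin> T1" "p \<notin> T2" using T(3) by blast
      then show ?thesis
      proof cases
        case 1
        then have "connects (insert q T1) t h U" "connects (insert r T2) t h U"
          using sub[OF T(1) _ T(4)] leaf[OF _ T(5) pI(3)] T(2) by auto
        then show ?thesis
          using T(1-3) pqr(2-4) pqE by (intro exI[of _ "insert q T1"] exI[of _ "insert r T2"]) auto
      next
        case 2
        then have "connects (insert q T2) t h U" "connects (insert r T1) t h U"
          using sub[OF T(2) _ T(5)] leaf[OF _ T(4) pI(3)] T(1) by auto
        then show ?thesis
          using T(1-3) pqr(2-4) pqE by (intro exI[of _ "insert r T1"] exI[of _ "insert q T2"]) auto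
      next
        case 3
        then have "connects (insert q T1) t h U" "connects (insert r T2) t h U"
          using leaf[OF _ T(4) pI(2)] leaf[OF _ T(5) pI(3)] T(1,2) by auto
        then show ?thesis
          using T(1-3) pqr(2-4) pqE by (intro exI[of _ "insert q T1"] exI[of _ "insert r T2"]) auto
      qed
    qed
  qed
qed

text \<open>A smallest set of at least two vertices that induces enough edges becomes tight and sparse after removing
  surplus edges.\<close>

lemma dense_doubly_connected:
  assumes G: "loopfree V E t h" and F: "F \<subseteq> E" and V: "card V \<ge> 2" and c: "2 * card V \<le> card F + 2"
  shows "\<exists>U T1 T2. card U \<ge> 2 \<and> T1 \<subseteq> F \<and> doubly_connected V E t h U T1 T2 \<and> T2 \<subseteq> F"
proof -
  have fin: "finite V" "finite E" "finite F" using G F finite_subset by (auto simp: loopfree_def)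
  have ends: "\<And>e. e \<in> F \<Longrightarrow> t e \<in> V \<and> h e \<in> V \<and> t e \<noteq> h e" using G F by (auto simp: loopfree_def)
  let ?Q = "\<lambda>U. U \<subseteq> V \<and> card U \<ge> 2 \<and> 2 * card U \<le> card (inside F t h U) + 2"
  have "inside F t h V = F" using ends by (auto simp: inside_def)
  then have "?Q V" using V c by simp
  then obtain U where U: "?Q U" and min: "\<And>X. ?Q X \<Longrightarrow> card U \<le> card X"
    using ex_has_least_nat[of ?Q V card] by blast
  have fU: "finite U" using U fin finite_subset by blast
  obtain D where D: "D \<subseteq> inside F t h U" "card D = 2 * card U - 2"
    using obtain_subset_with_card_n[of "2 * card U - 2" "inside F t h U"] U by (metis le_diff_conv)
  have DF: "D \<subseteq> F" using D by (auto simp: inside_def)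
  have "tight_sparse U D t h"
    unfolding tight_sparse_def
  proof (intro conjI ballI allI impI)
    show "finite D" using DF fin finite_subset by blast
    show "card D + 2 = 2 * card U" using D U by linarith
    fix S assume S: "S \<subseteq> U" "S \<noteq> {}"
    show "card (inside D t h S) + 2 \<le> 2 * card S"
    proof (cases "S = U")
      case True
      have "card (inside D t h S) \<le> card D" using DF fin finite_subset by (intro card_mono) (auto simp: inside_def)
      moreover have "card S = card U" using True by simp
      ultimately show ?thesis using D(2) U by linarith
    next
      case F1: False
      then have lt: "card S < card U" using S fU by (simp add: psubset_card_mono psubset_eq)
      show ?thesis
      proof (cases "card S \<ge> 2")
        case True
        then have "card (inside F t h S) + 2 < 2 * card S" using min[of S] lt S U by force
        moreover have "card (inside D t h S) \<le> card (inside F t h S)" using fin DF by (intro card_mono) (auto simp: inside_def)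
        ultimately show ?thesis by linarith
      next
        case False
        have fS: "finite S" using S fU finite_subset by blast
        then have "card S = 1" using False S by (metis One_nat_def Suc_1 Suc_leI card_gt_0_iff le_neq_implies_less not_less_eq_eq)
        then obtain x where x: "S = {x}" by (meson card_1_singletonE)
        have "inside D t h S = {}" using x ends DF by (fastforce simp: inside_def)
        then show ?thesis using x by simp
      qed
    qed
  qed (use fU U D ends DF in \<open>auto simp: inside_def\<close>)
  from tight_sparse_decomposition[OF this] obtain T1 T2
    where T: "T1 \<subseteq> D" "T2 \<subseteq> D" "T1 \<inter> T2 = {}" "connects T1 t h U" "connects T2 t h U"
    by (elim exE conjE) (rule that)
  have "doubly_connected V E t h U T1 T2"
    by unfold_locales (use T D DF F G U in \<open>auto simp: inside_def\<close>)
  then show ?thesis using T DF U by blast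
qed

section \<open>Dissociated elements of a large finite group\<close>

definition comb :: "int list \<Rightarrow> 'a::ab_group_add list \<Rightarrow> 'a" where
  "comb cs bs = sum_list (map2 zmul cs bs)"

text \<open>The list version of \<open>dissoc4\<close>, which can be extended by one element at a time.\<close>

definition dissoc :: "'a::ab_group_add list \<Rightarrow> bool" where
  "dissoc bs \<longleftrightarrow> (\<forall>cs. length cs = length bs \<longrightarrow> set cs \<subseteq> {-2..2} \<longrightarrow> (\<exists>c\<in>set cs. odd c) \<longrightarrow> comb cs bs \<noteq> 0)"

lemma dissoc_Nil: "dissoc []"
  by (simp add: dissoc_def)

lemma card_halves_le:
  fixes Z :: "'a::{finite,ab_group_add} set"
  shows "card {b. b + b \<in> Z} \<le> card Z * card {x::'a. x + x = 0}"
proof -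
  have fibre: "card {b. b + b = y} \<le> card {x::'a. x + x = 0}" for y :: 'a
  proof (cases "{b. b + b = y} = {}")
    case True
    then show ?thesis by (metis card.empty zero_le)
  next
    case False
    then obtain b0 where b0: "b0 + b0 = y" by blast
    show ?thesis
    proof (rule card_inj_on_le[of "\<lambda>b. b - b0"])
      show "inj_on (\<lambda>b. b - b0) {b. b + b = y}" by (rule inj_onI) simp
      show "(\<lambda>b. b - b0) ` {b. b + b = y} \<subseteq> {x. x + x = 0}"
        using b0 by (auto simp: algebra_simps)
    qed simp
  qed
  have "{b. b + b \<in> Z} = (\<Union>y\<in>Z. {b. b + b = y})" by auto
  then have "card {b. b + b \<in> Z} \<le> (\<Sum>y\<in>Z. card {b. b + b = y})"
    using card_UN_le[of Z "\<lambda>y. {b. b + b = y}"] by simp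
  also have "\<dots> \<le> (\<Sum>y\<in>Z. card {x::'a. x + x = 0})" by (rule sum_mono) (rule fibre)
  finally show ?thesis by simp
qed

text \<open>Doubling is the only obstruction to choosing elements one after another. If many elements have
  order at most 2, the next element is taken among them; otherwise doubling has small fibres and almost every
  element will do.\<close>

lemma dissoc_extend:
  fixes bs :: "'a::{finite,ab_group_add} list"
  assumes bs: "dissoc bs" "length bs \<le> 3" and X: "card X \<le> 1000" and A: "CARD('a) \<ge> 400000"
  shows "\<exists>b. b \<notin> X \<and> dissoc (b # bs)"
proof -
  define L where "L = {cs :: int list. set cs \<subseteq> {-2..2} \<and> length cs = length bs}"
  define Z where "Z = (\<lambda>cs. comb cs bs) ` L \<union> (\<lambda>cs. - comb cs bs) ` L"
  have "card L = 5 ^ length bs" unfolding L_def by (subst card_lists_length_eq) auto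
  also have "\<dots> \<le> 5 ^ 3" using bs by (intro power_increasing) auto
  finally have cL: "card L \<le> 125" by simp
  have fL: "finite L" unfolding L_def by (rule finite_lists_length_eq) simp
  have cZ: "card Z \<le> 250"
    using card_Un_le[of "(\<lambda>cs. comb cs bs) ` L" "(\<lambda>cs. - comb cs bs) ` L"]
      card_image_le[OF fL, of "\<lambda>cs. comb cs bs"] card_image_le[OF fL, of "\<lambda>cs. - comb cs bs"] cL
    unfolding Z_def by linarith
  let ?D = "{x::'a. x + x = 0}"
  obtain b where b: "b \<notin> X" "b \<notin> Z" "b + b = 0 \<or> b + b \<notin> Z"
  proof (cases "card ?D > 1250")
    case True
    have "card (X \<union> Z) \<le> 1250" using card_Un_le[of X Z] X cZ by linarith
    then have "\<not> ?D \<subseteq> X \<union> Z" using True card_mono[of "X \<union> Z" ?D] by fastforce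
    then show ?thesis using that by blast
  next
    case False
    have "card Z * card ?D \<le> 250 * 1250" using cZ False by (intro mult_mono) auto
    then have "card {b. b + b \<in> Z} \<le> 312500" using card_halves_le[of Z] by linarith
    then have "card (X \<union> Z \<union> {b. b + b \<in> Z}) \<le> 1000 + 250 + 312500"
      using card_Un_le[of "X \<union> Z" "{b. b + b \<in> Z}"] card_Un_le[of X Z] X cZ by linarith
    then have "\<not> UNIV \<subseteq> X \<union> Z \<union> {b. b + b \<in> Z}"
      using A card_mono[of "X \<union> Z \<union> {b. b + b \<in> Z}" UNIV] by fastforce
    then show ?thesis using that by blast
  qed
  have "dissoc (b # bs)"
    unfolding dissoc_def
  proof (intro allI impI)
    fix ccs :: "int list"
    assume len: "length ccs = length (b # bs)" and rng: "set ccs \<subseteq> {-2..2}" and od: "\<exists>c\<in>set ccs. odd c"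
    obtain c cs where c: "ccs = c # cs" using len by (cases ccs) auto
    have cs: "cs \<in> L" "length cs = length bs" "set cs \<subseteq> {-2..2}" using len rng c by (auto simp: L_def)
    have inZ: "comb cs bs \<in> Z" "- comb cs bs \<in> Z" using cs(1) by (auto simp: Z_def)
    have co: "comb ccs (b # bs) = zmul c b + comb cs bs" by (simp add: comb_def c)
    have c2: "c \<in> {-2..2}" using rng c by simp
    have nz: "comb cs bs \<noteq> 0" if "even c"
    proof -
      have "\<exists>c\<in>set cs. odd c" using od c that by auto
      then show ?thesis using bs(1) cs(2,3) by (auto simp: dissoc_def)
    qed
    have "c = -2 \<or> c = -1 \<or> c = 0 \<or> c = 1 \<or> c = 2" using c2 by auto
    then show "comb ccs (b # bs) \<noteq> 0"
    proof (elim disjE)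
      assume "c = -2"
      then have "comb ccs (b # bs) = comb cs bs - (b + b)" "comb cs bs \<noteq> 0" using co nz by (simp_all add: zmul_2)
      then show ?thesis using b(3) inZ by auto
    next
      assume "c = -1"
      then have "comb ccs (b # bs) = comb cs bs - b" using co by simp
      then show ?thesis using b(2) inZ by auto
    next
      assume "c = 0"
      then show ?thesis using co nz by simp
    next
      assume "c = 1"
      then have "comb ccs (b # bs) = b - (- comb cs bs)" using co by simp
      then show ?thesis using b(2) inZ by (metis right_minus_eq)
    next
      assume "c = 2"
      then have "comb ccs (b # bs) = (b + b) - (- comb cs bs)" "comb cs bs \<noteq> 0" using co nz by (simp_all add: zmul_2)
      then show ?thesis using b(3) inZ by (metis right_minus_eq neg_equal_0_iff_equal)
    qed
  qed
  then show ?thesis using b by blast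
qed

lemma dissoc4_exists:
  fixes X :: "'a::{finite,ab_group_add} set"
  assumes X: "card X \<le> 300" and A: "CARD('a) \<ge> 400000"
  shows "\<exists>b1 b2 c1 c2. dissoc4 b1 b2 c1 c2 \<and> b1 \<notin> X \<and> b2 \<notin> X \<and> b1 + b2 \<notin> X \<and> b1 - b2 \<notin> X"
proof -
  obtain b1 where b1: "b1 \<notin> X" "dissoc [b1]" using dissoc_extend[OF dissoc_Nil, of X] X A by auto
  let ?Y = "X \<union> (\<lambda>x. x - b1) ` X \<union> (\<lambda>x. b1 - x) ` X"
  have "card ?Y \<le> 1000"
    using card_Un_le[of "X \<union> (\<lambda>x. x - b1) ` X" "(\<lambda>x. b1 - x) ` X"] card_Un_le[of X "(\<lambda>x. x - b1) ` X"]
      card_image_le[of X "\<lambda>x. x - b1"] card_image_le[of X "\<lambda>x. b1 - x"] X by auto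
  then obtain b2 where b2: "b2 \<notin> ?Y" "dissoc [b2, b1]" using dissoc_extend[OF b1(2), of ?Y] A by auto
  obtain c1 where c1: "dissoc [c1, b2, b1]" using dissoc_extend[OF b2(2), of "{}"] A by auto
  obtain c2 where c2: "dissoc [c2, c1, b2, b1]" using dissoc_extend[OF c1, of "{}"] A by auto
  have "dissoc4 b1 b2 c1 c2"
    unfolding dissoc4_def
  proof (intro allI impI)
    fix i j k l :: int
    assume *: "\<bar>i\<bar> \<le> 2" "\<bar>j\<bar> \<le> 2" "\<bar>k\<bar> \<le> 2" "\<bar>l\<bar> \<le> 2" "odd i \<or> odd j \<or> odd k \<or> odd l"
    have "comb [l, k, j, i] [c2, c1, b2, b1] \<noteq> 0"
      using c2[unfolded dissoc_def, rule_format, of "[l, k, j, i]"] * by (auto simp: abs_le_iff)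
    then show "zmul i b1 + zmul j b2 + zmul k c1 + zmul l c2 \<noteq> 0" by (simp add: comb_def ac_simps)
  qed
  moreover have "b1 + b2 \<notin> X"
  proof
    assume "b1 + b2 \<in> X"
    then have "b2 \<in> (\<lambda>x. x - b1) ` X" by (intro image_eqI[of _ _ "b1 + b2"]) auto
    then show False using b2 by blast
  qed
  moreover have "b1 - b2 \<notin> X"
  proof
    assume "b1 - b2 \<in> X"
    then have "b2 \<in> (\<lambda>x. b1 - x) ` X" by (intro image_eqI[of _ _ "b1 - b2"]) auto
    then show False using b2 by blast
  qed
  ultimately show ?thesis using b1 b2 by blast
qed

lemma span2_cases:
  assumes "x \<in> span2 b1 b2" "x \<noteq> 0"
  shows "\<exists>y\<in>{b1, b2, b1 + b2, b1 - b2}. x = y \<or> x = - y"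
proof -
  obtain i j where ij: "x = zmul i b1 + zmul j b2" "\<bar>i\<bar> \<le> 1" "\<bar>j\<bar> \<le> 1" using assms by (auto simp: span2_def)
  then have "i = -1 \<or> i = 0 \<or> i = 1" "j = -1 \<or> j = 0 \<or> j = 1" by linarith+
  then show ?thesis using ij(1) assms(2) by (elim disjE) (auto simp: algebra_simps)
qed

section \<open>A translate of a thin basis that the flows rarely meet\<close>

text \<open>Take a set \<open>P\<close> of 100 elements and a maximal family of disjoint translates \<open>P + y\<close>. Every further translate
  meets one of them, so \<open>P - P\<close> and the set of these \<open>y\<close> add up to the whole group.\<close>

lemma thin_basis:
  assumes A: "CARD('a::{finite,ab_group_add}) \<ge> 4000000"
  shows "\<exists>X Y :: 'a set. (\<forall>a. \<exists>x\<in>X. \<exists>y\<in>Y. a = x + y) \<and> 80 * (card X + card Y) \<le> CARD('a)"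
proof -
  obtain P :: "'a set" where P: "card P = 100"
    using obtain_subset_with_card_n[of 100 "UNIV :: 'a set"] A by auto
  let ?Q = "\<lambda>Y :: 'a set. \<forall>y\<in>Y. \<forall>y'\<in>Y. y \<noteq> y' \<longrightarrow> (\<forall>p\<in>P. \<forall>p'\<in>P. p + y \<noteq> p' + y')"
  have "{} \<in> Collect ?Q" by simp
  then have "\<exists>Y\<in>Collect ?Q. \<forall>Y'\<in>Collect ?Q. Y \<subseteq> Y' \<longrightarrow> Y = Y'"
    by (intro finite_has_maximal) (rule finite, blast)
  then obtain Y where YQ: "Y \<in> Collect ?Q" and max': "\<forall>Y'\<in>Collect ?Q. Y \<subseteq> Y' \<longrightarrow> Y = Y'"
    by (rule bexE)
  have Y: "?Q Y" using YQ by (rule CollectD)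
  have max: "Y = Y'" if "?Q Y'" "Y \<subseteq> Y'" for Y'
  proof -
    have "Y' \<in> Collect ?Q" using that(1) by (rule CollectI)
    with max' have "Y \<subseteq> Y' \<longrightarrow> Y = Y'" by (rule bspec)
    then show ?thesis using that(2) by (rule mp)
  qed
  define X where "X = (\<lambda>(p, p'). p - p') ` (P \<times> P)"
  have "card X \<le> 10000"
    using card_image_le[of "P \<times> P" "\<lambda>(p, p'). p - p'"] P by (simp add: X_def)
  moreover have "100 * card Y \<le> CARD('a)"
  proof -
    have "card (\<Union>y\<in>Y. (\<lambda>p. p + y) ` P) = (\<Sum>y\<in>Y. card ((\<lambda>p. p + y) ` P))"
      by (rule card_UN_disjoint) (use Y in auto)
    also have "\<dots> = (\<Sum>y\<in>Y. 100)" using P by (intro sum.cong) (auto simp: card_image)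
    finally show ?thesis using card_mono[of "UNIV :: 'a set" "\<Union>y\<in>Y. (\<lambda>p. p + y) ` P"] by simp
  qed
  moreover have "\<exists>x\<in>X. \<exists>y\<in>Y. a = x + y" for a
  proof (cases "a \<in> Y")
    case True
    obtain p where "p \<in> P" using P by fastforce
    then have "0 \<in> X" unfolding X_def by (intro image_eqI[of _ _ "(p, p)"]) auto
    then show ?thesis using True by force
  next
    case False
    have "\<not> ?Q (insert a Y)" using max[of "insert a Y"] False by blast
    then obtain y1 y2 p1 p2 where *: "y1 \<in> insert a Y" "y2 \<in> insert a Y" "y1 \<noteq> y2" "p1 \<in> P" "p2 \<in> P" "p1 + y1 = p2 + y2"
      by blast
    have "\<not> (y1 \<in> Y \<and> y2 \<in> Y)" using Y *(3-6) by blast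
    then have "y1 = a \<and> y2 \<in> Y \<or> y2 = a \<and> y1 \<in> Y" using *(1-3) by blast
    then obtain y p p' where *: "y \<in> Y" "p \<in> P" "p' \<in> P" "p + a = p' + y"
      using *(4-6) that by metis
    then have "a = (p' - p) + y" by (simp add: algebra_simps)
    moreover have "p' - p \<in> X" unfolding X_def using * by (intro image_eqI[of _ _ "(p', p)"]) auto
    ultimately show ?thesis using * by blast
  qed
  ultimately show ?thesis using A by (intro exI[of _ X] exI[of _ Y]) auto
qed

text \<open>The values that block a shift by an element of \<open>X + s\<close> or of \<open>Y - s\<close>, in either direction.\<close>

definition translates :: "'a::ab_group_add set \<Rightarrow> 'a set \<Rightarrow> 'a \<Rightarrow> 'a set" where
  "translates X Y s = {v. (\<exists>x\<in>X. v = x + s \<or> v = - (x + s)) \<or> (\<exists>y\<in>Y. v = y - s \<or> v = - (y - s))}"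

lemma card_translates_hit:
  fixes X Y :: "'a::{finite,ab_group_add} set"
  shows "card {s. v \<in> translates X Y s} \<le> 2 * (card X + card Y)"
proof -
  have "{s. v \<in> translates X Y s} \<subseteq> (\<lambda>x. v - x) ` X \<union> (\<lambda>x. - v - x) ` X \<union> (\<lambda>y. y - v) ` Y \<union> (\<lambda>y. y + v) ` Y"
  proof
    fix s assume "s \<in> {s. v \<in> translates X Y s}"
    then consider x where "x \<in> X" "v = x + s" | x where "x \<in> X" "v = - (x + s)"
      | y where "y \<in> Y" "v = y - s" | y where "y \<in> Y" "v = - (y - s)"
      by (auto simp: translates_def)
    then show "s \<in> (\<lambda>x. v - x) ` X \<union> (\<lambda>x. - v - x) ` X \<union> (\<lambda>y. y - v) ` Y \<union> (\<lambda>y. y + v) ` Y"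
    proof cases
      case 1 then have "s \<in> (\<lambda>x. v - x) ` X" by (intro image_eqI[of _ _ x]) auto
      then show ?thesis by blast
    next
      case 2 then have "s \<in> (\<lambda>x. - v - x) ` X" by (intro image_eqI[of _ _ x]) auto
      then show ?thesis by blast
    next
      case 3 then have "s \<in> (\<lambda>y. y - v) ` Y" by (intro image_eqI[of _ _ y]) auto
      then show ?thesis by blast
    next
      case 4 then have "s \<in> (\<lambda>y. y + v) ` Y" by (intro image_eqI[of _ _ y]) auto
      then show ?thesis by blast
    qed
  qed
  then have "card {s. v \<in> translates X Y s} \<le> card ((\<lambda>x. v - x) ` X \<union> (\<lambda>x. - v - x) ` X \<union> (\<lambda>y. y - v) ` Y \<union> (\<lambda>y. y + v) ` Y)"
    by (intro card_mono) auto
  also have "\<dots> \<le> card X + card X + card Y + card Y"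
    by (intro order_trans[OF card_Un_le] add_mono card_image_le) auto
  finally show ?thesis by simp
qed

text \<open>Averaging over all \<open>s\<close>: a fixed value is hit by few of the sets.\<close>

lemma rare_translate:
  fixes X Y :: "'a::{finite,ab_group_add} set" and f f' :: "'e \<Rightarrow> 'a"
  assumes c: "80 * (card X + card Y) \<le> CARD('a)" and fin: "finite E"
  shows "\<exists>s. 20 * card {e\<in>E. f e \<in> translates X Y s \<or> f' e \<in> translates X Y s} \<le> card E"
proof (rule ccontr)
  assume no: "\<not> ?thesis"
  let ?W = "\<lambda>s. {e\<in>E. f e \<in> translates X Y s \<or> f' e \<in> translates X Y s}"
  have "CARD('a) * (card E + 1) = (\<Sum>s\<in>(UNIV::'a set). card E + 1)" by simp
  also have "\<dots> \<le> (\<Sum>s\<in>UNIV. 20 * card (?W s))"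
    using no by (intro sum_mono) (auto simp: not_le Suc_le_eq)
  also have "\<dots> = 20 * (\<Sum>s\<in>UNIV. \<Sum>e\<in>E. if f e \<in> translates X Y s \<or> f' e \<in> translates X Y s then 1 else 0)"
    using fin by (simp add: sum_distrib_left[symmetric] sum.inter_filter[symmetric])
  also have "(\<Sum>s\<in>UNIV. \<Sum>e\<in>E. if f e \<in> translates X Y s \<or> f' e \<in> translates X Y s then 1 else 0)
      = (\<Sum>e\<in>E. \<Sum>s\<in>UNIV. if f e \<in> translates X Y s \<or> f' e \<in> translates X Y s then 1 else (0::nat))"
    by (rule sum.swap)
  also have "\<dots> \<le> (\<Sum>e\<in>E. 4 * (card X + card Y))"
  proof (rule sum_mono)
    fix e
    have "(\<Sum>s\<in>UNIV. if f e \<in> translates X Y s \<or> f' e \<in> translates X Y s then 1 else (0::nat))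
      = card ({s. f e \<in> translates X Y s} \<union> {s. f' e \<in> translates X Y s})"
      by (simp add: sum.If_cases Un_def)
    also have "\<dots> \<le> card {s. f e \<in> translates X Y s} + card {s. f' e \<in> translates X Y s}" by (rule card_Un_le)
    also have "\<dots> \<le> 4 * (card X + card Y)"
      using card_translates_hit[of "f e" X Y] card_translates_hit[of "f' e" X Y] by linarith
    finally show "(\<Sum>s\<in>UNIV. if f e \<in> translates X Y s \<or> f' e \<in> translates X Y s then 1 else (0::nat)) \<le> 4 * (card X + card Y)" .
  qed
  also have "20 * \<dots> = card E * (80 * (card X + card Y))" by simp
  also have "\<dots> \<le> card E * CARD('a)" using c by (rule mult_left_mono) simp
  finally show False by (simp add: algebra_simps)
qed

section \<open>Bridges after deleting few edges\<close>

text \<open>Cuts that witness \<open>k\<close> bridges separate the vertices into at least \<open>k + 1\<close> classes, since each bridge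
  runs inside a class of the other cuts and its own cut divides that class. Only bridges and deleted edges run
  between classes, and each class sends out at least four edges.\<close>

lemma card_bridges_le:
  assumes G: "loopfree V E t h" and four: "\<And>S. S \<subseteq> V \<Longrightarrow> S \<noteq> {} \<Longrightarrow> S \<noteq> V \<Longrightarrow> 4 \<le> card (cut E t h S)"
    and W: "W \<subseteq> E"
  shows "card {e\<in>E - W. \<exists>S\<subseteq>V. cut (E - W) t h S = {e}} \<le> card W"
proof -
  define B where "B = {e\<in>E - W. \<exists>S\<subseteq>V. cut (E - W) t h S = {e}}"
  have fin: "finite V" "finite E" "finite B" "finite W" using G W finite_subset by (auto simp: loopfree_def B_def)
  have ends: "t e \<in> V" "h e \<in> V" if "e \<in> E" for e using G that by (auto simp: loopfree_def)
  have "\<forall>e\<in>B. \<exists>S. S \<subseteq> V \<and> cut (E - W) t h S = {e}" by (auto simp: B_def)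
  from bchoice[OF this] obtain S where S: "\<And>e. e \<in> B \<Longrightarrow> cut (E - W) t h (S e) = {e}" by blast
  \<comment> \<open>two vertices are in the same class if no witnessing cut separates them\<close>
  define p where "p F x = {e\<in>F. x \<in> S e}" for F x
  have classes: "card F + 1 \<le> card (p F ` V)" if "finite F" "F \<subseteq> B" "V \<noteq> {}" for F
    using that
  proof (induction F rule: finite_induct)
    case empty
    then show ?case using fin by (simp add: Suc_le_eq card_gt_0_iff)
  next
    case (insert e F)
    have e: "e \<in> B" "e \<in> E - W" using insert.prems by (auto simp: B_def)
    have proj: "p F ` V = (\<lambda>s. s - {e}) ` (p (insert e F) ` V)"
    proof -
      have "p F x = p (insert e F) x - {e}" for x using insert.hyps by (auto simp: p_def)
      then show ?thesis by (simp add: image_image)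
    qed
    have "t e \<in> S e \<longleftrightarrow> h e \<notin> S e" using S[OF e(1)] by (auto simp: cut_def)
    then have ne: "p (insert e F) (t e) \<noteq> p (insert e F) (h e)" by (auto simp: p_def)
    have "t e \<in> S b \<longleftrightarrow> h e \<in> S b" if "b \<in> F" for b
    proof -
      have "cut (E - W) t h (S b) = {b}" "e \<noteq> b" using S insert that by auto
      then have "e \<notin> cut (E - W) t h (S b)" by simp
      then show ?thesis using e(2) by (auto simp: cut_def)
    qed
    then have "p (insert e F) (t e) - {e} = p (insert e F) (h e) - {e}" by (auto simp: p_def)
    moreover have "p (insert e F) (t e) \<in> p (insert e F) ` V" "p (insert e F) (h e) \<in> p (insert e F) ` V"
      using ends e(2) by blast+
    ultimately have "\<not> inj_on (\<lambda>s. s - {e}) (p (insert e F) ` V)"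
      using ne by (meson inj_onD)
    then have "card (p F ` V) \<noteq> card (p (insert e F) ` V)"
      unfolding proj using fin eq_card_imp_inj_on by blast
    moreover have "card (p F ` V) \<le> card (p (insert e F) ` V)"
      unfolding proj using fin by (intro card_image_le) simp
    ultimately show ?case using insert by simp
  qed
  show ?thesis
  proof (cases "B = {}")
    case True
    then show ?thesis unfolding B_def[symmetric] by simp
  next
    case False
    then have "V \<noteq> {}" using ends by (auto simp: B_def)
    then have cC: "card B + 1 \<le> card (p B ` V)" using classes fin by blast
    let ?C = "p B ` V"
    define K where "K c = {x\<in>V. p B x = c}" for c
    have sub: "cut E t h (K c) \<subseteq> W \<union> B" for c
    proof
      fix e assume e: "e \<in> cut E t h (K c)"
      then have eE: "e \<in> E" and ne: "p B (t e) \<noteq> p B (h e)" using ends by (auto simp: cut_def K_def)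
      then obtain b where b: "b \<in> B" "(t e \<in> S b) \<noteq> (h e \<in> S b)" by (auto simp: p_def)
      show "e \<in> W \<union> B"
      proof (cases "e \<in> W")
        case False
        then have "e \<in> cut (E - W) t h (S b)" using eE b by (auto simp: cut_def)
        then show ?thesis using S[OF b(1)] b by auto
      qed simp
    qed
    have big: "4 \<le> card (cut E t h (K c))" if c: "c \<in> ?C" for c
    proof (rule four)
      show "K c \<subseteq> V" "K c \<noteq> {}" using c by (auto simp: K_def)
      show "K c \<noteq> V"
      proof
        assume "K c = V"
        then have "?C \<subseteq> {c}" by (auto simp: K_def)
        then have "card ?C \<le> 1" using card_mono[of "{c}" ?C] by simp
        then show False using cC False fin by (metis card_gt_0_iff add_le_same_cancel2 le_trans not_le)
      qed
    qed
    have "4 * (card B + 1) \<le> 4 * card ?C" using cC by simp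
    also have "\<dots> = (\<Sum>c\<in>?C. 4)" by simp
    also have "\<dots> \<le> (\<Sum>c\<in>?C. card (cut E t h (K c)))" by (rule sum_mono) (rule big)
    also have "\<dots> = (\<Sum>c\<in>?C. \<Sum>e\<in>W \<union> B. if e \<in> cut E t h (K c) then 1 else 0)"
    proof (rule sum.cong)
      fix c
      have "cut E t h (K c) = {e\<in>W \<union> B. e \<in> cut E t h (K c)}" using sub[of c] by blast
      then show "card (cut E t h (K c)) = (\<Sum>e\<in>W \<union> B. if e \<in> cut E t h (K c) then 1 else 0)"
        using fin by (simp add: sum.inter_filter[symmetric])
    qed simp
    also have "\<dots> = (\<Sum>e\<in>W \<union> B. \<Sum>c\<in>?C. if e \<in> cut E t h (K c) then 1 else 0)" by (rule sum.swap)
    also have "\<dots> \<le> (\<Sum>e\<in>W \<union> B. 2)"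
    proof (rule sum_mono)
      fix e
      have "(\<Sum>c\<in>?C. if e \<in> cut E t h (K c) then 1 else 0) = card {c\<in>?C. e \<in> cut E t h (K c)}"
        using fin by (simp add: sum.inter_filter[symmetric])
      also have "\<dots> \<le> card {p B (t e), p B (h e)}" by (rule card_mono) (auto simp: cut_def K_def)
      also have "\<dots> \<le> 2" by (simp add: card_insert_if)
      finally show "(\<Sum>c\<in>?C. if e \<in> cut E t h (K c) then 1 else 0) \<le> (2::nat)" .
    qed
    also have "\<dots> \<le> 2 * (card W + card B)" using card_Un_le[of W B] by simp
    finally show ?thesis by (simp add: B_def)
  qed
qed

section \<open>At most one pairing at a vertex of degree four is bad\<close>

lemma card_filter_int: "finite F \<Longrightarrow> int (card {e\<in>F. P e}) = (\<Sum>e\<in>F. of_bool (P e))"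
  by (simp add: Int_def)

text \<open>Two crossing cuts of size at most \<open>k\<close> have four corners, each with at least \<open>k\<close> edges. Counting over the second
  cut, the two corners on either side of it are joined by at least \<open>k/2\<close> edges, hence by more than \<open>k/2\<close> as \<open>k\<close>
  is odd. All these edges cross the first cut, which is too much.\<close>

lemma crossing_cuts_contradiction:
  assumes fin: "finite F" and F: "\<And>e. e \<in> F \<Longrightarrow> t e \<in> V \<and> h e \<in> V" and k: "odd k"
    and one: "\<And>S. S \<subseteq> V \<Longrightarrow> of_bool (u0 \<in> S) + of_bool (u1 \<in> S) + of_bool (u2 \<in> S) + of_bool (u3 \<in> S) = (1::nat)
      \<Longrightarrow> k \<le> card (cut F t h S)"
    and u: "u3 \<in> V"
    and S: "S \<subseteq> V" "u0 \<in> S" "u1 \<in> S" "u2 \<notin> S" "u3 \<notin> S" "card (cut F t h S) \<le> k"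
    and R: "R \<subseteq> V" "u0 \<in> R" "u1 \<notin> R" "u2 \<in> R" "u3 \<notin> R" "card (cut F t h R) \<le> k"
  shows False
proof -
  define M where "M A B = {e\<in>F. t e \<in> A \<and> h e \<in> B \<or> t e \<in> B \<and> h e \<in> A}" for A B
  have glue: "int (card (cut F t h A)) + card (cut F t h B) \<le> card (cut F t h C) + 2 * int (card (M A B))"
    if "A \<inter> B = {}" "cut F t h C = cut F t h (A \<union> B)" for A B C
  proof -
    have "int (card (cut F t h A)) + card (cut F t h B)
      = (\<Sum>e\<in>F. of_bool ((t e \<in> A) \<noteq> (h e \<in> A)) + of_bool ((t e \<in> B) \<noteq> (h e \<in> B)))"
      using fin by (simp add: card_cut sum.distrib del: sum_of_bool_eq)
    also have "\<dots> \<le> (\<Sum>e\<in>F. of_bool ((t e \<in> A \<union> B) \<noteq> (h e \<in> A \<union> B)) + 2 * of_bool (t e \<in> A \<and> h e \<in> B \<or> t e \<in> B \<and> h e \<in> A))"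
      by (rule sum_mono) (use that(1) in auto)
    also have "\<dots> = card (cut F t h (A \<union> B)) + 2 * int (card (M A B))"
      unfolding M_def using fin by (simp add: card_cut card_filter_int sum.distrib sum_distrib_left[symmetric] del: sum_of_bool_eq)
    finally show ?thesis using that(2) by simp
  qed
  let ?X0 = "S \<inter> R" and ?X1 = "S - R" and ?X2 = "R - S" and ?X3 = "V - (S \<union> R)"
  have k0: "k \<le> card (cut F t h ?X0)" by (rule one) (use S R in auto)
  have k1: "k \<le> card (cut F t h ?X1)" by (rule one) (use S R in auto)
  have k2: "k \<le> card (cut F t h ?X2)" by (rule one) (use S R in auto)
  have k3: "k \<le> card (cut F t h ?X3)" by (rule one) (use S R u in auto)
  have "int (card (cut F t h ?X0)) + int (card (cut F t h ?X2)) \<le> card (cut F t h R) + 2 * int (card (M ?X0 ?X2))"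
  proof (rule glue)
    have "S \<inter> R \<union> (R - S) = R" by blast
    then show "cut F t h R = cut F t h (S \<inter> R \<union> (R - S))" by simp
  qed blast
  then have m02: "k + 1 \<le> 2 * card (M ?X0 ?X2)" using k0 k2 R(6) k by presburger
  have "int (card (cut F t h ?X1)) + int (card (cut F t h ?X3)) \<le> card (cut F t h R) + 2 * int (card (M ?X1 ?X3))"
  proof (rule glue)
    have "S - R \<union> (V - (S \<union> R)) = V - R" using S(1) by blast
    then show "cut F t h R = cut F t h (S - R \<union> (V - (S \<union> R)))" using cut_compl[of F t V h R] F by simp
  qed blast
  then have m13: "k + 1 \<le> 2 * card (M ?X1 ?X3)" using k1 k3 R(6) k by presburger
  have "M ?X0 ?X2 \<union> M ?X1 ?X3 \<subseteq> cut F t h S" "M ?X0 ?X2 \<inter> M ?X1 ?X3 = {}"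
    by (auto simp: M_def cut_def)
  moreover have "finite (M ?X0 ?X2)" "finite (M ?X1 ?X3)" using fin by (auto simp: M_def)
  ultimately have "card (M ?X0 ?X2) + card (M ?X1 ?X3) \<le> card (cut F t h S)"
    using card_mono[OF finite_cut[OF fin]] by (metis card_Un_disjoint)
  then show False using m02 m13 S(6) by linarith
qed

section \<open>Splitting a vertex of degree four\<close>

text \<open>The value of \<open>y\<close> on an edge at \<open>v\<close>, counted in the direction away from \<open>v\<close>.\<close>

definition outv :: "('e \<Rightarrow> 'v) \<Rightarrow> 'v \<Rightarrow> ('e \<Rightarrow> 'a::ab_group_add) \<Rightarrow> 'e \<Rightarrow> 'a" where
  "outv t v y e = (if t e = v then y e else - y e)"

locale degree_four =
  fixes V :: "'v set" and E :: "'e set" and t h :: "'e \<Rightarrow> 'v" and v :: 'v and e1 e2 e3 e4 :: 'e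
  assumes G: "loopfree V E t h" and v: "v \<in> V"
    and inc: "incident E t h v = {e1, e2, e3, e4}" and dist: "distinct [e1, e2, e3, e4]"
begin

abbreviation "I \<equiv> {e1, e2, e3, e4}"
abbreviation "u \<equiv> other t h v"

lemma fin: "finite V" "finite E" using G by (auto simp: loopfree_def)

lemma ends: "e \<in> E \<Longrightarrow> t e \<in> V \<and> h e \<in> V \<and> t e \<noteq> h e" using G by (simp add: loopfree_def)

lemma IE: "I \<subseteq> E" using inc by (auto simp: incident_def)

lemma u: "e \<in> I \<Longrightarrow> u e \<in> V \<and> u e \<noteq> v \<and> (t e = v \<and> h e = u e \<or> h e = v \<and> t e = u e)"
proof -
  assume e: "e \<in> I"
  then have "e \<in> incident E t h v" using inc by simp
  then show ?thesis using ends[of e] by (auto simp: incident_def other_def)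
qed

lemma notv: "e \<in> E - I \<Longrightarrow> t e \<noteq> v \<and> h e \<noteq> v"
proof -
  assume e: "e \<in> E - I"
  then have "e \<notin> incident E t h v" using inc by simp
  then show ?thesis using e by (auto simp: incident_def)
qed

lemma net_at:
  fixes y :: "'e \<Rightarrow> 'b::ab_group_add"
  shows "net E t h y w = net (E - I) t h y w +
     (if w = v then outv t v y e1 + outv t v y e2 + outv t v y e3 + outv t v y e4
      else - ((if u e1 = w then outv t v y e1 else 0) + (if u e2 = w then outv t v y e2 else 0)
        + (if u e3 = w then outv t v y e3 else 0) + (if u e4 = w then outv t v y e4 else 0)))"
proof -
  let ?c = "\<lambda>e. (if t e = w then y e else 0) - (if h e = w then y e else 0)"
  have c: "?c e = (if w = v then outv t v y e else - (if u e = w then outv t v y e else 0))" if "e \<in> I" for e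
  proof -
    have "t e = v \<and> h e = u e \<or> h e = v \<and> t e = u e" "u e \<noteq> v" using u[OF that] by blast+
    then show ?thesis by (elim disjE) (auto simp: outv_def)
  qed
  have "net E t h y w = (\<Sum>e\<in>E - I. ?c e) + (\<Sum>e\<in>I. ?c e)"
    unfolding net_def using sum.subset_diff[OF IE fin(2)] by blast
  also have "(\<Sum>e\<in>I. ?c e) = (\<Sum>e\<in>I. if w = v then outv t v y e else - (if u e = w then outv t v y e else 0))"
    by (rule sum.cong) (use c in auto)
  also have "\<dots> = (if w = v then outv t v y e1 + outv t v y e2 + outv t v y e3 + outv t v y e4
      else - ((if u e1 = w then outv t v y e1 else 0) + (if u e2 = w then outv t v y e2 else 0)
        + (if u e3 = w then outv t v y e3 else 0) + (if u e4 = w then outv t v y e4 else 0)))"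
  proof -
    have "(\<Sum>e\<in>I. g e) = g e1 + g e2 + g e3 + g e4" for g :: "'e \<Rightarrow> 'b" using dist by (simp add: add.assoc)
    then show ?thesis by simp
  qed
  finally show ?thesis by (simp add: net_def)
qed

lemma net_rest_v: "net (E - I) t h y v = 0"
  unfolding net_def by (rule sum.neutral) (use notv in auto)

text \<open>Splitting off \<open>e1 e2 | e3 e4\<close>: the edges \<open>e1\<close> and \<open>e3\<close> survive, with their end \<open>v\<close> replaced by the far end of
  \<open>e2\<close> and \<open>e4\<close>.\<close>

definition t' :: "'e \<Rightarrow> 'v" where
  "t' = t(e1 := if t e1 = v then u e2 else t e1, e3 := if t e3 = v then u e4 else t e3)"

definition h' :: "'e \<Rightarrow> 'v" where
  "h' = h(e1 := if h e1 = v then u e2 else h e1, e3 := if h e3 = v then u e4 else h e3)"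

abbreviation "E' \<equiv> E - {e2, e4}"

definition straight :: "('e \<Rightarrow> 'a::ab_group_add) \<Rightarrow> bool" where
  "straight y \<longleftrightarrow> outv t v y e2 = - outv t v y e1 \<and> outv t v y e4 = - outv t v y e3"

lemma net_split:
  assumes "straight y"
  shows "net E' t' h' y w = (if w = v then 0 else net E t h y w)"
proof -
  let ?c = "\<lambda>e. (if t' e = w then y e else 0) - (if h' e = w then y e else 0)"
  have E': "E' = (E - I) \<union> {e1, e3}" "(E - I) \<inter> {e1, e3} = {}" using IE dist by auto
  have "net E' t' h' y w = (\<Sum>e\<in>E - I. ?c e) + (\<Sum>e\<in>{e1, e3}. ?c e)"
    unfolding net_def E'(1) by (rule sum.union_disjoint) (use fin E'(2) in auto)
  also have "(\<Sum>e\<in>E - I. ?c e) = net (E - I) t h y w"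
    unfolding net_def by (rule sum.cong) (auto simp: t'_def h'_def)
  also have "(\<Sum>e\<in>{e1, e3}. ?c e) = ?c e1 + ?c e3" using dist by simp
  also have "?c e1 = (if u e2 = w then outv t v y e1 else 0) - (if u e1 = w then outv t v y e1 else 0)"
    using u[of e1] u[of e2] dist by (auto simp: t'_def h'_def outv_def)
  also have "?c e3 = (if u e4 = w then outv t v y e3 else 0) - (if u e3 = w then outv t v y e3 else 0)"
    using u[of e3] u[of e4] dist by (auto simp: t'_def h'_def outv_def)
  finally have eq: "net E' t' h' y w = net (E - I) t h y w
     + ((if u e2 = w then outv t v y e1 else 0) - (if u e1 = w then outv t v y e1 else 0)
     + ((if u e4 = w then outv t v y e3 else 0) - (if u e3 = w then outv t v y e3 else 0)))" .
  show ?thesis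
  proof (cases "w = v")
    case True
    then show ?thesis using eq net_rest_v u[of e1] u[of e2] u[of e3] u[of e4] by auto
  next
    case False
    then show ?thesis using eq net_at[of y w] assms by (simp add: straight_def)
  qed
qed

text \<open>The values on the deleted edges that let \<open>y\<close> pass straight through \<open>v\<close>; the sign depends on the directions
  of the two edges.\<close>

definition unsplit :: "('e \<Rightarrow> 'a::ab_group_add) \<Rightarrow> 'e \<Rightarrow> 'a" where
  "unsplit y = y(e2 := if (t e1 = v) = (t e2 = v) then - y e1 else y e1,
             e4 := if (t e3 = v) = (t e4 = v) then - y e3 else y e3)"

lemma unsplit_same: "e \<in> E' \<Longrightarrow> unsplit y e = y e" by (auto simp: unsplit_def)

lemma straight_unsplit: "straight (unsplit y)"
  using dist by (auto simp: straight_def outv_def unsplit_def)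

lemma unsplit_eq: "straight y \<Longrightarrow> unsplit y = y"
  unfolding straight_def outv_def unsplit_def
  by (rule ext) (auto split: if_splits)

lemma net_straight_v: "straight y \<Longrightarrow> net E t h y v = 0"
  using net_at[of y v] net_rest_v[of y] by (simp add: straight_def)

lemma circ_split: "straight y \<Longrightarrow> circ E' t' h' y \<longleftrightarrow> circ E t h y"
  unfolding circ_def using net_split net_straight_v by metis

lemma circ_unsplit: "circ E' t' h' y \<Longrightarrow> circ E t h (unsplit y)"
  using circ_split[OF straight_unsplit, of y] circ_cong[of E' "unsplit y" y] unsplit_same by blast

lemma nz_unsplit: "nzflow E' t' h' y \<Longrightarrow> nzflow E t h (unsplit y)"
proof -
  assume y: "nzflow E' t' h' y"
  have "e1 \<in> E'" "e3 \<in> E'" using IE dist by auto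
  then have "y e1 \<noteq> 0" "y e3 \<noteq> 0" using y unfolding nzflow_def by blast+
  then have "unsplit y e \<noteq> 0" if "e \<in> E" for e using that y unfolding nzflow_def by (auto simp: unsplit_def)
  then show ?thesis using y circ_unsplit by (auto simp: nzflow_def)
qed

lemma ustep_unsplit: "ustep E' t' h' y y' \<Longrightarrow> ustep E t h (unsplit y) (unsplit y')"
proof -
  assume "ustep E' t' h' y y'"
  then obtain b z where *: "nzflow E' t' h' y" "nzflow E' t' h' y'" "circ E' t' h' z"
    "\<forall>e\<in>E'. \<bar>z e\<bar> \<le> (1::int)" "\<forall>e\<in>E'. y' e = y e + zmul (z e) b"
    by (auto simp: ustep_def)
  have e13: "e1 \<in> E'" "e3 \<in> E'" using IE dist by auto
  have "\<bar>unsplit z e\<bar> \<le> 1" if "e \<in> E" for e using *(4) e13 that by (auto simp: unsplit_def)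
  moreover have "unsplit y' e = unsplit y e + zmul (unsplit z e) b" if "e \<in> E" for e
    using *(5) e13 that by (auto simp: unsplit_def zmul_minus)
  ultimately show ?thesis
    unfolding ustep_def using nz_unsplit[OF *(1)] nz_unsplit[OF *(2)] circ_unsplit[OF *(3)] by blast
qed

lemma reach_split:
  assumes "nzflow E t h f" "straight f" "nzflow E t h f'" "straight f'"
    and IH: "nzflow E' t' h' f \<Longrightarrow> nzflow E' t' h' f' \<Longrightarrow> reach E' t' h' f f'"
  shows "reach E t h f f'"
proof -
  have "nzflow E' t' h' f" "nzflow E' t' h' f'"
    using assms circ_split by (auto simp: nzflow_def)
  then have "reach E' t' h' f f'" by (rule IH)
  then have "reach E t h (unsplit f) (unsplit f')"
    by (induction rule: rtranclp_induct) (auto intro: ustep_unsplit rtranclp.rtrancl_into_rtrancl)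
  then show ?thesis unfolding unsplit_eq[OF assms(2)] unsplit_eq[OF assms(4)] .
qed

definition count :: "'v set \<Rightarrow> nat" where
  "count S = of_bool (u e1 \<in> S) + of_bool (u e2 \<in> S) + of_bool (u e3 \<in> S) + of_bool (u e4 \<in> S)"

lemma cut_at:
  assumes S: "v \<notin> S" and F: "I \<subseteq> F" "F \<subseteq> E"
  shows "cut F t h S = cut (F - I) t h S \<union> {e\<in>I. u e \<in> S}" "card (cut F t h S) = card (cut (F - I) t h S) + count S"
proof -
  show eq: "cut F t h S = cut (F - I) t h S \<union> {e\<in>I. u e \<in> S}"
  proof (rule set_eqI)
    fix e
    show "e \<in> cut F t h S \<longleftrightarrow> e \<in> cut (F - I) t h S \<union> {e\<in>I. u e \<in> S}"
    proof (cases "e \<in> I")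
      case True
      then show ?thesis using u[OF True] S F by (auto simp: cut_def)
    next
      case False
      then show ?thesis by (auto simp: cut_def)
    qed
  qed
  have "card {e\<in>I. u e \<in> S} = (\<Sum>e\<in>I. of_bool (u e \<in> S))" by (simp add: Int_def)
  also have "\<dots> = count S" using dist by (simp add: count_def add.assoc del: sum_of_bool_eq)
  finally have "card {e\<in>I. u e \<in> S} = count S" .
  moreover have "finite F" using F fin finite_subset by blast
  moreover have "cut (F - I) t h S \<inter> {e\<in>I. u e \<in> S} = {}" by (auto simp: cut_def)
  ultimately show "card (cut F t h S) = card (cut (F - I) t h S) + count S"
    unfolding eq by (subst card_Un_disjoint) auto
qed

text \<open>Splitting shrinks a cut only if it separates the far ends of \<open>e1, e2\<close> from those of \<open>e3, e4\<close>.\<close>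

lemma split_cuts:
  assumes four: "\<And>S. S \<subseteq> V \<Longrightarrow> S \<noteq> {} \<Longrightarrow> S \<noteq> V \<Longrightarrow> 4 \<le> card (cut E t h S)"
    and good: "\<And>S. S \<subseteq> V - {v} \<Longrightarrow> u e1 \<in> S \<Longrightarrow> u e2 \<in> S \<Longrightarrow> u e3 \<notin> S \<Longrightarrow> u e4 \<notin> S \<Longrightarrow> 4 \<le> card (cut (E - I) t h S)"
    and S: "S \<subseteq> V - {v}" "S \<noteq> {}" "S \<noteq> V - {v}"
  shows "4 \<le> card (cut E' t' h' S)"
proof -
  have vS: "v \<notin> S" using S by blast
  have e13: "e1 \<in> E'" "e3 \<in> E'" using IE dist by auto
  have sub: "cut (E - I) t h S \<subseteq> cut E' t' h' S" by (auto simp: cut_def t'_def h'_def)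
  have c1: "e1 \<in> cut E' t' h' S \<longleftrightarrow> (u e1 \<in> S) \<noteq> (u e2 \<in> S)"
    using u[of e1] e13 dist by (auto simp: cut_def t'_def h'_def)
  have c3: "e3 \<in> cut E' t' h' S \<longleftrightarrow> (u e3 \<in> S) \<noteq> (u e4 \<in> S)"
    using u[of e3] e13 dist by (auto simp: cut_def t'_def h'_def)
  have ni: "e1 \<notin> cut (E - I) t h S" "e3 \<notin> cut (E - I) t h S" by (auto simp: cut_def)
  have fc: "finite (cut E' t' h' S)" "finite (cut (E - I) t h S)" using fin by auto
  let ?c = "card (cut (E - I) t h S)"
  have lower: "?c + of_bool ((u e1 \<in> S) \<noteq> (u e2 \<in> S)) + of_bool ((u e3 \<in> S) \<noteq> (u e4 \<in> S)) \<le> card (cut E' t' h' S)"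
  proof -
    let ?D = "(if (u e1 \<in> S) \<noteq> (u e2 \<in> S) then {e1} else {}) \<union> (if (u e3 \<in> S) \<noteq> (u e4 \<in> S) then {e3} else {})"
    have "cut (E - I) t h S \<union> ?D \<subseteq> cut E' t' h' S" using sub c1 c3 by auto
    then have "card (cut (E - I) t h S \<union> ?D) \<le> card (cut E' t' h' S)" using fc card_mono by blast
    moreover have "card (cut (E - I) t h S \<union> ?D) = ?c + card ?D" using ni fc by (intro card_Un_disjoint) auto
    moreover have "card ?D = of_bool ((u e1 \<in> S) \<noteq> (u e2 \<in> S)) + of_bool ((u e3 \<in> S) \<noteq> (u e4 \<in> S))"
      using dist by auto
    ultimately show ?thesis by linarith
  qed
  have inE: "?c + count S \<ge> 4" using four[of S] S vS v cut_at(2)[OF vS IE subset_refl] by auto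
  have outE: "?c + (4 - count S) \<ge> 4"
  proof -
    let ?R = "V - {v} - S"
    have "cut E t h (V - ?R) = cut E t h ?R" using ends by (intro cut_compl) auto
    have "v \<notin> ?R" by blast
    have "4 \<le> card (cut E t h ?R)" by (rule four) (use S v in auto)
    also have "\<dots> = card (cut (E - I) t h ?R) + count ?R" by (rule cut_at(2)) (use IE in auto)
    also have "cut (E - I) t h ?R = cut (E - I) t h S" using ends notv by (intro cut_compl) auto
    also have "count ?R = 4 - count S"
      using u[of e1] u[of e2] u[of e3] u[of e4] by (auto simp: count_def)
    finally show ?thesis .
  qed
  have g1: "4 \<le> ?c" if "u e1 \<in> S" "u e2 \<in> S" "u e3 \<notin> S" "u e4 \<notin> S" using good[OF S(1)] that by blast
  have g2: "4 \<le> ?c" if "u e1 \<notin> S" "u e2 \<notin> S" "u e3 \<in> S" "u e4 \<in> S"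
  proof -
    have "4 \<le> card (cut (E - I) t h (V - {v} - S))"
      by (rule good) (use that u[of e1] u[of e2] in auto)
    also have "cut (E - I) t h (V - {v} - S) = cut (E - I) t h S" using ends notv by (intro cut_compl) auto
    finally show ?thesis .
  qed
  show ?thesis
    using lower inE outE g1 g2 unfolding count_def
    by (cases "u e1 \<in> S"; cases "u e2 \<in> S"; cases "u e3 \<in> S"; cases "u e4 \<in> S") simp_all
qed

lemma split_loopfree:
  assumes "u e1 \<noteq> u e2" "u e3 \<noteq> u e4"
  shows "loopfree (V - {v}) E' t' h'"
proof -
  have "t' e \<in> V - {v} \<and> h' e \<in> V - {v} \<and> t' e \<noteq> h' e" if e: "e \<in> E'" for e
  proof -
    consider "e = e1" | "e = e3" | "e \<in> E - I" using e by blast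
    then show ?thesis
    proof cases
      case 1
      then show ?thesis using u[of e1] u[of e2] assms dist by (auto simp: t'_def h'_def)
    next
      case 2
      then show ?thesis using u[of e3] u[of e4] assms dist by (auto simp: t'_def h'_def)
    next
      case 3
      then show ?thesis using notv[OF 3] ends[of e] by (auto simp: t'_def h'_def)
    qed
  qed
  then show ?thesis using fin by (simp add: loopfree_def)
qed

text \<open>The cut conditions yield a unit circulation that leaves \<open>v\<close> through \<open>e1\<close> and \<open>e2\<close> and returns through
  \<open>e3\<close> and \<open>e4\<close>. A directed cycle in it through \<open>e1\<close> leaves \<open>v\<close> only once, so \<open>e2\<close> stays in the remainder.\<close>

lemma two_cycles:
  assumes R: "I \<subseteq> R" "R \<subseteq> E"
    and one: "\<And>S. S \<subseteq> V - {v} \<Longrightarrow> count S = 1 \<or> count S = 3 \<Longrightarrow> 1 \<le> card (cut (R - I) t h S)"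
    and two: "\<And>S. S \<subseteq> V - {v} \<Longrightarrow> u e1 \<in> S \<Longrightarrow> u e2 \<in> S \<Longrightarrow> u e3 \<notin> S \<Longrightarrow> u e4 \<notin> S \<Longrightarrow> 2 \<le> card (cut (R - I) t h S)"
  shows "\<exists>z1 z2. circ E t h z1 \<and> circ E t h z2 \<and> (\<forall>e. \<bar>z1 e\<bar> \<le> (1::int)) \<and> (\<forall>e. \<bar>z2 e\<bar> \<le> (1::int)) \<and>
    (\<forall>e. z1 e = 0 \<or> z2 e = 0) \<and> (\<forall>e. e \<notin> R \<longrightarrow> z1 e = 0 \<and> z2 e = 0) \<and>
    outv t v z1 e1 = 1 \<and> z1 e2 = 0 \<and> outv t v z2 e2 = 1 \<and> z2 e1 = 0"
proof -
  let ?V = "V - {v}"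
  let ?d = "\<lambda>w. of_bool (w = u e1) + of_bool (w = u e2) - of_bool (w = u e3) - of_bool (w = u e4) :: int"
  have finR: "finite R" using R fin finite_subset by blast
  have sd: "sum ?d S = of_bool (u e1 \<in> S) + of_bool (u e2 \<in> S) - of_bool (u e3 \<in> S) - of_bool (u e4 \<in> S)" if "S \<subseteq> ?V" for S
  proof -
    have "finite S" using that fin finite_subset by blast
    then show ?thesis by (simp add: sum.distrib sum_subtractf sum_delta_int del: sum_of_bool_eq)
  qed
  have endsR: "t e \<in> ?V \<and> h e \<in> ?V \<and> t e \<noteq> h e" if "e \<in> R - I" for e
    using that R ends[of e] notv[of e] by auto
  have "\<bar>sum ?d S\<bar> \<le> card (cut (R - I) t h S)" if S: "S \<subseteq> ?V" for S
  proof -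
    have two': "2 \<le> card (cut (R - I) t h S)" if "u e1 \<notin> S" "u e2 \<notin> S" "u e3 \<in> S" "u e4 \<in> S"
    proof -
      have "2 \<le> card (cut (R - I) t h (?V - S))"
        by (rule two) (use that u[of e1] u[of e2] in auto)
      also have "cut (R - I) t h (?V - S) = cut (R - I) t h S" using endsR by (intro cut_compl) auto
      finally show ?thesis .
    qed
    show ?thesis
      using sd[OF S] one[OF S] two[OF S] two' unfolding count_def
      by (cases "u e1 \<in> S"; cases "u e2 \<in> S"; cases "u e3 \<in> S"; cases "u e4 \<in> S") simp_all
  qed
  moreover have "sum ?d ?V = 0" using sd[of ?V] u[of e1] u[of e2] u[of e3] u[of e4] by simp
  ultimately obtain x where x: "\<forall>e. \<bar>x e\<bar> \<le> 1" "\<forall>e. e \<notin> R - I \<longrightarrow> x e = 0" "\<forall>w\<in>?V. net (R - I) t h x w = ?d w"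
    using unit_flow_exists[of "R - I" ?V t h ?d] endsR finR fin by blast
  define w where "w = x(e1 := if t e1 = v then 1 else -1, e2 := if t e2 = v then 1 else -1,
    e3 := if t e3 = v then -1 else 1, e4 := if t e4 = v then -1 else 1)"
  have ow: "outv t v w e1 = 1" "outv t v w e2 = 1" "outv t v w e3 = -1" "outv t v w e4 = -1"
    using dist by (auto simp: outv_def w_def)
  have wI: "w e = x e" if "e \<notin> I" for e using that by (auto simp: w_def)
  have nw: "net (E - I) t h w a = net (R - I) t h x a" for a
  proof -
    have "net (E - I) t h w a = net (E - I) t h x a" by (rule net_cong) (use wI in auto)
    also have "\<dots> = net (R - I) t h x a" using fin R x by (intro net_mono_support) auto
    finally show ?thesis .
  qed
  have "net E t h w a = 0" for a
  proof (cases "a = v")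
    case True
    then show ?thesis using net_at[of w v] net_rest_v[of w] ow by simp
  next
    case av: False
    show ?thesis
    proof (cases "a \<in> V")
      case True
      then have "net (R - I) t h x a = ?d a" using x(3) av by blast
      then show ?thesis using net_at[of w a] av ow nw[of a] by (simp add: of_bool_def eq_commute[of a])
    next
      case False
      then show ?thesis using net_outside[OF G] by blast
    qed
  qed
  then have cw: "circ E t h w" by (simp add: circ_def)
  have w1: "\<bar>w e\<bar> \<le> 1" for e using x(1) by (auto simp: w_def)
  have wR: "w e = 0" if "e \<notin> R" for e
  proof -
    have "e \<notin> I" using that R by blast
    then show ?thesis using wI[of e] x(2) that by simp
  qed
  have "w e1 \<noteq> 0" using dist by (auto simp: w_def)
  then obtain z1 where z1: "circ E t h z1" "conforms E z1 w" "z1 e1 \<noteq> 0"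
    and un: "\<And>a b. z1 a \<noteq> 0 \<Longrightarrow> z1 b \<noteq> 0 \<Longrightarrow> src t h w a = src t h w b \<Longrightarrow> a = b"
    using dicycle_through[OF fin(2) cw, of e1] IE by blast
  have z1w: "z1 e = 0 \<or> z1 e = w e" for e
  proof -
    have "w e = sgn (w e)" using w1[of e] by (auto simp: sgn_if)
    then show ?thesis using conforms_cases[OF z1(2), of e] by presburger
  qed
  have "src t h w e1 = v" "src t h w e2 = v"
    using u[of e1] u[of e2] dist by (auto simp: src_def w_def)
  then have z1e2: "z1 e2 = 0" using un[of e1 e2] z1(3) dist by auto
  have z1e1: "z1 e1 = w e1" using z1w[of e1] z1(3) by blast
  let ?z2 = "\<lambda>e. w e - z1 e"
  have "circ E t h ?z2" by (intro circ_diff cw z1)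
  moreover have "\<bar>?z2 e\<bar> \<le> 1" "\<bar>z1 e\<bar> \<le> 1" "z1 e = 0 \<or> ?z2 e = 0" for e
    using z1w[of e] w1[of e] by auto
  moreover have "z1 e = 0 \<and> ?z2 e = 0" if "e \<notin> R" for e using z1w[of e] wR[OF that] by auto
  moreover have "outv t v z1 e1 = 1" "outv t v ?z2 e2 = 1" "?z2 e1 = 0"
    using ow z1e1 z1e2 by (auto simp: outv_def)
  ultimately show ?thesis using z1(1) z1e2 by (intro exI[of _ z1] exI[of _ ?z2]) blast
qed

lemma outv_zmul: "outv t v (\<lambda>e. f e + zmul (z e) b) e = outv t v f e + zmul (outv t v z e) b"
  by (auto simp: outv_def zmul_minus)

text \<open>The two shifts have disjoint supports, so each edge is exposed to only one of the forbidden values, and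
  together they cancel the outflow on \<open>e1\<close> and \<open>e2\<close>.\<close>

lemma straighten:
  fixes f :: "'e \<Rightarrow> 'a::ab_group_add"
  assumes f: "nzflow E t h f"
    and z: "circ E t h z1" "circ E t h z2" "\<forall>e. \<bar>z1 e\<bar> \<le> (1::int)" "\<forall>e. \<bar>z2 e\<bar> \<le> (1::int)"
      "\<forall>e. z1 e = 0 \<or> z2 e = 0" "\<forall>e. e \<notin> R \<longrightarrow> z1 e = 0 \<and> z2 e = 0"
      "outv t v z1 e1 = 1" "z1 e2 = 0" "outv t v z2 e2 = 1" "z2 e1 = 0"
    and b: "b1 + b2 = - (outv t v f e1 + outv t v f e2)"
    and free: "\<And>e. e \<in> R \<Longrightarrow> f e \<noteq> b1 \<and> f e \<noteq> - b1 \<and> f e \<noteq> b2 \<and> f e \<noteq> - b2"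
  shows "\<exists>g. nzflow E t h g \<and> straight g \<and> reach E t h f g"
proof -
  let ?f = "\<lambda>e. f e + zmul (z1 e) b1" and ?g = "\<lambda>e. f e + zmul (z1 e) b1 + zmul (z2 e) b2"
  have nz: "x + zmul k b \<noteq> 0" if "\<bar>k\<bar> \<le> 1" "x \<noteq> 0" "k \<noteq> 0 \<Longrightarrow> x \<noteq> b \<and> x \<noteq> - b" for x b :: 'a and k
  proof -
    have "k = -1 \<or> k = 0 \<or> k = 1" using that(1) by linarith
    then show ?thesis
    proof (elim disjE)
      assume "k = 1"
      then show ?thesis using that(3) by (simp add: eq_neg_iff_add_eq_0)
    qed (use that in auto)
  qed
  have f0: "f e \<noteq> 0" if "e \<in> E" for e using f that by (auto simp: nzflow_def)
  have f1: "?f e \<noteq> 0" if e: "e \<in> E" for e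
    by (rule nz) (use z(3,6) f0[OF e] free[of e] in auto)
  have g1: "?g e \<noteq> 0" if e: "e \<in> E" for e
  proof (cases "z2 e = 0")
    case True
    then show ?thesis using f1[OF e] by simp
  next
    case False
    then have "z1 e = 0" "e \<in> R" using z(5,6) by blast+
    then have "f e + zmul (z2 e) b2 \<noteq> 0" using z(4) f0[OF e] free[of e] by (intro nz) auto
    then show ?thesis using \<open>z1 e = 0\<close> by simp
  qed
  have s1: "ustep E t h f ?f" by (rule ustep_shift[OF f z(1)]) (use z f1 in auto)
  then have nf: "nzflow E t h ?f" by (auto simp: ustep_def)
  have s2: "ustep E t h ?f ?g" by (rule ustep_shift[OF nf z(2)]) (use z g1 in auto)
  then have ng: "nzflow E t h ?g" by (auto simp: ustep_def)
  have o: "outv t v ?g e = outv t v f e + zmul (outv t v z1 e) b1 + zmul (outv t v z2 e) b2" for e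
    unfolding outv_zmul ..
  have z12: "outv t v z1 e2 = 0" "outv t v z2 e1 = 0" using z(8,10) by (simp_all add: outv_def)
  have "outv t v ?g e1 + outv t v ?g e2 = (outv t v f e1 + b1) + (outv t v f e2 + b2)"
    unfolding o z(7,9) z12 by simp
  also have "\<dots> = (b1 + b2) + (outv t v f e1 + outv t v f e2)" by (simp add: ac_simps)
  finally have o12: "outv t v ?g e1 + outv t v ?g e2 = 0" unfolding b by simp
  have "outv t v ?g e1 + outv t v ?g e2 + outv t v ?g e3 + outv t v ?g e4 = 0"
    using net_at[of ?g v] net_rest_v[of ?g] ng by (simp add: nzflow_def circ_def)
  then have o34: "outv t v ?g e3 + outv t v ?g e4 = 0" unfolding o12 by simp
  have "straight ?g"
    unfolding straight_def add_eq_0_iff[symmetric] using o12 o34 by (rule conjI)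
  moreover have "reach E t h f ?g" using s1 s2 by (meson r_into_rtranclp rtranclp_trans)
  ultimately show ?thesis using ng by blast
qed

text \<open>The pairing \<open>a b | c d\<close> of the four neighbours is bad if a small cut of \<open>F\<close> separates the two pairs. For all edges
  away from \<open>v\<close> and \<open>k = 3\<close> this spoils the cut condition after splitting; for the edges that are left after
  deletion and \<open>k = 1\<close> it prevents the two cycles.\<close>

definition bad :: "'e set \<Rightarrow> nat \<Rightarrow> 'v \<Rightarrow> 'v \<Rightarrow> 'v \<Rightarrow> 'v \<Rightarrow> bool" where
  "bad F k a b c d \<longleftrightarrow> (\<exists>S\<subseteq>V - {v}. a \<in> S \<and> b \<in> S \<and> c \<notin> S \<and> d \<notin> S \<and> card (cut F t h S) \<le> k)"

lemma bad_exclusive: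
  assumes F: "F \<subseteq> E - I" and k: "odd k" and p: "{a, b, c, d} = u ` I"
    and one: "\<And>S. S \<subseteq> V - {v} \<Longrightarrow> of_bool (a \<in> S) + of_bool (b \<in> S) + of_bool (c \<in> S) + of_bool (d \<in> S) = (1::nat) \<Longrightarrow> k \<le> card (cut F t h S)"
  shows "\<not> (bad F k a b c d \<and> bad F k a c b d)"
proof
  assume "bad F k a b c d \<and> bad F k a c b d"
  then obtain S R where S: "S \<subseteq> V - {v}" "a \<in> S" "b \<in> S" "c \<notin> S" "d \<notin> S" "card (cut F t h S) \<le> k"
    and R: "R \<subseteq> V - {v}" "a \<in> R" "b \<notin> R" "c \<in> R" "d \<notin> R" "card (cut F t h R) \<le> k"
    unfolding bad_def by blast
  have fF: "finite F" using F fin finite_subset by blast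
  have "t e \<in> V - {v} \<and> h e \<in> V - {v}" if "e \<in> F" for e using F that ends[of e] notv[of e] by auto
  moreover have "d \<in> u ` I" using p by blast
  then obtain e where "e \<in> I" "d = u e" by blast
  then have "d \<in> V - {v}" using u[of e] by simp
  ultimately show False
    using crossing_cuts_contradiction[OF fF _ k one _ S R] by blast
qed

end

section \<open>Any two flows are joined\<close>

lemma degree_four_count:
  assumes "finite V" "\<And>v. v \<in> V \<Longrightarrow> 4 \<le> d v" "(\<Sum>v\<in>V. d v) = 2 * m" "4 * m < 9 * card V"
  shows "card V < 2 * card {v\<in>V. d v = (4::nat)}"
proof -
  let ?F = "{v\<in>V. d v = 4}"
  have "5 * card V = (\<Sum>v\<in>V. 5)" by simp
  also have "\<dots> \<le> (\<Sum>v\<in>V. d v + (if d v = 4 then 1 else 0))" using assms(2) by (intro sum_mono) force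
  also have "\<dots> = 2 * m + card ?F" using assms(1,3) by (simp add: sum.distrib sum.inter_filter[symmetric])
  finally show ?thesis using assms(4) by linarith
qed

definition contractible where
  "contractible V E t h f f' \<longleftrightarrow> (\<exists>U T1 T2 b1 b2 c1 c2. card U \<ge> 2 \<and> doubly_connected V E t h U T1 T2 \<and> dissoc4 b1 b2 c1 c2 \<and>
    (\<forall>e\<in>T1 \<union> T2. f e \<notin> span2 b1 b2 \<and> f' e \<notin> span2 b1 b2))"

text \<open>Up to sign, \<open>span2 b1 b2\<close> has at most four nonzero elements. If each of them is taken by at most one edge
  in 36, at most a ninth of the edges is lost, and \<open>8/9 * 9/4 = 2\<close>.\<close>

lemma dense_case:
  fixes f f' :: "'e \<Rightarrow> 'a::{finite,ab_group_add}"
  assumes A: "CARD('a) \<ge> 400000" and G: "loopfree V E t h" and V: "card V \<ge> 2"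
    and nz: "nzflow E t h f" "nzflow E t h f'" and d: "9 * card V \<le> 4 * card E"
  shows "contractible V E t h f f'"
proof -
  have fin: "finite E" "finite V" using G by (auto simp: loopfree_def)
  have E0: "card E > 0" using d V by linarith
  define N where "N x = {e\<in>E. f e = x \<or> f e = - x \<or> f' e = x \<or> f' e = - x}" for x
  define X where "X = {x. card E < 36 * card (N x)}"
  have "(\<Sum>x\<in>UNIV. card (N x)) = (\<Sum>x\<in>UNIV. \<Sum>e\<in>E. if f e = x \<or> f e = - x \<or> f' e = x \<or> f' e = - x then 1 else 0)"
    unfolding N_def using fin by (simp add: sum.inter_filter[symmetric])
  also have "\<dots> = (\<Sum>e\<in>E. \<Sum>x\<in>UNIV. if f e = x \<or> f e = - x \<or> f' e = x \<or> f' e = - x then 1 else 0)" by (rule sum.swap)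
  also have "\<dots> \<le> (\<Sum>e\<in>E. 4)"
  proof (rule sum_mono)
    fix e
    have "(\<Sum>x\<in>UNIV. if f e = x \<or> f e = - x \<or> f' e = x \<or> f' e = - x then 1 else (0::nat))
      = card {x. f e = x \<or> f e = - x \<or> f' e = x \<or> f' e = - x}"
      by (simp add: sum.If_cases)
    also have "\<dots> \<le> card {f e, - f e, f' e, - f' e}" by (rule card_mono) (auto simp: minus_equation_iff)
    also have "\<dots> \<le> 4" by (simp add: card_insert_if)
    finally show "(\<Sum>x\<in>UNIV. if f e = x \<or> f e = - x \<or> f' e = x \<or> f' e = - x then 1 else (0::nat)) \<le> 4" .
  qed
  finally have tot: "(\<Sum>x\<in>UNIV. card (N x)) \<le> 4 * card E" by simp
  have "card X * card E = (\<Sum>x\<in>X. card E)" by simp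
  also have "\<dots> \<le> (\<Sum>x\<in>X. 36 * card (N x))" by (rule sum_mono) (simp add: X_def)
  also have "\<dots> \<le> (\<Sum>x\<in>UNIV. 36 * card (N x))" by (rule sum_mono2) auto
  also have "\<dots> \<le> 144 * card E" using tot by (simp add: sum_distrib_left[symmetric])
  finally have "card X \<le> 300" using E0 by simp
  then obtain b1 b2 c1 c2 where b: "dissoc4 b1 b2 c1 c2" "b1 \<notin> X" "b2 \<notin> X" "b1 + b2 \<notin> X" "b1 - b2 \<notin> X"
    using dissoc4_exists[OF _ A, of X] by blast
  define W where "W = {e\<in>E. f e \<in> span2 b1 b2 \<or> f' e \<in> span2 b1 b2}"
  have "W \<subseteq> N b1 \<union> N b2 \<union> N (b1 + b2) \<union> N (b1 - b2)"
  proof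
    fix e assume e: "e \<in> W"
    then have "f e \<noteq> 0" "f' e \<noteq> 0" "e \<in> E" using nz by (auto simp: nzflow_def W_def)
    then have "\<exists>y\<in>{b1, b2, b1 + b2, b1 - b2}. e \<in> N y"
      using e span2_cases[of "f e" b1 b2] span2_cases[of "f' e" b1 b2] unfolding W_def N_def by blast
    then show "e \<in> N b1 \<union> N b2 \<union> N (b1 + b2) \<union> N (b1 - b2)" by blast
  qed
  moreover have finN: "finite (N x)" for x using fin by (simp add: N_def)
  ultimately have "card W \<le> card (N b1 \<union> N b2 \<union> N (b1 + b2) \<union> N (b1 - b2))" by (intro card_mono) auto
  also have "\<dots> \<le> card (N b1) + card (N b2) + card (N (b1 + b2)) + card (N (b1 - b2))"
    by (intro order_trans[OF card_Un_le] add_mono order_refl)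
  finally have cW: "9 * card W \<le> card E" using b(2-5) unfolding X_def by auto
  have "card (E - W) = card E - card W" using fin by (intro card_Diff_subset) (auto simp: W_def)
  then have "2 * card V \<le> card (E - W) + 2" using cW d by linarith
  then obtain U T1 T2 where U: "card U \<ge> 2" "T1 \<subseteq> E - W" "doubly_connected V E t h U T1 T2" "T2 \<subseteq> E - W"
    using dense_doubly_connected[OF G _ V, of "E - W"] by blast
  have "f e \<notin> span2 b1 b2 \<and> f' e \<notin> span2 b1 b2" if "e \<in> T1 \<union> T2" for e
    using that U(2,4) by (auto simp: W_def)
  then show ?thesis unfolding contractible_def using U(1,3) b(1) by blast
qed

lemma parallel_case:
  fixes f f' :: "'e \<Rightarrow> 'a::{finite,ab_group_add}"
  assumes A: "CARD('a) \<ge> 400000" and G: "loopfree V E t h"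
    and nz: "nzflow E t h f" "nzflow E t h f'"
    and p: "a \<in> E" "b \<in> E" "a \<noteq> b" "{t a, h a} = {t b, h b}"
  shows "contractible V E t h f f'"
proof -
  define X where "X = {f a, - f a, f b, - f b, f' a, - f' a, f' b, - f' b}"
  have "X = set [f a, - f a, f b, - f b, f' a, - f' a, f' b, - f' b]" by (simp add: X_def)
  then have "card X \<le> 8" using card_length[of "[f a, - f a, f b, - f b, f' a, - f' a, f' b, - f' b]"] by simp
  then obtain b1 b2 c1 c2 where bs: "dissoc4 b1 b2 c1 c2" "b1 \<notin> X" "b2 \<notin> X" "b1 + b2 \<notin> X" "b1 - b2 \<notin> X"
    using dissoc4_exists[OF _ A, of X] by auto
  have X: "x \<notin> span2 b1 b2" if "x \<noteq> 0" "x \<in> X" for x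
  proof
    assume "x \<in> span2 b1 b2"
    from span2_cases[OF this that(1)] obtain y where y: "y \<in> {b1, b2, b1 + b2, b1 - b2}" "x = y \<or> x = - y"
      by (rule bexE)
    have "- x \<in> X" using that(2) unfolding X_def by auto
    then have "y \<in> X" using y(2) that(2) by auto
    then show False using bs(2-5) y(1) by blast
  qed
  have ne: "t a \<noteq> h a" "t a \<in> V" "h a \<in> V" using G p by (auto simp: loopfree_def)
  have con: "connects {e} t h {t a, h a}" if "{t e, h e} = {t a, h a}" for e
    unfolding connects_def
  proof (intro allI impI)
    fix S assume S: "S \<subseteq> {t a, h a}" "S \<noteq> {}" "S \<noteq> {t a, h a}"
    then have "S = {t a} \<or> S = {h a}" by blast
    then have "(t e \<in> S) \<noteq> (h e \<in> S)" using that ne by (auto simp: doubleton_eq_iff)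
    then show "cut {e} t h S \<noteq> {}" by (auto simp: cut_def)
  qed
  have sb: "t b \<in> {t a, h a}" "h b \<in> {t a, h a}" "t b \<in> V" "h b \<in> V" using p(2,4) G by (auto simp: loopfree_def)
  have "doubly_connected V E t h {t a, h a} {a} {b}"
    by unfold_locales (use G p ne con[of a] con[of b] sb in auto)
  moreover have "card {t a, h a} \<ge> 2" using ne by simp
  moreover have "f e \<notin> span2 b1 b2 \<and> f' e \<notin> span2 b1 b2" if "e \<in> {a} \<union> {b}" for e
    using that nz p X by (auto simp: X_def nzflow_def)
  ultimately show ?thesis unfolding contractible_def using bs(1) by blast
qed

text \<open>There are at most \<open>2 |W|\<close> deleted edges and bridges, with at most \<open>4 |W| < |V| / 2\<close> ends.\<close>

lemma sparse_vertex:
  assumes G: "loopfree V E t h" and four: "\<And>S. S \<subseteq> V \<Longrightarrow> S \<noteq> {} \<Longrightarrow> S \<noteq> V \<Longrightarrow> 4 \<le> card (cut E t h S)"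
    and V: "card V \<ge> 2" and s: "4 * card E < 9 * card V" and W: "W \<subseteq> E" "20 * card W \<le> card E"
  shows "\<exists>v\<in>V. card (incident E t h v) = 4 \<and> incident E t h v \<subseteq> E - W \<and>
    (\<forall>e\<in>incident E t h v. \<forall>S\<subseteq>V. cut (E - W) t h S \<noteq> {e})"
proof (rule ccontr)
  assume no: "\<not> ?thesis"
  have fin: "finite V" "finite E" and ends: "\<And>e. e \<in> E \<Longrightarrow> t e \<in> V \<and> h e \<in> V \<and> t e \<noteq> h e"
    using G by (auto simp: loopfree_def)
  define B where "B = {e\<in>E - W. \<exists>S\<subseteq>V. cut (E - W) t h S = {e}}"
  have cB: "card B \<le> card W" unfolding B_def by (rule card_bridges_le[OF G four W(1)])
  have finBW: "finite (W \<union> B)" using fin W finite_subset by (auto simp: B_def)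
  have deg4: "4 \<le> card (incident E t h v)" if v: "v \<in> V" for v
  proof -
    have "{v} \<noteq> V" using V by auto
    then have "4 \<le> card (cut E t h {v})" using four[of "{v}"] v by simp
    also have "cut E t h {v} = incident E t h v" using ends by (fastforce simp: cut_def incident_def)
    finally show ?thesis .
  qed
  let ?F = "{v\<in>V. card (incident E t h v) = 4}"
  have cF: "card V < 2 * card ?F"
    by (rule degree_four_count[OF fin(1) deg4 sum_degree[OF fin ends] s])
  have "?F \<subseteq> t ` (W \<union> B) \<union> h ` (W \<union> B)"
  proof
    fix v assume v: "v \<in> ?F"
    have "\<exists>e\<in>incident E t h v. e \<in> W \<union> B"
    proof (cases "incident E t h v \<subseteq> E - W")
      case True
      then obtain e S where "e \<in> incident E t h v" "S \<subseteq> V" "cut (E - W) t h S = {e}" using no v by blast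
      then show ?thesis using True by (auto simp: B_def)
    next
      case False
      then show ?thesis by (auto simp: incident_def)
    qed
    then obtain e where "e \<in> W \<union> B" "t e = v \<or> h e = v" by (auto simp: incident_def)
    then show "v \<in> t ` (W \<union> B) \<union> h ` (W \<union> B)" by blast
  qed
  then have "card ?F \<le> card (t ` (W \<union> B) \<union> h ` (W \<union> B))" using finBW by (intro card_mono) auto
  also have "\<dots> \<le> card (W \<union> B) + card (W \<union> B)"
    by (intro order_trans[OF card_Un_le] add_mono card_image_le finBW)
  also have "\<dots> \<le> 2 * (card W + card B)" using card_Un_le[of W B] by simp
  finally have "card ?F \<le> 4 * card W" using cB by simp
  then show False using cF s W(2) by linarith
qed

context degree_four
begin

lemma perm:
  assumes "{a, b, c, d} = I" "distinct [a, b, c, d]"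
  shows "degree_four V E t h v a b c d"
  by unfold_locales (use assms G v inc in auto)

lemma nonbridge_cut:
  assumes R: "I \<subseteq> R" "R \<subseteq> E" and nb: "\<forall>e\<in>I. \<forall>S\<subseteq>V. cut R t h S \<noteq> {e}"
    and S: "S \<subseteq> V - {v}" "count S = 1"
  shows "1 \<le> card (cut (R - I) t h S)"
proof (rule ccontr)
  assume no: "\<not> ?thesis"
  have vS: "v \<notin> S" using S by blast
  have "card (cut R t h S) = 1" using cut_at(2)[OF vS R] S no by simp
  then obtain e where e: "cut R t h S = {e}" by (rule card_1_singletonE)
  have "finite (cut (R - I) t h S)" using R fin finite_subset by (intro finite_cut) blast
  then have "cut (R - I) t h S = {}" using no by (simp add: not_le)
  then have "e \<in> I" using cut_at(1)[OF vS R] e by auto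
  then show False using nb e S by blast
qed

text \<open>For \<open>E\<close> with \<open>k = 3\<close> and for \<open>R\<close> with \<open>k = 1\<close>, at most one of the three pairings is bad, so one is good for both.\<close>

lemma good_pairing:
  assumes four: "\<And>S. S \<subseteq> V \<Longrightarrow> S \<noteq> {} \<Longrightarrow> S \<noteq> V \<Longrightarrow> 4 \<le> card (cut E t h S)"
    and R: "I \<subseteq> R" "R \<subseteq> E" and nb: "\<forall>e\<in>I. \<forall>S\<subseteq>V. cut R t h S \<noteq> {e}"
  shows "\<exists>a b c d. {a, b, c, d} = I \<and> distinct [a, b, c, d] \<and>
    \<not> bad (E - I) 3 (u a) (u b) (u c) (u d) \<and> \<not> bad (R - I) 1 (u a) (u b) (u c) (u d)"
proof -
  have oneE: "3 \<le> card (cut (E - I) t h S)" if S: "S \<subseteq> V - {v}" "count S = 1" for S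
  proof -
    have "S \<noteq> {}" using S(2) by (auto simp: count_def)
    moreover have "S \<noteq> V" "S \<subseteq> V" using S v by auto
    ultimately have "4 \<le> card (cut E t h S)" by (intro four)
    also have "\<dots> = card (cut (E - I) t h S) + count S" by (rule cut_at(2)) (use S IE in auto)
    finally show ?thesis using S by simp
  qed
  note oneR = nonbridge_cut[OF R nb]
  let ?u1 = "u e1" and ?u2 = "u e2" and ?u3 = "u e3" and ?u4 = "u e4"
  have excl: "\<not> (bad F k ?u1 ?u2 ?u3 ?u4 \<and> bad F k ?u1 ?u3 ?u2 ?u4) \<and>
      \<not> (bad F k ?u1 ?u2 ?u4 ?u3 \<and> bad F k ?u1 ?u4 ?u2 ?u3) \<and>
      \<not> (bad F k ?u1 ?u3 ?u4 ?u2 \<and> bad F k ?u1 ?u4 ?u3 ?u2)"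
    if F: "F \<subseteq> E - I" "odd k" and one: "\<And>S. S \<subseteq> V - {v} \<Longrightarrow> count S = 1 \<Longrightarrow> k \<le> card (cut F t h S)" for F k
    using one unfolding count_def
    by (intro conjI bad_exclusive[OF F]) (auto simp: add_ac)
  have sw: "bad F k a b c d \<longleftrightarrow> bad F k a b d c" for F k a b c d by (auto simp: bad_def)
  have "E - I \<subseteq> E - I" "R - I \<subseteq> E - I" using R by auto
  note x1 = excl[OF this(1) _ oneE] and x2 = excl[OF this(2) _ oneR]
  have "\<not> bad (E - I) 3 ?u1 ?u2 ?u3 ?u4 \<and> \<not> bad (R - I) 1 ?u1 ?u2 ?u3 ?u4 \<or>
    \<not> bad (E - I) 3 ?u1 ?u3 ?u2 ?u4 \<and> \<not> bad (R - I) 1 ?u1 ?u3 ?u2 ?u4 \<or>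
    \<not> bad (E - I) 3 ?u1 ?u4 ?u2 ?u3 \<and> \<not> bad (R - I) 1 ?u1 ?u4 ?u2 ?u3"
    using x1 x2 sw by auto
  then show ?thesis
  proof (elim disjE)
    assume "\<not> bad (E - I) 3 ?u1 ?u2 ?u3 ?u4 \<and> \<not> bad (R - I) 1 ?u1 ?u2 ?u3 ?u4"
    then show ?thesis using dist by blast
  next
    assume "\<not> bad (E - I) 3 ?u1 ?u3 ?u2 ?u4 \<and> \<not> bad (R - I) 1 ?u1 ?u3 ?u2 ?u4"
    moreover have "{e1, e3, e2, e4} = I" "distinct [e1, e3, e2, e4]" using dist by auto
    ultimately show ?thesis by blast
  next
    assume "\<not> bad (E - I) 3 ?u1 ?u4 ?u2 ?u3 \<and> \<not> bad (R - I) 1 ?u1 ?u4 ?u2 ?u3"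
    moreover have "{e1, e4, e2, e3} = I" "distinct [e1, e4, e2, e3]" using dist by auto
    ultimately show ?thesis by blast
  qed
qed

text \<open>The same two cycles straighten both flows, so both descend to the same split graph.\<close>

lemma sparse_step:
  fixes f f' :: "'e \<Rightarrow> 'a::ab_group_add"
  assumes four: "\<And>S. S \<subseteq> V \<Longrightarrow> S \<noteq> {} \<Longrightarrow> S \<noteq> V \<Longrightarrow> 4 \<le> card (cut E t h S)"
    and R: "I \<subseteq> R" "R \<subseteq> E" and nb: "\<forall>e\<in>I. \<forall>S\<subseteq>V. cut R t h S \<noteq> {e}"
    and good: "\<not> bad (E - I) 3 (u e1) (u e2) (u e3) (u e4)" "\<not> bad (R - I) 1 (u e1) (u e2) (u e3) (u e4)"
    and simple: "u e1 \<noteq> u e2" "u e3 \<noteq> u e4"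
    and nz: "nzflow E t h f" "nzflow E t h f'"
    and basis: "\<And>a. \<exists>x\<in>X. \<exists>y\<in>Y. a = x + y"
    and free: "\<And>e. e \<in> R \<Longrightarrow> f e \<notin> translates X Y s \<and> f' e \<notin> translates X Y s"
    and IH: "\<And>t h. loopfree (V - {v}) E' t h \<Longrightarrow>
      (\<And>S. S \<subseteq> V - {v} \<Longrightarrow> S \<noteq> {} \<Longrightarrow> S \<noteq> V - {v} \<Longrightarrow> 4 \<le> card (cut E' t h S)) \<Longrightarrow>
      (\<And>g g' :: 'e \<Rightarrow> 'a. nzflow E' t h g \<Longrightarrow> nzflow E' t h g' \<Longrightarrow> reach E' t h g g')"
  shows "reach E t h f f'"
proof -
  have one: "1 \<le> card (cut (R - I) t h S)" if S: "S \<subseteq> V - {v}" "count S = 1 \<or> count S = 3" for S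
  proof -
    note * = nonbridge_cut[OF R nb]
    show ?thesis
    proof (cases "count S = 1")
      case True
      then show ?thesis using * S by blast
    next
      case False
      have "count (V - {v} - S) = 1"
        using False S(2) u[of e1] u[of e2] u[of e3] u[of e4] by (auto simp: count_def of_bool_def split: if_splits)
      then have "1 \<le> card (cut (R - I) t h (V - {v} - S))" by (intro *) auto
      also have "cut (R - I) t h (V - {v} - S) = cut (R - I) t h S" using R ends notv by (intro cut_compl) auto
      finally show ?thesis .
    qed
  qed
  have two: "2 \<le> card (cut (R - I) t h S)" if "S \<subseteq> V - {v}" "u e1 \<in> S" "u e2 \<in> S" "u e3 \<notin> S" "u e4 \<notin> S" for S
  proof -
    have "\<not> card (cut (R - I) t h S) \<le> 1" using good(2) that unfolding bad_def by blast
    then show ?thesis by simp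
  qed
  have goodE: "4 \<le> card (cut (E - I) t h S)" if "S \<subseteq> V - {v}" "u e1 \<in> S" "u e2 \<in> S" "u e3 \<notin> S" "u e4 \<notin> S" for S
  proof -
    have "\<not> card (cut (E - I) t h S) \<le> 3" using good(1) that unfolding bad_def by blast
    then show ?thesis by simp
  qed
  obtain z1 z2 where z: "circ E t h z1" "circ E t h z2" "\<forall>e. \<bar>z1 e\<bar> \<le> (1::int)" "\<forall>e. \<bar>z2 e\<bar> \<le> (1::int)"
      "\<forall>e. z1 e = 0 \<or> z2 e = 0" "\<forall>e. e \<notin> R \<longrightarrow> z1 e = 0 \<and> z2 e = 0"
      "outv t v z1 e1 = 1" "z1 e2 = 0" "outv t v z2 e2 = 1" "z2 e1 = 0"
    using two_cycles[OF R one two] by blast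
  have st: "\<exists>g'. nzflow E t h g' \<and> straight g' \<and> reach E t h g g'"
    if g: "nzflow E t h g" and fr: "\<And>e. e \<in> R \<Longrightarrow> g e \<notin> translates X Y s" for g :: "'e \<Rightarrow> 'a"
  proof -
    obtain x y where xy: "x \<in> X" "y \<in> Y" "- (outv t v g e1 + outv t v g e2) = x + y" using basis by blast
    have "(x + s) + (y - s) = - (outv t v g e1 + outv t v g e2)" unfolding xy(3) by simp
    moreover have "g e \<noteq> x + s \<and> g e \<noteq> - (x + s) \<and> g e \<noteq> y - s \<and> g e \<noteq> - (y - s)" if "e \<in> R" for e
      using fr[OF that] xy unfolding translates_def by blast
    ultimately show ?thesis by (rule straighten[OF g z])
  qed
  obtain g where g: "nzflow E t h g" "straight g" "reach E t h f g" using st[OF nz(1)] free by blast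
  obtain g' where g': "nzflow E t h g'" "straight g'" "reach E t h f' g'" using st[OF nz(2)] free by blast
  have "reach E t h g g'"
    using split_cuts[OF four goodE] by (intro reach_split g(1,2) g'(1,2) IH split_loopfree simple)
  then show ?thesis using g(3) reach_sym[OF g'(3)] by (meson rtranclp_trans)
qed

end

text \<open>Cuts of the contracted graph are cuts of the original one, so the induction hypothesis applies to it.\<close>

lemma contraction_step:
  fixes f f' :: "'e \<Rightarrow> 'a::ab_group_add" and t h :: "'e \<Rightarrow> 'v"
  assumes D: "doubly_connected V E t h U T1 T2" and U: "card U \<ge> 2" and dis: "dissoc4 b1 b2 c1 c2"
    and four: "\<And>S. S \<subseteq> V \<Longrightarrow> S \<noteq> {} \<Longrightarrow> S \<noteq> V \<Longrightarrow> 4 \<le> card (cut E t h S)"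
    and nz: "nzflow E t h f" "nzflow E t h f'"
    and free: "\<forall>e\<in>T1 \<union> T2. f e \<notin> span2 b1 b2 \<and> f' e \<notin> span2 b1 b2"
    and IH: "\<And>V' E' (t' :: 'e \<Rightarrow> 'v) h'. card V' < card V \<Longrightarrow> loopfree V' E' t' h' \<Longrightarrow>
      (\<And>S. S \<subseteq> V' \<Longrightarrow> S \<noteq> {} \<Longrightarrow> S \<noteq> V' \<Longrightarrow> 4 \<le> card (cut E' t' h' S)) \<Longrightarrow>
      nzflow E' t' h' f \<Longrightarrow> nzflow E' t' h' f' \<Longrightarrow> reach E' t' h' f f'"
  shows "reach E t h f f'"
proof -
  interpret doubly_connected V E t h U T1 T2 by (rule D)
  obtain u0 where u0: "u0 \<in> U" using U by fastforce
  let ?o = "outer" and ?t = "quot u0 \<circ> t" and ?h = "quot u0 \<circ> h"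
  have fV: "finite V" "finite U" using G UV finite_subset by (auto simp: loopfree_def)
  have ends: "\<And>e. e \<in> E \<Longrightarrow> t e \<in> V \<and> h e \<in> V \<and> t e \<noteq> h e" using G by (auto simp: loopfree_def)
  let ?V = "insert u0 (V - U)"
  have "card ?V = Suc (card V - card U)" using fV UV u0 by (simp add: card_Diff_subset)
  moreover have "card U \<le> card V" using fV UV card_mono by blast
  ultimately have cV: "card ?V < card V" using U by linarith
  have lf: "loopfree ?V ?o ?t ?h"
    unfolding loopfree_def
  proof (intro conjI ballI)
    fix e assume e: "e \<in> ?o"
    then have *: "e \<in> E" "\<not> (t e \<in> U \<and> h e \<in> U)" by (auto simp: outer_def)
    show "?t e \<in> ?V" "?h e \<in> ?V" "?t e \<noteq> ?h e"
      using * ends[of e] u0 by (auto simp: quot_def)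
  qed (use fV outer_E(2) in auto)
  have cuts: "4 \<le> card (cut ?o ?t ?h S)" if S: "S \<subseteq> ?V" "S \<noteq> {}" "S \<noteq> ?V" for S
  proof -
    let ?S = "if u0 \<in> S then S \<union> U else S"
    have q: "quot u0 x \<in> S \<longleftrightarrow> x \<in> ?S" if "x \<in> V" for x
      using that S(1) u0 by (auto simp: quot_def)
    have "cut ?o ?t ?h S = cut E t h ?S"
    proof (rule set_eqI)
      fix e
      show "e \<in> cut ?o ?t ?h S \<longleftrightarrow> e \<in> cut E t h ?S"
      proof (cases "e \<in> E")
        case True
        have "t e \<in> U \<and> h e \<in> U \<Longrightarrow> (t e \<in> ?S) = (h e \<in> ?S)" using S(1) u0 by auto
        then show ?thesis using q[of "t e"] q[of "h e"] ends[OF True] True by (auto simp: cut_def outer_def)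
      next
        case False
        then show ?thesis by (auto simp: cut_def outer_def)
      qed
    qed
    moreover have "4 \<le> card (cut E t h ?S)"
    proof (rule four)
      show "?S \<subseteq> V" "?S \<noteq> {}" using S UV u0 by auto
      show "?S \<noteq> V"
      proof
        assume eq: "?S = V"
        then have "u0 \<in> S" using u0 UV by (auto split: if_splits)
        then have "V - U \<subseteq> S" using eq by auto
        then show False using S \<open>u0 \<in> S\<close> by blast
      qed
    qed
    ultimately show ?thesis by simp
  qed
  have nzo: "nzflow ?o ?t ?h y" if "nzflow E t h y" for y :: "'e \<Rightarrow> 'a"
    using circ_outer[OF u0, of y] that outer_E(1) by (auto simp: nzflow_def)
  have "reach ?o ?t ?h f f'"
    by (rule IH[OF cV lf _ nzo[OF nz(1)] nzo[OF nz(2)]]) (rule cuts)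
  then show ?thesis
    using reach_of_contraction[OF u0 dis nz(1) _ nz(2)] free by blast
qed

theorem any_two_flows_joined:
  fixes f f' :: "'e \<Rightarrow> 'a::{finite,ab_group_add}" and t h :: "'e \<Rightarrow> 'v"
  assumes A: "CARD('a) \<ge> 4000000"
    and "loopfree V E t h" and "\<And>S. S \<subseteq> V \<Longrightarrow> S \<noteq> {} \<Longrightarrow> S \<noteq> V \<Longrightarrow> 4 \<le> card (cut E t h S)"
    and "nzflow E t h f" "nzflow E t h f'"
  shows "reach E t h f f'"
  using assms(2-)
proof (induction "card V" arbitrary: V E t h f f' rule: less_induct)
  case less
  note G = less.prems(1) and four = less.prems(2) and nz = less.prems(3,4)
  have fin: "finite V" "finite E" and ends: "\<And>e. e \<in> E \<Longrightarrow> t e \<in> V \<and> h e \<in> V \<and> t e \<noteq> h e"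
    using G by (auto simp: loopfree_def)
  have A': "CARD('a) \<ge> 400000" using A by simp
  have contract: ?case if "contractible V E t h f f'"
  proof -
    obtain U T1 T2 b1 b2 c1 c2 where *: "card U \<ge> 2" "doubly_connected V E t h U T1 T2" "dissoc4 b1 b2 c1 c2"
      "\<forall>e\<in>T1 \<union> T2. f e \<notin> span2 b1 b2 \<and> f' e \<notin> span2 b1 b2" 
      using \<open>contractible V E t h f f'\<close> unfolding contractible_def by (elim exE conjE) (rule that)
    show ?thesis
    proof (rule contraction_step[OF *(2,1,3) _ nz *(4)])
      show "4 \<le> card (cut E t h S)" if "S \<subseteq> V" "S \<noteq> {}" "S \<noteq> V" for S using that by (rule four)
      show "reach E' t' h' f f'"
        if "card V' < card V" "loopfree V' E' t' h'"
          "\<And>S. S \<subseteq> V' \<Longrightarrow> S \<noteq> {} \<Longrightarrow> S \<noteq> V' \<Longrightarrow> 4 \<le> card (cut E' t' h' S)"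
          "nzflow E' t' h' f" "nzflow E' t' h' f'" for V' :: "'v set" and E' t' h'
        by (rule less.hyps) (fact that)+
    qed
  qed
  consider "card V \<le> 1" | "\<exists>a\<in>E. \<exists>b\<in>E. a \<noteq> b \<and> {t a, h a} = {t b, h b}"
    | "card V \<ge> 2" "9 * card V \<le> 4 * card E"
    | "card V \<ge> 2" "4 * card E < 9 * card V" "\<And>a b. a \<in> E \<Longrightarrow> b \<in> E \<Longrightarrow> {t a, h a} = {t b, h b} \<Longrightarrow> a = b"
    by (metis One_nat_def Suc_1 not_less not_less_eq_eq)
  then show ?case
  proof cases
    case 1
    have "E = {}" using ends 1 card_le_Suc0_iff_eq[OF fin(1)] by auto
    then show ?thesis using ustep_agree[OF nz(1), of f'] by auto
  next
    case 2
    then obtain a b where "a \<in> E" "b \<in> E" "a \<noteq> b" "{t a, h a} = {t b, h b}" by blast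
    then show ?thesis by (intro contract parallel_case[OF A' G nz])
  next
    case 3
    then show ?thesis by (intro contract dense_case[OF A' G _ nz])
  next
    case 4
    obtain X Y :: "'a set" where XY: "\<And>a. \<exists>x\<in>X. \<exists>y\<in>Y. a = x + y" "80 * (card X + card Y) \<le> CARD('a)"
      using thin_basis[OF A] by blast
    obtain s where s: "20 * card {e\<in>E. f e \<in> translates X Y s \<or> f' e \<in> translates X Y s} \<le> card E"
      using rare_translate[OF XY(2) fin(2), of f f'] by blast
    define W where "W = {e\<in>E. f e \<in> translates X Y s \<or> f' e \<in> translates X Y s}"
    have W: "W \<subseteq> E" "20 * card W \<le> card E" using s by (auto simp: W_def)
    obtain v where v: "v \<in> V" "card (incident E t h v) = 4" "incident E t h v \<subseteq> E - W"
      "\<forall>e\<in>incident E t h v. \<forall>S\<subseteq>V. cut (E - W) t h S \<noteq> {e}"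
      using sparse_vertex[OF G four 4(1,2) W] by blast
    have "\<exists>e1 e2 e3 e4. incident E t h v = {e1, e2, e3, e4} \<and> distinct [e1, e2, e3, e4]"
    proof -
      have "finite (incident E t h v)" using fin by (simp add: incident_def)
      then obtain xs where xs: "set xs = incident E t h v" "distinct xs" using finite_distinct_list by blast
      then have "length xs = Suc (Suc (Suc (Suc 0)))" using v(2) distinct_card[of xs] by simp
      then obtain e1 e2 e3 e4 where es: "xs = [e1, e2, e3, e4]"
        unfolding length_Suc_conv length_0_conv by (elim exE conjE) (rule that, simp)
      have "incident E t h v = {e1, e2, e3, e4} \<and> distinct [e1, e2, e3, e4]"
        using xs unfolding es by (simp only: list.set)
      then show ?thesis by (intro exI)
    qed
    then obtain e1 e2 e3 e4 where e: "incident E t h v = {e1, e2, e3, e4}" "distinct [e1, e2, e3, e4]" by blast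
    interpret P: degree_four V E t h v e1 e2 e3 e4
      by unfold_locales (use G v(1) e in auto)
    have R: "{e1, e2, e3, e4} \<subseteq> E - W" "E - W \<subseteq> E"
      and nb: "\<forall>e\<in>{e1, e2, e3, e4}. \<forall>S\<subseteq>V. cut (E - W) t h S \<noteq> {e}"
      using v(3,4) unfolding e(1) by auto
    obtain a b c d where p: "{a, b, c, d} = {e1, e2, e3, e4}" "distinct [a, b, c, d]"
      and good: "\<not> P.bad (E - {e1, e2, e3, e4}) 3 (P.u a) (P.u b) (P.u c) (P.u d)"
        "\<not> P.bad (E - W - {e1, e2, e3, e4}) 1 (P.u a) (P.u b) (P.u c) (P.u d)"
      using P.good_pairing[OF four R nb] by blast
    interpret Q: degree_four V E t h v a b c d by (rule P.perm[OF p])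
    have simple: "P.u x \<noteq> P.u y" if "x \<in> {a, b, c, d}" "y \<in> {a, b, c, d}" "x \<noteq> y" for x y
    proof
      assume eq: "P.u x = P.u y"
      have "{t x, h x} = {t y, h y}" using Q.u[OF that(1)] Q.u[OF that(2)] eq by auto
      then show False using 4(3)[of x y] Q.IE that by blast
    qed
    show ?thesis
    proof (rule Q.sparse_step[where R = "E - W" and X = X and Y = Y and s = s, OF four])
      show "{a, b, c, d} \<subseteq> E - W" "\<forall>e\<in>{a, b, c, d}. \<forall>S\<subseteq>V. cut (E - W) t h S \<noteq> {e}"
        unfolding p(1) by (rule R(1), rule nb)
      show "\<not> Q.bad (E - {a, b, c, d}) 3 (P.u a) (P.u b) (P.u c) (P.u d)"
        "\<not> Q.bad (E - W - {a, b, c, d}) 1 (P.u a) (P.u b) (P.u c) (P.u d)"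
        using good unfolding p(1) .
      show "P.u a \<noteq> P.u b" "P.u c \<noteq> P.u d" using simple p(2) by auto
      show "f e \<notin> translates X Y s \<and> f' e \<notin> translates X Y s" if "e \<in> E - W" for e
        using that by (auto simp: W_def)
      have "card (V - {v}) < card V" using fin v(1) by (intro card_Diff1_less)
      then show "reach (E - {b, d}) t h g g'"
        if "loopfree (V - {v}) (E - {b, d}) t h"
          "\<And>S. S \<subseteq> V - {v} \<Longrightarrow> S \<noteq> {} \<Longrightarrow> S \<noteq> V - {v} \<Longrightarrow> 4 \<le> card (cut (E - {b, d}) t h S)"
          "nzflow (E - {b, d}) t h g" "nzflow (E - {b, d}) t h g'" for t h and g g' :: "'e \<Rightarrow> 'a"
        using less.hyps that by blast
    qed (use nz XY in auto)
  qed
qed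

theorem theorem6p1:
  fixes G :: "('v, 'e) multigraph"
  assumes "multigraph G"
    and "edge_connected 4 G"
    and "CARD('a::{finite,ab_group_add}) \<ge> 62 * (56^2 * 27 + 27) + 1"
  shows "flow_connected TYPE('a) G"
  unfolding flow_connected_def
proof (intro allI impI ballI)
  fix D :: "('v, 'e) pre_digraph" and f f' :: "'e \<Rightarrow> 'a"
  assume D: "orientation_of D G" and f: "f \<in> flows D" and f': "f' \<in> flows D"
  have lf: "loopfree (vertices G) (edges G) (tail D) (head D)"
    unfolding loopfree_def
  proof (intro conjI ballI)
    fix e assume e: "e \<in> edges G"
    then have *: "ends G e = {tail D e, head D e}" "ends G e \<subseteq> vertices G" "card (ends G e) = 2"
      using assms(1) D by (auto simp: multigraph_def orientation_of_def)
    then show "tail D e \<in> vertices G" "head D e \<in> vertices G" by auto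
    show "tail D e \<noteq> head D e" using * by auto
  qed (use assms(1) in \<open>auto simp: multigraph_def\<close>)
  have "reach (edges G) (tail D) (head D) f f'"
    using assms(3) f f' edge_connected_cut[OF assms(1) D assms(2)]
    by (intro any_two_flows_joined[OF _ lf]) (auto simp: flows_iff[OF assms(1) D])
  then have "equivalent_flows G D (restrict f (edges G)) (restrict f' (edges G))"
    by (rule reach_equivalent[OF assms(1) D])
  moreover have "restrict f (edges G) = f" "restrict f' (edges G) = f'"
    using f f' by (auto simp: flows_iff[OF assms(1) D] extensional_restrict)
  ultimately show "equivalent_flows G D f f'" by simp
qed

end
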